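(* Let $\mathscr{J}$ be a system of arities in a symmetric monoidal closed category $\mathscr{V}$ such that $\mathscr{V}_0$ has pullbacks, and let $\mathscr{C}$ be a $\mathscr{J}$-admissible $\mathscr{V}$-category. Given an algebra $A$ in $\mathscr{C}$, the following are equivalent: (1) $A$ is commutative; (2) $A^\perp$ is contracommutative; (3) $A^{\perp\perp}$ is commutative; (4) $A$ commutes with $A^{\perp\perp}$.
   Context: Base setting. $\mathscr{V}$ is a symmetric monoidal closed category with unit object $I$ and underlying ordinary category $\mathscr{V}_0$. By universe enlargement, $\mathscr{V}$ is a full subcategory of a symmetric monoidal closed category $\mathscr{V}'$ that is complete and cocomplete relative to a universe in which everything considered is small, with $\mathscr{V}\hookrightarrow\mathscr{V}'$ preserving all limits that exist in $\mathscr{V}$; $\mathscr{V}$-functor categories exist as $\mathscr{V}'$-categories. A system of arities is a fully faithful symmetric strong monoidal $\mathscr{V}$-functor $\mathscr{J}\to\mathscr{V}$, written as the inclusion of a full sub-$\mathscr{V}$-category containing $I$ and closed under $\otimes$ ($\mathscr{J}$ need not be small). A $\mathscr{J}$-cotensor in a $\mathscr{V}$-category is a cotensor $[J,C]$ with $J\in\mathrm{ob}\,\mathscr{J}$; $\mathscr{V}$-categories with $\mathscr{J}$-cotensors are equipped with designated ones, with $[I,C]=C$ (and identity counit). A $\mathscr{J}$-theory is a $\mathscr{V}$-category $\mathscr{T}$ equipped with an identity-on-objects $\mathscr{V}$-functor $\tau:\mathscr{J}^{\mathrm{op}}\to\mathscr{T}$ that preserves $\mathscr{J}$-cotensors; equivalently,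 $\mathrm{ob}\,\mathscr{T}=\mathrm{ob}\,\mathscr{J}$ and each object $J$ is equipped with a morphism $J\to\mathscr{T}(J,I)$ exhibiting $J$ as a cotensor $[J,I]$ in $\mathscr{T}$, which for $J=I$ is the identity on $I$. A morphism of $\mathscr{J}$-theories is a $\mathscr{V}$-functor commuting with the structure $\mathscr{V}$-functors $\tau$. For a $\mathscr{V}$-category $\mathscr{C}$ with $\mathscr{J}$-cotensors, a $\mathscr{T}$-algebra in $\mathscr{C}$ is a $\mathscr{V}$-functor $A:\mathscr{T}\to\mathscr{C}$ preserving $\mathscr{J}$-cotensors; its carrier is $|A|=A(I)$. $\mathscr{T}\text{-}\mathrm{Alg}(\mathscr{C})$ is the full sub-$\mathscr{V}'$-category of $[\mathscr{T},\mathscr{C}]$ on the $\mathscr{T}$-algebras; for a morphism $f$ in it, $|f|=f_I$. $\mathscr{C}$ is $\mathscr{J}$-admissible if it has $\mathscr{J}$-cotensors and for every $\mathscr{J}$-theory $\mathscr{T}$ the ends defining the hom-objects of $\mathscr{T}\text{-}\mathrm{Alg}(\mathscr{C})$ exist in $\mathscr{V}$ (so it is a $\mathscr{V}$-category). $\mathscr{J}$-cotensors in $\mathscr{T}\text{-}\mathrm{Alg}(\mathscr{C})$ are pointwise, with designated ones chosen so that evaluation at $I$ sends them to the designated ones in $\mathscr{C}$. Algebras and commutants. An algebra in $\mathscr{C}$ is a pair $(\mathscr{T},A)$ (also written $A$) with $\mathscr{T}$ a $\mathscr{J}$-theory and $A$ a $\mathscr{T}$-algebra in $\mathscr{C}$.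 For an object $C$ of $\mathscr{C}$, $\mathrm{Alg}(C)$ is the category of algebras with carrier $C$, where a morphism $(M,f):(\mathscr{T},A)\to(\mathscr{U},B)$ consists of a morphism of $\mathscr{J}$-theories $M:\mathscr{T}\to\mathscr{U}$ and an isomorphism $f:A\to BM$ of $\mathscr{T}$-algebras with $|f|=1_C$. The commutant of $(\mathscr{T},A)$ is the algebra $A^\perp=(\mathscr{T}^\perp_A,A^\perp)$, where $\mathscr{T}^\perp_A$ is the $\mathscr{J}$-theory with $\mathscr{T}^\perp_A(J,K)=\mathscr{T}\text{-}\mathrm{Alg}(\mathscr{C})([J,A],[K,A])$ ($J,K\in\mathrm{ob}\,\mathscr{J}$), with composition and identities as in $\mathscr{T}\text{-}\mathrm{Alg}(\mathscr{C})$ and structure morphisms $J\to\mathscr{T}\text{-}\mathrm{Alg}(\mathscr{C})([J,A],A)$ the cotensor counits, and $A^\perp:\mathscr{T}^\perp_A\to\mathscr{C}$ is the algebra on $|A|$ given by $J\mapsto[J,|A|]$ and on homs by evaluation at $I$. $A^{\perp\perp}$ is the commutant of $A^\perp$. Given algebras $A,B$ on $C$, $A$ commutes with $B$ if there is a (necessarily unique) morphism $B\to A^\perp$ in $\mathrm{Alg}(C)$. $A$ is commutative if $A$ commutes with itself, and contracommutative if $A^\perp$ is commutative. *)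

theory Defs
  imports Main
begin

section \<open>Symmetric monoidal closed categories\<close>

text \<open>
  Arrows live in a single type and carry their source and target. The operation
  \<open>ihom\<close> is the internal hom, written \<open>X \<Rrightarrow> Y\<close>; \<open>evaluation X Y\<close> is the evaluation
  \<open>(X \<Rrightarrow> Y) \<otimes> X \<rightarrow> Y\<close>. The tensor product of arrows is written \<open>\<boxtimes>\<close>.
\<close>

record ('o, 'm) smc_structure =
  objs :: "'o set"
  arrs :: "'m set"
  source :: "'m \<Rightarrow> 'o"
  target :: "'m \<Rightarrow> 'o"
  idt :: "'o \<Rightarrow> 'm" ("\<one>\<index>")
  compose :: "'m \<Rightarrow> 'm \<Rightarrow> 'm" (infixr "\<cdot>\<index>" 55)
  unit_object :: "'o" ("\<I>\<index>")
  tensor_obj :: "'o \<Rightarrow> 'o \<Rightarrow> 'o" (infixr "\<otimes>\<index>" 70)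
  tensor_arr :: "'m \<Rightarrow> 'm \<Rightarrow> 'm" (infixr "\<boxtimes>\<index>" 70)
  associator :: "'o \<Rightarrow> 'o \<Rightarrow> 'o \<Rightarrow> 'm" ("\<a>\<index>")
  left_unitor :: "'o \<Rightarrow> 'm" ("\<l>\<index>")
  right_unitor :: "'o \<Rightarrow> 'm" ("\<r>\<index>")
  symm :: "'o \<Rightarrow> 'o \<Rightarrow> 'm" ("\<s>\<index>")
  ihom :: "'o \<Rightarrow> 'o \<Rightarrow> 'o" (infixr "\<Rrightarrow>\<index>" 65)
  evaluation :: "'o \<Rightarrow> 'o \<Rightarrow> 'm" ("\<e>\<index>")

text \<open>The set \<open>\<V> X Y\<close> of arrows from \<open>X\<close> to \<open>Y\<close> in the underlying ordinary category.\<close>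

definition arrows :: "('o, 'm) smc_structure \<Rightarrow> 'o \<Rightarrow> 'o \<Rightarrow> 'm set" ("\<V>\<index>") where
  "arrows V X Y = {f \<in> arrs V. source V f = X \<and> target V f = Y}"

definition is_inverse :: "('o, 'm) smc_structure \<Rightarrow> 'o \<Rightarrow> 'o \<Rightarrow> 'm \<Rightarrow> 'm \<Rightarrow> bool" where
  "is_inverse V X Y f g \<longleftrightarrow>
     f \<in> arrows V X Y \<and> g \<in> arrows V Y X \<and> compose V g f = idt V X \<and> compose V f g = idt V Y"

definition is_iso :: "('o, 'm) smc_structure \<Rightarrow> 'o \<Rightarrow> 'o \<Rightarrow> 'm \<Rightarrow> bool" where
  "is_iso V X Y f \<longleftrightarrow> (\<exists>g. is_inverse V X Y f g)"

definition inv_arr :: "('o, 'm) smc_structure \<Rightarrow> 'o \<Rightarrow> 'o \<Rightarrow> 'm \<Rightarrow> 'm" where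
  "inv_arr V X Y f = (THE g. is_inverse V X Y f g)"

locale smc_category =
  fixes V :: "('o, 'm) smc_structure" (structure)
  assumes source_obj: "f \<in> arrs V \<Longrightarrow> source V f \<in> objs V"
    and target_obj: "f \<in> arrs V \<Longrightarrow> target V f \<in> objs V"
    and idt_arr: "X \<in> objs V \<Longrightarrow> \<one> X \<in> \<V> X X"
    and comp_arr: "\<lbrakk>f \<in> \<V> X Y; g \<in> \<V> Y Z\<rbrakk> \<Longrightarrow> g \<cdot> f \<in> \<V> X Z"
    and comp_idt_left: "f \<in> \<V> X Y \<Longrightarrow> \<one> Y \<cdot> f = f"
    and comp_idt_right: "f \<in> \<V> X Y \<Longrightarrow> f \<cdot> \<one> X = f"
    and comp_assoc: "\<lbrakk>f \<in> \<V> W X; g \<in> \<V> X Y; h \<in> \<V> Y Z\<rbrakk> \<Longrightarrow> (h \<cdot> g) \<cdot> f = h \<cdot> (g \<cdot> f)"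
    and unit_obj: "\<I> \<in> objs V"
    and tensor_obj: "\<lbrakk>X \<in> objs V; Y \<in> objs V\<rbrakk> \<Longrightarrow> X \<otimes> Y \<in> objs V"
    and tensor_arr: "\<lbrakk>f \<in> \<V> X X'; g \<in> \<V> Y Y'\<rbrakk> \<Longrightarrow> f \<boxtimes> g \<in> \<V> (X \<otimes> Y) (X' \<otimes> Y')"
    and tensor_idt: "\<lbrakk>X \<in> objs V; Y \<in> objs V\<rbrakk> \<Longrightarrow> \<one> X \<boxtimes> \<one> Y = \<one> (X \<otimes> Y)"
    and tensor_comp:
      "\<lbrakk>f \<in> \<V> X X'; f' \<in> \<V> X' X''; g \<in> \<V> Y Y'; g' \<in> \<V> Y' Y''\<rbrakk>
       \<Longrightarrow> (f' \<cdot> f) \<boxtimes> (g' \<cdot> g) = (f' \<boxtimes> g') \<cdot> (f \<boxtimes> g)"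
    and associator_iso:
      "\<lbrakk>X \<in> objs V; Y \<in> objs V; Z \<in> objs V\<rbrakk>
       \<Longrightarrow> is_iso V ((X \<otimes> Y) \<otimes> Z) (X \<otimes> (Y \<otimes> Z)) (\<a> X Y Z)"
    and associator_natural:
      "\<lbrakk>f \<in> \<V> X X'; g \<in> \<V> Y Y'; h \<in> \<V> Z Z'\<rbrakk>
       \<Longrightarrow> \<a> X' Y' Z' \<cdot> ((f \<boxtimes> g) \<boxtimes> h) = (f \<boxtimes> (g \<boxtimes> h)) \<cdot> \<a> X Y Z"
    and left_unitor_iso: "X \<in> objs V \<Longrightarrow> is_iso V (\<I> \<otimes> X) X (\<l> X)"
    and left_unitor_natural: "f \<in> \<V> X Y \<Longrightarrow> \<l> Y \<cdot> (\<one> \<I> \<boxtimes> f) = f \<cdot> \<l> X"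
    and right_unitor_iso: "X \<in> objs V \<Longrightarrow> is_iso V (X \<otimes> \<I>) X (\<r> X)"
    and right_unitor_natural: "f \<in> \<V> X Y \<Longrightarrow> \<r> Y \<cdot> (f \<boxtimes> \<one> \<I>) = f \<cdot> \<r> X"
    and symm_arr: "\<lbrakk>X \<in> objs V; Y \<in> objs V\<rbrakk> \<Longrightarrow> \<s> X Y \<in> \<V> (X \<otimes> Y) (Y \<otimes> X)"
    and symm_natural:
      "\<lbrakk>f \<in> \<V> X X'; g \<in> \<V> Y Y'\<rbrakk> \<Longrightarrow> \<s> X' Y' \<cdot> (f \<boxtimes> g) = (g \<boxtimes> f) \<cdot> \<s> X Y"
    and symm_symm: "\<lbrakk>X \<in> objs V; Y \<in> objs V\<rbrakk> \<Longrightarrow> \<s> Y X \<cdot> \<s> X Y = \<one> (X \<otimes> Y)"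
    and pentagon:
      "\<lbrakk>W \<in> objs V; X \<in> objs V; Y \<in> objs V; Z \<in> objs V\<rbrakk>
       \<Longrightarrow> \<a> W X (Y \<otimes> Z) \<cdot> \<a> (W \<otimes> X) Y Z
         = (\<one> W \<boxtimes> \<a> X Y Z) \<cdot> \<a> W (X \<otimes> Y) Z \<cdot> (\<a> W X Y \<boxtimes> \<one> Z)"
    and triangle:
      "\<lbrakk>X \<in> objs V; Y \<in> objs V\<rbrakk> \<Longrightarrow> (\<one> X \<boxtimes> \<l> Y) \<cdot> \<a> X \<I> Y = \<r> X \<boxtimes> \<one> Y"
    and hexagon:
      "\<lbrakk>X \<in> objs V; Y \<in> objs V; Z \<in> objs V\<rbrakk>
       \<Longrightarrow> \<a> Y Z X \<cdot> \<s> X (Y \<otimes> Z) \<cdot> \<a> X Y Z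
         = (\<one> Y \<boxtimes> \<s> X Z) \<cdot> \<a> Y X Z \<cdot> (\<s> X Y \<boxtimes> \<one> Z)"
    and ihom_obj: "\<lbrakk>X \<in> objs V; Y \<in> objs V\<rbrakk> \<Longrightarrow> X \<Rrightarrow> Y \<in> objs V"
    and eval_arr: "\<lbrakk>X \<in> objs V; Y \<in> objs V\<rbrakk> \<Longrightarrow> \<e> X Y \<in> \<V> ((X \<Rrightarrow> Y) \<otimes> X) Y"
    and closed:
      "\<lbrakk>X \<in> objs V; Y \<in> objs V; Z \<in> objs V; f \<in> \<V> (Z \<otimes> X) Y\<rbrakk>
       \<Longrightarrow> \<exists>!g. g \<in> \<V> Z (X \<Rrightarrow> Y) \<and> \<e> X Y \<cdot> (g \<boxtimes> \<one> X) = f"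

section \<open>Enriched categories\<close>

text \<open>
  \<open>Comp C X Y Z\<close> is the composition \<open>C(Y,Z) \<otimes> C(X,Y) \<rightarrow> C(X,Z)\<close> and \<open>Ide C X\<close> is
  the identity \<open>\<I> \<rightarrow> C(X,X)\<close>.
\<close>

record ('a, 'o, 'm) vcat =
  Ob :: "'a set"
  Hom :: "'a \<Rightarrow> 'a \<Rightarrow> 'o"
  Comp :: "'a \<Rightarrow> 'a \<Rightarrow> 'a \<Rightarrow> 'm"
  Ide :: "'a \<Rightarrow> 'm"

record ('a, 'b, 'm) vfun =
  obj_map :: "'a \<Rightarrow> 'b"
  hom_map :: "'a \<Rightarrow> 'a \<Rightarrow> 'm"

text \<open>
  Designated cotensors: \<open>cotensor_ob C J X\<close> is the cotensor \<open>[J,X]\<close>, with counit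
  \<open>counit C J X : J \<rightarrow> C([J,X],X)\<close>.
\<close>

record ('a, 'o, 'm) cotensored_vcat = "('a, 'o, 'm) vcat" +
  cotensor_ob :: "'o \<Rightarrow> 'a \<Rightarrow> 'a"
  counit :: "'o \<Rightarrow> 'a \<Rightarrow> 'm"

context smc_category
begin

definition has_pullbacks :: bool where
  "has_pullbacks \<longleftrightarrow>
     (\<forall>X Y Z f g. f \<in> \<V> X Z \<longrightarrow> g \<in> \<V> Y Z \<longrightarrow>
       (\<exists>P p q. p \<in> \<V> P X \<and> q \<in> \<V> P Y \<and> f \<cdot> p = g \<cdot> q \<and>
         (\<forall>W u v. u \<in> \<V> W X \<longrightarrow> v \<in> \<V> W Y \<longrightarrow> f \<cdot> u = g \<cdot> v \<longrightarrow>
           (\<exists>!h. h \<in> \<V> W P \<and> p \<cdot> h = u \<and> q \<cdot> h = v))))"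

definition curry_arr :: "'o \<Rightarrow> 'o \<Rightarrow> 'o \<Rightarrow> 'm \<Rightarrow> 'm" where
  "curry_arr Z X Y f = (THE g. g \<in> \<V> Z (X \<Rrightarrow> Y) \<and> \<e> X Y \<cdot> (g \<boxtimes> \<one> X) = f)"

definition is_vcat :: "('a, 'o, 'm, 'z) vcat_scheme \<Rightarrow> bool" where
  "is_vcat C \<longleftrightarrow>
     (\<forall>X \<in> Ob C. \<forall>Y \<in> Ob C. Hom C X Y \<in> objs V) \<and>
     (\<forall>X \<in> Ob C. \<forall>Y \<in> Ob C. \<forall>Z \<in> Ob C.
        Comp C X Y Z \<in> \<V> (Hom C Y Z \<otimes> Hom C X Y) (Hom C X Z)) \<and>
     (\<forall>X \<in> Ob C. Ide C X \<in> \<V> \<I> (Hom C X X)) \<and>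
     (\<forall>W \<in> Ob C. \<forall>X \<in> Ob C. \<forall>Y \<in> Ob C. \<forall>Z \<in> Ob C.
        Comp C W X Z \<cdot> (Comp C X Y Z \<boxtimes> \<one> (Hom C W X)) =
        Comp C W Y Z \<cdot> (\<one> (Hom C Y Z) \<boxtimes> Comp C W X Y) \<cdot> \<a> (Hom C Y Z) (Hom C X Y) (Hom C W X)) \<and>
     (\<forall>X \<in> Ob C. \<forall>Y \<in> Ob C.
        Comp C X Y Y \<cdot> (Ide C Y \<boxtimes> \<one> (Hom C X Y)) = \<l> (Hom C X Y) \<and>
        Comp C X X Y \<cdot> (\<one> (Hom C X Y) \<boxtimes> Ide C X) = \<r> (Hom C X Y))"

definition is_vfun ::
  "('a, 'o, 'm, 'y) vcat_scheme \<Rightarrow> ('b, 'o, 'm, 'z) vcat_scheme \<Rightarrow> ('a, 'b, 'm) vfun \<Rightarrow> bool" where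
  "is_vfun B C F \<longleftrightarrow>
     (\<forall>X \<in> Ob B. obj_map F X \<in> Ob C) \<and>
     (\<forall>X \<in> Ob B. \<forall>Y \<in> Ob B.
        hom_map F X Y \<in> \<V> (Hom B X Y) (Hom C (obj_map F X) (obj_map F Y))) \<and>
     (\<forall>X \<in> Ob B. \<forall>Y \<in> Ob B. \<forall>Z \<in> Ob B.
        hom_map F X Z \<cdot> Comp B X Y Z =
        Comp C (obj_map F X) (obj_map F Y) (obj_map F Z) \<cdot> (hom_map F Y Z \<boxtimes> hom_map F X Y)) \<and>
     (\<forall>X \<in> Ob B. hom_map F X X \<cdot> Ide B X = Ide C (obj_map F X))"

definition vfun_comp :: "('b, 'c, 'm) vfun \<Rightarrow> ('a, 'b, 'm) vfun \<Rightarrow> ('a, 'c, 'm) vfun" where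
  "vfun_comp G F =
     \<lparr>obj_map = (\<lambda>X. obj_map G (obj_map F X)),
      hom_map = (\<lambda>X Y. hom_map G (obj_map F X) (obj_map F Y) \<cdot> hom_map F X Y)\<rparr>"

text \<open>Equality of functors on objects and hom-objects, ignoring values off the domain.\<close>

definition vfun_eq ::
  "('a, 'o, 'm, 'z) vcat_scheme \<Rightarrow> ('a, 'b, 'm) vfun \<Rightarrow> ('a, 'b, 'm) vfun \<Rightarrow> bool" where
  "vfun_eq B F G \<longleftrightarrow>
     (\<forall>X \<in> Ob B. obj_map F X = obj_map G X) \<and>
     (\<forall>X \<in> Ob B. \<forall>Y \<in> Ob B. hom_map F X Y = hom_map G X Y)"

definition is_vnat ::
  "('a, 'o, 'm, 'y) vcat_scheme \<Rightarrow> ('b, 'o, 'm, 'z) vcat_scheme \<Rightarrow>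
   ('a, 'b, 'm) vfun \<Rightarrow> ('a, 'b, 'm) vfun \<Rightarrow> ('a \<Rightarrow> 'm) \<Rightarrow> bool" where
  "is_vnat B C F G t \<longleftrightarrow>
     (\<forall>X \<in> Ob B. t X \<in> \<V> \<I> (Hom C (obj_map F X) (obj_map G X))) \<and>
     (\<forall>X \<in> Ob B. \<forall>Y \<in> Ob B.
        Comp C (obj_map F X) (obj_map F Y) (obj_map G Y) \<cdot> (t Y \<boxtimes> hom_map F X Y)
          \<cdot> inv_arr V (\<I> \<otimes> Hom B X Y) (Hom B X Y) (\<l> (Hom B X Y)) =
        Comp C (obj_map F X) (obj_map G X) (obj_map G Y) \<cdot> (hom_map G X Y \<boxtimes> t X)
          \<cdot> inv_arr V (Hom B X Y \<otimes> \<I>) (Hom B X Y) (\<r> (Hom B X Y)))"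

text \<open>Composition of arrows \<open>g : \<I> \<rightarrow> C(Y,Z)\<close> and \<open>f : \<I> \<rightarrow> C(X,Y)\<close> of the
  underlying ordinary category of \<open>C\<close>.\<close>

definition ucomp ::
  "('b, 'o, 'm, 'z) vcat_scheme \<Rightarrow> 'b \<Rightarrow> 'b \<Rightarrow> 'b \<Rightarrow> 'm \<Rightarrow> 'm \<Rightarrow> 'm" where
  "ucomp C X Y Z g f = Comp C X Y Z \<cdot> (g \<boxtimes> f) \<cdot> inv_arr V (\<I> \<otimes> \<I>) \<I> (\<l> \<I>)"

definition is_vnat_iso ::
  "('a, 'o, 'm, 'y) vcat_scheme \<Rightarrow> ('b, 'o, 'm, 'z) vcat_scheme \<Rightarrow>
   ('a, 'b, 'm) vfun \<Rightarrow> ('a, 'b, 'm) vfun \<Rightarrow> ('a \<Rightarrow> 'm) \<Rightarrow> bool" where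
  "is_vnat_iso B C F G t \<longleftrightarrow>
     is_vnat B C F G t \<and>
     (\<exists>u. is_vnat B C G F u \<and>
       (\<forall>X \<in> Ob B.
          ucomp C (obj_map F X) (obj_map G X) (obj_map F X) (u X) (t X) = Ide C (obj_map F X) \<and>
          ucomp C (obj_map G X) (obj_map F X) (obj_map G X) (t X) (u X) = Ide C (obj_map G X)))"

definition self_vcat :: "('o, 'o, 'm) vcat" where
  "self_vcat =
     \<lparr>Ob = objs V,
      Hom = (\<lambda>X Y. X \<Rrightarrow> Y),
      Comp = (\<lambda>X Y Z. curry_arr ((Y \<Rrightarrow> Z) \<otimes> (X \<Rrightarrow> Y)) X Z
                (\<e> Y Z \<cdot> (\<one> (Y \<Rrightarrow> Z) \<boxtimes> \<e> X Y) \<cdot> \<a> (Y \<Rrightarrow> Z) (X \<Rrightarrow> Y) X)),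
      Ide = (\<lambda>X. curry_arr \<I> X X (\<l> X))\<rparr>"

definition full_sub :: "('a, 'o, 'm) vcat \<Rightarrow> 'a set \<Rightarrow> ('a, 'o, 'm) vcat" where
  "full_sub C S = C\<lparr>Ob := S\<rparr>"

definition op_vcat :: "('a, 'o, 'm) vcat \<Rightarrow> ('a, 'o, 'm) vcat" where
  "op_vcat C =
     \<lparr>Ob = Ob C,
      Hom = (\<lambda>X Y. Hom C Y X),
      Comp = (\<lambda>X Y Z. Comp C Z Y X \<cdot> \<s> (Hom C Z Y) (Hom C Y X)),
      Ide = Ide C\<rparr>"

subsection \<open>Cotensors\<close>

text \<open>The comparison \<open>C(Y,D) \<rightarrow> [J, C(Y,X)]\<close> induced by \<open>c : J \<rightarrow> C(D,X)\<close>.\<close>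

definition cotensor_comparison ::
  "('a, 'o, 'm, 'z) vcat_scheme \<Rightarrow> 'o \<Rightarrow> 'a \<Rightarrow> 'a \<Rightarrow> 'm \<Rightarrow> 'a \<Rightarrow> 'm" where
  "cotensor_comparison C J X D c Y =
     curry_arr (Hom C Y D) J (Hom C Y X)
       (Comp C Y D X \<cdot> (c \<boxtimes> \<one> (Hom C Y D)) \<cdot> \<s> (Hom C Y D) J)"

definition is_cotensor ::
  "('a, 'o, 'm, 'z) vcat_scheme \<Rightarrow> 'o \<Rightarrow> 'a \<Rightarrow> 'a \<Rightarrow> 'm \<Rightarrow> bool" where
  "is_cotensor C J X D c \<longleftrightarrow>
     D \<in> Ob C \<and> c \<in> \<V> J (Hom C D X) \<and>
     (\<forall>Y \<in> Ob C. is_iso V (Hom C Y D) (J \<Rrightarrow> Hom C Y X) (cotensor_comparison C J X D c Y))"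

text \<open>The arrow \<open>Z \<rightarrow> C(Y,[J,X])\<close> corresponding to \<open>f : Z \<otimes> J \<rightarrow> C(Y,X)\<close>.\<close>

definition cotensor_lift ::
  "('a, 'o, 'm, 'z) cotensored_vcat_scheme \<Rightarrow> 'o \<Rightarrow> 'a \<Rightarrow> 'o \<Rightarrow> 'a \<Rightarrow> 'm \<Rightarrow> 'm" where
  "cotensor_lift C J X Z Y f =
     (THE h. h \<in> \<V> Z (Hom C Y (cotensor_ob C J X)) \<and>
        cotensor_comparison C J X (cotensor_ob C J X) (counit C J X) Y \<cdot> h = curry_arr Z J (Hom C Y X) f)"

text \<open>The hom-maps \<open>C(X,Y) \<rightarrow> C([J,X],[J,Y])\<close> and \<open>[K,J] \<rightarrow> C([J,X],[K,X])\<close> of the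
  cotensor functors \<open>[J,-]\<close> and \<open>[-,X]\<close>.\<close>

definition cot_map :: "('a, 'o, 'm, 'z) cotensored_vcat_scheme \<Rightarrow> 'o \<Rightarrow> 'a \<Rightarrow> 'a \<Rightarrow> 'm" where
  "cot_map C J X Y =
     cotensor_lift C J Y (Hom C X Y) (cotensor_ob C J X)
       (Comp C (cotensor_ob C J X) X Y \<cdot> (\<one> (Hom C X Y) \<boxtimes> counit C J X))"

definition cot_comap :: "('a, 'o, 'm, 'z) cotensored_vcat_scheme \<Rightarrow> 'a \<Rightarrow> 'o \<Rightarrow> 'o \<Rightarrow> 'm" where
  "cot_comap C X J K =
     cotensor_lift C K X (K \<Rrightarrow> J) (cotensor_ob C J X) (counit C J X \<cdot> \<e> K J)"

end

section \<open>Theories and algebras for a system of arities\<close>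

text \<open>\<open>str\<close> is the structure functor \<open>\<J>\<^sup>o\<^sup>p \<rightarrow> T\<close>.\<close>

record ('o, 'm) jtheory = "('o, 'o, 'm) vcat" +
  str :: "('o, 'o, 'm) vfun"

type_synonym ('c, 'o, 'm) alg = "('o, 'm) jtheory \<times> ('o, 'c, 'm) vfun"

locale system_of_arities = smc_category V
  for V :: "('o, 'm) smc_structure" (structure) +
  fixes \<J> :: "'o set"
  assumes arities_subset: "\<J> \<subseteq> objs V"
    and arities_unit: "\<I> \<in> \<J>"
    and arities_tensor: "\<lbrakk>J \<in> \<J>; K \<in> \<J>\<rbrakk> \<Longrightarrow> J \<otimes> K \<in> \<J>"
begin

definition arities_op :: "('o, 'o, 'm) vcat" where
  "arities_op = op_vcat (full_sub self_vcat \<J>)"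

definition preserves_cotensors ::
  "('a, 'o, 'm, 'y) vcat_scheme \<Rightarrow> ('b, 'o, 'm, 'z) vcat_scheme \<Rightarrow> ('a, 'b, 'm) vfun \<Rightarrow> bool" where
  "preserves_cotensors B C F \<longleftrightarrow>
     (\<forall>J \<in> \<J>. \<forall>X \<in> Ob B. \<forall>D c. is_cotensor B J X D c \<longrightarrow>
        is_cotensor C J (obj_map F X) (obj_map F D) (hom_map F D X \<cdot> c))"

definition has_designated_cotensors :: "('c, 'o, 'm, 'z) cotensored_vcat_scheme \<Rightarrow> bool" where
  "has_designated_cotensors C \<longleftrightarrow>
     (\<forall>J \<in> \<J>. \<forall>X \<in> Ob C. is_cotensor C J X (cotensor_ob C J X) (counit C J X)) \<and>
     (\<forall>X \<in> Ob C. cotensor_ob C \<I> X = X \<and> counit C \<I> X = Ide C X)"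

definition is_theory :: "('o, 'm) jtheory \<Rightarrow> bool" where
  "is_theory T \<longleftrightarrow>
     is_vcat T \<and> Ob T = \<J> \<and> is_vfun arities_op T (str T) \<and>
     (\<forall>J \<in> \<J>. obj_map (str T) J = J) \<and>
     preserves_cotensors arities_op T (str T)"

definition is_theory_morphism ::
  "('o, 'm) jtheory \<Rightarrow> ('o, 'm) jtheory \<Rightarrow> ('o, 'o, 'm) vfun \<Rightarrow> bool" where
  "is_theory_morphism T U M \<longleftrightarrow>
     is_vfun T U M \<and> vfun_eq arities_op (vfun_comp M (str T)) (str U)"

definition is_talg ::
  "('o, 'm) jtheory \<Rightarrow> ('c, 'o, 'm, 'z) cotensored_vcat_scheme \<Rightarrow> ('o, 'c, 'm) vfun \<Rightarrow> bool" where
  "is_talg T C A \<longleftrightarrow> is_vfun T C A \<and> preserves_cotensors T C A"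

subsection \<open>The enriched category of algebras of a theory\<close>

text \<open>
  A wedge from \<open>E\<close> to \<open>(S,S') \<mapsto> C(A S, B S')\<close>. The wedge condition, an equality of arrows
  \<open>E \<rightarrow> [T(S,S'), C(A S, B S')]\<close>, is written in its transposed form on \<open>E \<otimes> T(S,S')\<close>.
\<close>

definition is_wedge ::
  "('o, 'm) jtheory \<Rightarrow> ('c, 'o, 'm, 'z) cotensored_vcat_scheme \<Rightarrow>
   ('o, 'c, 'm) vfun \<Rightarrow> ('o, 'c, 'm) vfun \<Rightarrow> 'o \<Rightarrow> ('o \<Rightarrow> 'm) \<Rightarrow> bool" where
  "is_wedge T C A B E p \<longleftrightarrow>
     E \<in> objs V \<and>
     (\<forall>S \<in> Ob T. p S \<in> \<V> E (Hom C (obj_map A S) (obj_map B S))) \<and>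
     (\<forall>S \<in> Ob T. \<forall>S' \<in> Ob T.
        Comp C (obj_map A S) (obj_map A S') (obj_map B S') \<cdot> (p S' \<boxtimes> hom_map A S S') =
        Comp C (obj_map A S) (obj_map B S) (obj_map B S') \<cdot> (hom_map B S S' \<boxtimes> p S)
          \<cdot> \<s> E (Hom T S S'))"

definition is_end ::
  "('o, 'm) jtheory \<Rightarrow> ('c, 'o, 'm, 'z) cotensored_vcat_scheme \<Rightarrow>
   ('o, 'c, 'm) vfun \<Rightarrow> ('o, 'c, 'm) vfun \<Rightarrow> 'o \<Rightarrow> ('o \<Rightarrow> 'm) \<Rightarrow> bool" where
  "is_end T C A B E p \<longleftrightarrow>
     is_wedge T C A B E p \<and>
     (\<forall>X q. is_wedge T C A B X q \<longrightarrow> (\<exists>!h. h \<in> \<V> X E \<and> (\<forall>S \<in> Ob T. p S \<cdot> h = q S)))"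

definition admissible :: "('c, 'o, 'm, 'z) cotensored_vcat_scheme \<Rightarrow> bool" where
  "admissible C \<longleftrightarrow>
     is_vcat C \<and> has_designated_cotensors C \<and>
     (\<forall>T A B. is_theory T \<longrightarrow> is_talg T C A \<longrightarrow> is_talg T C B \<longrightarrow> (\<exists>E p. is_end T C A B E p))"

text \<open>A fixed choice of the end defining the hom-object from \<open>A\<close> to \<open>B\<close>, with its projections.\<close>

definition alg_end ::
  "('o, 'm) jtheory \<Rightarrow> ('c, 'o, 'm, 'z) cotensored_vcat_scheme \<Rightarrow>
   ('o, 'c, 'm) vfun \<Rightarrow> ('o, 'c, 'm) vfun \<Rightarrow> 'o \<times> ('o \<Rightarrow> 'm)" where
  "alg_end T C A B = (SOME Ep. is_end T C A B (fst Ep) (snd Ep))"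

definition alg_hom ::
  "('o, 'm) jtheory \<Rightarrow> ('c, 'o, 'm, 'z) cotensored_vcat_scheme \<Rightarrow>
   ('o, 'c, 'm) vfun \<Rightarrow> ('o, 'c, 'm) vfun \<Rightarrow> 'o" where
  "alg_hom T C A B = fst (alg_end T C A B)"

definition alg_proj ::
  "('o, 'm) jtheory \<Rightarrow> ('c, 'o, 'm, 'z) cotensored_vcat_scheme \<Rightarrow>
   ('o, 'c, 'm) vfun \<Rightarrow> ('o, 'c, 'm) vfun \<Rightarrow> 'o \<Rightarrow> 'm" where
  "alg_proj T C A B = snd (alg_end T C A B)"

definition alg_lift ::
  "('o, 'm) jtheory \<Rightarrow> ('c, 'o, 'm, 'z) cotensored_vcat_scheme \<Rightarrow>
   ('o, 'c, 'm) vfun \<Rightarrow> ('o, 'c, 'm) vfun \<Rightarrow> 'o \<Rightarrow> ('o \<Rightarrow> 'm) \<Rightarrow> 'm" where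
  "alg_lift T C A B X q =
     (THE h. h \<in> \<V> X (alg_hom T C A B) \<and> (\<forall>S \<in> Ob T. alg_proj T C A B S \<cdot> h = q S))"

definition alg_cot ::
  "('c, 'o, 'm, 'z) cotensored_vcat_scheme \<Rightarrow> 'o \<Rightarrow> ('o, 'c, 'm) vfun \<Rightarrow> ('o, 'c, 'm) vfun" where
  "alg_cot C J A =
     \<lparr>obj_map = (\<lambda>S. cotensor_ob C J (obj_map A S)),
      hom_map = (\<lambda>S S'. cot_map C J (obj_map A S) (obj_map A S') \<cdot> hom_map A S S')\<rparr>"

text \<open>The enriched category \<open>T-Alg(C)\<close> with its pointwise designated cotensors.\<close>

definition Alg_vcat ::
  "('o, 'm) jtheory \<Rightarrow> ('c, 'o, 'm, 'z) cotensored_vcat_scheme \<Rightarrow>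
   (('o, 'c, 'm) vfun, 'o, 'm) cotensored_vcat" where
  "Alg_vcat T C =
     \<lparr>Ob = {A. is_talg T C A},
      Hom = alg_hom T C,
      Comp = (\<lambda>A B D. alg_lift T C A D (alg_hom T C B D \<otimes> alg_hom T C A B)
                (\<lambda>S. Comp C (obj_map A S) (obj_map B S) (obj_map D S)
                       \<cdot> (alg_proj T C B D S \<boxtimes> alg_proj T C A B S))),
      Ide = (\<lambda>A. alg_lift T C A A \<I> (\<lambda>S. Ide C (obj_map A S))),
      cotensor_ob = alg_cot C,
      counit = (\<lambda>J A. alg_lift T C (alg_cot C J A) A J (\<lambda>S. counit C J (obj_map A S)))\<rparr>"

subsection \<open>Algebras with varying theory, and commutants\<close>

definition is_algebra :: "('c, 'o, 'm, 'z) cotensored_vcat_scheme \<Rightarrow> ('c, 'o, 'm) alg \<Rightarrow> bool" where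
  "is_algebra C = (\<lambda>(T, A). is_theory T \<and> is_talg T C A)"

definition alg_carrier :: "('c, 'o, 'm) alg \<Rightarrow> 'c" where
  "alg_carrier = (\<lambda>(T, A). obj_map A \<I>)"

text \<open>Morphisms \<open>(M, f)\<close> of the category \<open>Alg(X)\<close> of algebras with carrier \<open>X\<close>. The
  isomorphism \<open>f : A \<rightarrow> B M\<close> of \<open>T\<close>-algebras is given as an enriched natural isomorphism,
  with components \<open>f S : \<I> \<rightarrow> C(A S, B (M S))\<close>.\<close>

definition is_Alg_morphism ::
  "('c, 'o, 'm, 'z) cotensored_vcat_scheme \<Rightarrow> 'c \<Rightarrow> ('c, 'o, 'm) alg \<Rightarrow> ('c, 'o, 'm) alg \<Rightarrow>
   ('o, 'o, 'm) vfun \<times> ('o \<Rightarrow> 'm) \<Rightarrow> bool" where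
  "is_Alg_morphism C X = (\<lambda>(T, A) (U, B) (M, f).
     is_algebra C (T, A) \<and> alg_carrier (T, A) = X \<and>
     is_algebra C (U, B) \<and> alg_carrier (U, B) = X \<and>
     is_theory_morphism T U M \<and>
     is_vnat_iso T C A (vfun_comp B M) f \<and> f \<I> = Ide C X)"

text \<open>The structure functor sends \<open>[K,J]\<close> to \<open>T-Alg(C)([J,A],[K,A])\<close> by the functor
  \<open>[-,A]\<close>; it is the one determined by the cotensor counits \<open>J \<rightarrow> T-Alg(C)([J,A],A)\<close>.\<close>

definition commutant_theory ::
  "('c, 'o, 'm, 'z) cotensored_vcat_scheme \<Rightarrow> ('c, 'o, 'm) alg \<Rightarrow> ('o, 'm) jtheory" where
  "commutant_theory C = (\<lambda>(T, A).
     \<lparr>Ob = \<J>,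
      Hom = (\<lambda>J K. Hom (Alg_vcat T C) (alg_cot C J A) (alg_cot C K A)),
      Comp = (\<lambda>J K L. Comp (Alg_vcat T C) (alg_cot C J A) (alg_cot C K A) (alg_cot C L A)),
      Ide = (\<lambda>J. Ide (Alg_vcat T C) (alg_cot C J A)),
      str = \<lparr>obj_map = (\<lambda>J. J), hom_map = cot_comap (Alg_vcat T C) A\<rparr>\<rparr>)"

definition commutant ::
  "('c, 'o, 'm, 'z) cotensored_vcat_scheme \<Rightarrow> ('c, 'o, 'm) alg \<Rightarrow> ('c, 'o, 'm) alg" where
  "commutant C = (\<lambda>(T, A).
     (commutant_theory C (T, A),
      \<lparr>obj_map = (\<lambda>J. cotensor_ob C J (alg_carrier (T, A))),
       hom_map = (\<lambda>J K. alg_proj T C (alg_cot C J A) (alg_cot C K A) \<I>)\<rparr>))"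

definition commutes_with ::
  "('c, 'o, 'm, 'z) cotensored_vcat_scheme \<Rightarrow> ('c, 'o, 'm) alg \<Rightarrow> ('c, 'o, 'm) alg \<Rightarrow> bool" where
  "commutes_with C A B \<longleftrightarrow> (\<exists>m. is_Alg_morphism C (alg_carrier A) B (commutant C A) m)"

definition commutative :: "('c, 'o, 'm, 'z) cotensored_vcat_scheme \<Rightarrow> ('c, 'o, 'm) alg \<Rightarrow> bool" where
  "commutative C A \<longleftrightarrow> commutes_with C A A"

definition contracommutative :: "('c, 'o, 'm, 'z) cotensored_vcat_scheme \<Rightarrow> ('c, 'o, 'm) alg \<Rightarrow> bool" where
  "contracommutative C A \<longleftrightarrow> commutative C (commutant C A)"

end

end

theory Submission
  imports Defs
begin

text \<open>
  For algebras on a fixed object \<open>X\<close> write \<open>A \<le> B\<close> if there is a morphism \<open>A \<rightarrow> B\<close> in \<open>Alg(X)\<close>, so that \<open>A\<close> commutes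
  with \<open>B\<close> iff \<open>B \<le> A\<^sup>\<bottom>\<close>. This is a preorder, and commutation is symmetric: a morphism \<open>B \<rightarrow> A\<^sup>\<bottom>\<close> assigns to
  an operation \<open>u : J \<rightarrow> K\<close> of \<open>B\<close> a homomorphism \<open>[J,A] \<rightarrow> [K,A]\<close>, which under the identification
  \<open>[J,A(S)] = [J,[S,X]] = [S,[J,X]] = [S,B(J)]\<close> must be \<open>[S,B(u)]\<close>; its naturality in \<open>S\<close>, read in the other
  direction, says that every \<open>[J,A(t)]\<close> is a homomorphism of powers of \<open>B\<close>, that is, \<open>A \<le> B\<^sup>\<bottom>\<close>. Hence \<open>\<bottom>\<close> is a
  self-adjoint Galois connection, and the equivalences of \<open>A \<le> A\<^sup>\<bottom>\<close>, \<open>A\<^sup>\<bottom>\<^sup>\<bottom> \<le> A\<^sup>\<bottom>\<^sup>\<bottom>\<^sup>\<bottom>\<close> and \<open>A\<^sup>\<bottom>\<^sup>\<bottom> \<le> A\<^sup>\<bottom>\<close> are formal.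
\<close>

section \<open>Coherence in a symmetric monoidal category\<close>

context smc_category
begin

text \<open>The identification \<open>[J,A(S)] = [S,B(J)]\<close> holds only up to isomorphism: an
  algebra preserves cotensors without sending them to the designated ones, and the isomorphisms in
  \<open>Alg(X)\<close> are identities only at \<open>\<I>\<close>. It is therefore replaced by a
  family of isomorphisms that is pinned down through the projections from \<open>S\<close> to
  \<open>\<I>\<close> in the theory, and equations about this family are tested on projections. The
  second obstacle is that everything is enriched: operations form objects of \<open>\<V>\<close>,
  and exchanging \<open>J\<close> with \<open>S\<close> involves the symmetry, so that direct
  diagram chases would drown in structural isomorphisms. The chases are done on generalized elements
  instead. Only linear expressions occur, so the coherence needed is the symmetry and associativity
  of one shuffle isomorphism, which is proved from the monoidal axioms by induction on the number of
  factors. Enriched notions are translated into statements on elements once, in both directions; the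
  rest reads like ordinary category theory with variables.\<close>

lemma arrowsD: "f \<in> \<V> X Y \<Longrightarrow> f \<in> arrs V \<and> source V f = X \<and> target V f = Y"
  by (simp add: arrows_def)

lemma arrows_dom: "f \<in> \<V> X Y \<Longrightarrow> X \<in> objs V"
  using source_obj by (auto simp: arrows_def)

lemma arrows_cod: "f \<in> \<V> X Y \<Longrightarrow> Y \<in> objs V"
  using target_obj by (auto simp: arrows_def)

lemma comp_typed [simp]:
  assumes "f \<in> arrs V" "g \<in> arrs V" "target V f = source V g"
  shows "g \<cdot> f \<in> arrs V" "source V (g \<cdot> f) = source V f" "target V (g \<cdot> f) = target V g"
  using comp_arr[of f "source V f" "target V f" g "target V g"] assms by (auto simp: arrows_def)

lemma assoc [simp]:
  assumes "f \<in> arrs V" "g \<in> arrs V" "h \<in> arrs V" "target V f = source V g" "target V g = source V h"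
  shows "(h \<cdot> g) \<cdot> f = h \<cdot> g \<cdot> f"
  using comp_assoc[of f "source V f" "source V g" g "source V h" h "target V h"] assms
  by (auto simp: arrows_def)

text \<open>Simplification nests compositions to the right, which hides the redex of an equation on
  \<open>g \<cdot> f\<close> as soon as a further arrow \<open>k\<close> is precomposed. The
  \<open>_assoc\<close> variants of rules restore it.\<close>

lemma assoc_subst:
  assumes "g \<cdot> f = h"
    and "f \<in> arrs V" "g \<in> arrs V" "k \<in> arrs V" "target V f = source V g" "target V k = source V f"
  shows "g \<cdot> f \<cdot> k = h \<cdot> k"
  using assms assoc[of k f g] by simp

lemma idt_typed [simp]:
  assumes "X \<in> objs V"
  shows "\<one> X \<in> arrs V" "source V (\<one> X) = X" "target V (\<one> X) = X"
  using idt_arr[OF assms] by (auto simp: arrows_def)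

lemma idt_left [simp]: "f \<in> arrs V \<Longrightarrow> target V f = Y \<Longrightarrow> \<one> Y \<cdot> f = f"
  using comp_idt_left[of f "source V f" Y] by (auto simp: arrows_def)

lemma idt_right [simp]: "f \<in> arrs V \<Longrightarrow> source V f = X \<Longrightarrow> f \<cdot> \<one> X = f"
  using comp_idt_right[of f X "target V f"] by (auto simp: arrows_def)

lemma tensor_typed [simp]:
  assumes "f \<in> arrs V" "g \<in> arrs V"
  shows "f \<boxtimes> g \<in> arrs V" "source V (f \<boxtimes> g) = source V f \<otimes> source V g"
    "target V (f \<boxtimes> g) = target V f \<otimes> target V g"
  using tensor_arr[of f "source V f" "target V f" g "source V g" "target V g"] assms
  by (auto simp: arrows_def)

lemma interchange:
  assumes "f \<in> arrs V" "f' \<in> arrs V" "g \<in> arrs V" "g' \<in> arrs V"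
    "target V f = source V f'" "target V g = source V g'"
  shows "(f' \<boxtimes> g') \<cdot> (f \<boxtimes> g) = (f' \<cdot> f) \<boxtimes> (g' \<cdot> g)"
  using tensor_comp[of f "source V f" "source V f'" f' "target V f'" g "source V g" "source V g'" g' "target V g'"]
    assms by (auto simp: arrows_def)

lemma interchange_assoc:
  assumes "f \<in> arrs V" "f' \<in> arrs V" "g \<in> arrs V" "g' \<in> arrs V" "k \<in> arrs V"
    "target V f = source V f'" "target V g = source V g'" "target V k = source V f \<otimes> source V g"
  shows "(f' \<boxtimes> g') \<cdot> (f \<boxtimes> g) \<cdot> k = ((f' \<cdot> f) \<boxtimes> (g' \<cdot> g)) \<cdot> k"
  by (rule assoc_subst[OF interchange]) (use assms in auto)

declare source_obj [simp] target_obj [simp] unit_obj [simp] tensor_obj [simp] ihom_obj [simp]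

lemma idt_tensor [simp]: "X \<in> objs V \<Longrightarrow> Y \<in> objs V \<Longrightarrow> \<one> X \<boxtimes> \<one> Y = \<one> (X \<otimes> Y)"
  by (rule tensor_idt)

section \<open>Isomorphisms and cancellation\<close>

lemma is_inverse_unique: "is_inverse V X Y f g \<Longrightarrow> is_inverse V X Y f h \<Longrightarrow> g = h"
  unfolding is_inverse_def by (metis arrowsD assoc idt_left idt_right)

lemma inv_arr_eq: "is_inverse V X Y f g \<Longrightarrow> inv_arr V X Y f = g"
  unfolding inv_arr_def using is_inverse_unique by blast

lemma inv_arr: "is_iso V X Y f \<Longrightarrow> is_inverse V X Y f (inv_arr V X Y f)"
  using inv_arr_eq unfolding is_iso_def by metis

lemma is_inverse_typed:
  assumes "is_inverse V X Y f g"
  shows "f \<in> arrs V" "source V f = X" "target V f = Y" "g \<in> arrs V" "source V g = Y" "target V g = X"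
    "g \<cdot> f = \<one> X" "f \<cdot> g = \<one> Y"
  using assms by (auto simp: is_inverse_def arrows_def)

lemma is_inverse_assoc:
  assumes "is_inverse V X Y f g" "k \<in> arrs V"
  shows "target V k = X \<Longrightarrow> g \<cdot> f \<cdot> k = k" "target V k = Y \<Longrightarrow> f \<cdot> g \<cdot> k = k"
  using assms is_inverse_typed[OF assms(1)] by (auto simp: assoc_subst)

lemma iso_cancel_right:
  assumes "is_iso V X Y f" "g \<cdot> f = h \<cdot> f" "g \<in> arrs V" "h \<in> arrs V" "source V g = Y" "source V h = Y"
  shows "g = h"
proof -
  obtain k where k: "is_inverse V X Y f k" using assms(1) is_iso_def by metis
  have "g = (g \<cdot> f) \<cdot> k" using assms(3,5) is_inverse_typed[OF k] by simp
  also have "\<dots> = h" unfolding assms(2) using assms(4,6) is_inverse_typed[OF k] by simp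
  finally show ?thesis .
qed

lemma iso_cancel_left:
  assumes "is_iso V X Y f" "f \<cdot> g = f \<cdot> h" "g \<in> arrs V" "h \<in> arrs V" "target V g = X" "target V h = X"
  shows "g = h"
proof -
  obtain k where k: "is_inverse V X Y f k" using assms(1) is_iso_def by metis
  have "g = k \<cdot> (f \<cdot> g)" using assms(3,5) is_inverse_assoc[OF k] by simp
  also have "\<dots> = h" unfolding assms(2) using assms(4,6) is_inverse_assoc[OF k] by simp
  finally show ?thesis .
qed

lemma is_iso_comp:
  assumes "is_iso V X Y f" "is_iso V Y Z g"
  shows "is_iso V X Z (g \<cdot> f)"
proof -
  obtain k where k: "is_inverse V X Y f k" using assms(1) is_iso_def by metis
  obtain l where l: "is_inverse V Y Z g l" using assms(2) is_iso_def by metis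
  have "is_inverse V X Z (g \<cdot> f) (k \<cdot> l)"
    using is_inverse_typed[OF k] is_inverse_typed[OF l] is_inverse_assoc[OF k] is_inverse_assoc[OF l]
    by (auto simp: is_inverse_def arrows_def)
  then show ?thesis using is_iso_def by metis
qed

lemma is_iso_sym: "is_inverse V X Y f g \<Longrightarrow> is_inverse V Y X g f"
  by (auto simp: is_inverse_def)

lemma is_iso_idt: "X \<in> objs V \<Longrightarrow> is_iso V X X (\<one> X)"
  unfolding is_iso_def is_inverse_def by (intro exI[of _ "\<one> X"]) (simp add: arrows_def)

lemma is_iso_tensor:
  assumes "is_iso V X Y f" "is_iso V X' Y' f'"
  shows "is_iso V (X \<otimes> X') (Y \<otimes> Y') (f \<boxtimes> f')"
proof -
  obtain k where k: "is_inverse V X Y f k" using assms(1) is_iso_def by metis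
  obtain l where l: "is_inverse V X' Y' f' l" using assms(2) is_iso_def by metis
  have "X \<in> objs V" "Y \<in> objs V" "X' \<in> objs V" "Y' \<in> objs V"
    using k l by (auto simp: is_inverse_def dest: arrows_dom arrows_cod)
  then have "is_inverse V (X \<otimes> X') (Y \<otimes> Y') (f \<boxtimes> f') (k \<boxtimes> l)"
    using is_inverse_typed[OF k] is_inverse_typed[OF l]
    by (auto simp: is_inverse_def arrows_def interchange)
  then show ?thesis using is_iso_def by metis
qed

section \<open>Structural isomorphisms, their inverses and derived coherence laws\<close>

abbreviation associator_inv ("\<a>\<^sup>-") where "associator_inv X Y Z \<equiv> inv_arr V ((X \<otimes> Y) \<otimes> Z) (X \<otimes> (Y \<otimes> Z)) (\<a> X Y Z)"
abbreviation left_unitor_inv ("\<l>\<^sup>-") where "left_unitor_inv X \<equiv> inv_arr V (\<I> \<otimes> X) X (\<l> X)"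
abbreviation right_unitor_inv ("\<r>\<^sup>-") where "right_unitor_inv X \<equiv> inv_arr V (X \<otimes> \<I>) X (\<r> X)"

lemmas a_inverse = inv_arr[OF associator_iso]
lemmas l_inverse = inv_arr[OF left_unitor_iso]
lemmas r_inverse = inv_arr[OF right_unitor_iso]

declare is_inverse_typed[OF a_inverse, simp] is_inverse_assoc[OF a_inverse, simp]
  is_inverse_typed[OF l_inverse, simp] is_inverse_assoc[OF l_inverse, simp]
  is_inverse_typed[OF r_inverse, simp] is_inverse_assoc[OF r_inverse, simp]

lemma s_typed [simp]:
  assumes "X \<in> objs V" "Y \<in> objs V"
  shows "\<s> X Y \<in> arrs V" "source V (\<s> X Y) = X \<otimes> Y" "target V (\<s> X Y) = Y \<otimes> X"
  using symm_arr[OF assms] by (auto simp: arrows_def)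

lemma s_inverse: "X \<in> objs V \<Longrightarrow> Y \<in> objs V \<Longrightarrow> is_inverse V (X \<otimes> Y) (Y \<otimes> X) (\<s> X Y) (\<s> Y X)"
  by (simp add: is_inverse_def symm_arr symm_symm)

declare is_inverse_typed(7,8)[OF s_inverse, simp] is_inverse_assoc[OF s_inverse, simp]

lemma s_iso: "X \<in> objs V \<Longrightarrow> Y \<in> objs V \<Longrightarrow> is_iso V (X \<otimes> Y) (Y \<otimes> X) (\<s> X Y)"
  using s_inverse is_iso_def by metis

lemma s_nat:
  assumes "f \<in> arrs V" "g \<in> arrs V"
  shows "\<s> (target V f) (target V g) \<cdot> (f \<boxtimes> g) = (g \<boxtimes> f) \<cdot> \<s> (source V f) (source V g)"
  using symm_natural[of f "source V f" "target V f" g "source V g" "target V g"] assms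
  by (auto simp: arrows_def)

lemma a_nat:
  assumes "f \<in> arrs V" "g \<in> arrs V" "h \<in> arrs V"
  shows "\<a> (target V f) (target V g) (target V h) \<cdot> ((f \<boxtimes> g) \<boxtimes> h)
    = (f \<boxtimes> (g \<boxtimes> h)) \<cdot> \<a> (source V f) (source V g) (source V h)"
  using associator_natural[of f "source V f" "target V f" g "source V g" "target V g" h "source V h" "target V h"] assms
  by (auto simp: arrows_def)

lemma l_nat: "f \<in> arrs V \<Longrightarrow> \<l> (target V f) \<cdot> (\<one> \<I> \<boxtimes> f) = f \<cdot> \<l> (source V f)"
  using left_unitor_natural[of f "source V f" "target V f"] by (auto simp: arrows_def)

lemma r_nat: "f \<in> arrs V \<Longrightarrow> \<r> (target V f) \<cdot> (f \<boxtimes> \<one> \<I>) = f \<cdot> \<r> (source V f)"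
  using right_unitor_natural[of f "source V f" "target V f"] by (auto simp: arrows_def)

text \<open>Inverts the vertical sides of a commuting square; naturality of
  \<open>\<a>\<^sup>-\<close> and \<open>\<l>\<^sup>-\<close> follows from that of
  \<open>\<a>\<close> and \<open>\<l>\<close>.\<close>

lemma inverse_square:
  assumes "is_inverse V X Y u u'" "is_inverse V X' Y' v v'" "v \<cdot> f = g \<cdot> u"
    "f \<in> \<V> X X'" "g \<in> \<V> Y Y'"
  shows "f \<cdot> u' = v' \<cdot> g"
proof -
  note t = is_inverse_typed[OF assms(1)] is_inverse_typed[OF assms(2)] arrowsD[OF assms(4)] arrowsD[OF assms(5)]
  have "f \<cdot> u' = v' \<cdot> (v \<cdot> f) \<cdot> u'" using t is_inverse_assoc[OF assms(2)] by simp
  also have "\<dots> = v' \<cdot> g" using t by (simp add: assms(3))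
  finally show ?thesis .
qed

lemma ai_nat:
  assumes "f \<in> arrs V" "g \<in> arrs V" "h \<in> arrs V"
  shows "\<a>\<^sup>- (target V f) (target V g) (target V h) \<cdot> (f \<boxtimes> (g \<boxtimes> h))
    = ((f \<boxtimes> g) \<boxtimes> h) \<cdot> \<a>\<^sup>- (source V f) (source V g) (source V h)"
  by (rule inverse_square[OF a_inverse a_inverse a_nat, symmetric]) (use assms in \<open>auto simp: arrows_def\<close>)

lemma li_nat: "f \<in> arrs V \<Longrightarrow> (\<one> \<I> \<boxtimes> f) \<cdot> \<l>\<^sup>- (source V f) = \<l>\<^sup>- (target V f) \<cdot> f"
  by (rule inverse_square[OF l_inverse l_inverse l_nat]) (auto simp: arrows_def)

text \<open>Tensoring with \<open>\<I>\<close> is faithful, being naturally isomorphic to the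
  identity through \<open>\<l>\<close>. Unit laws may thus be proved after tensoring.\<close>

lemma unit_tensor_cancel:
  assumes "\<one> \<I> \<boxtimes> f = \<one> \<I> \<boxtimes> g" "f \<in> \<V> X Y" "g \<in> \<V> X Y"
  shows "f = g"
proof (rule iso_cancel_right[OF left_unitor_iso])
  note t = arrowsD[OF assms(2)] arrowsD[OF assms(3)]
  show "X \<in> objs V" using arrows_dom[OF assms(2)] .
  show "f \<cdot> \<l> X = g \<cdot> \<l> X" using l_nat[of f] l_nat[of g] t assms(1) by simp
qed (use arrowsD[OF assms(2)] arrowsD[OF assms(3)] in auto)

lemma tensor_unit_cancel:
  assumes "f \<boxtimes> \<one> \<I> = g \<boxtimes> \<one> \<I>" "f \<in> \<V> X Y" "g \<in> \<V> X Y"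
  shows "f = g"
proof (rule iso_cancel_right[OF right_unitor_iso])
  note t = arrowsD[OF assms(2)] arrowsD[OF assms(3)]
  show "X \<in> objs V" using arrows_dom[OF assms(2)] .
  show "f \<cdot> \<r> X = g \<cdot> \<r> X" using r_nat[of f] r_nat[of g] t assms(1) by simp
qed (use arrowsD[OF assms(2)] arrowsD[OF assms(3)] in auto)

text \<open>Kelly's argument: the axioms contain only the middle triangle, and this triangle follows
  from the pentagon on \<open>\<I>, \<I>, X, Y\<close> and two middle ones. The pentagon requires
  the additional factor \<open>\<I>\<close> on the left, which is cancelled at the end.\<close>

lemma left_unitor_tensor:
  assumes [simp]: "X \<in> objs V" "Y \<in> objs V"
  shows "\<l> (X \<otimes> Y) \<cdot> \<a> \<I> X Y = \<l> X \<boxtimes> \<one> Y"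
proof (rule unit_tensor_cancel)
  let ?a = "\<a> \<I> (\<I> \<otimes> X) Y \<cdot> (\<a> \<I> \<I> X \<boxtimes> \<one> Y)"
  have iso: "is_iso V (((\<I> \<otimes> \<I>) \<otimes> X) \<otimes> Y) (\<I> \<otimes> ((\<I> \<otimes> X) \<otimes> Y)) ?a"
    by (rule is_iso_comp[OF is_iso_tensor[OF associator_iso is_iso_idt] associator_iso]) auto
  have p: "(\<one> \<I> \<boxtimes> \<a> \<I> X Y) \<cdot> ?a = \<a> \<I> \<I> (X \<otimes> Y) \<cdot> \<a> (\<I> \<otimes> \<I>) X Y"
    using pentagon[of \<I> \<I> X Y] by simp
  have "(\<one> \<I> \<boxtimes> (\<l> (X \<otimes> Y) \<cdot> \<a> \<I> X Y)) \<cdot> ?a = (\<one> \<I> \<boxtimes> \<l> (X \<otimes> Y)) \<cdot> (\<one> \<I> \<boxtimes> \<a> \<I> X Y) \<cdot> ?a"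
    by (simp add: interchange_assoc)
  also have "\<dots> = ((\<one> \<I> \<boxtimes> \<l> (X \<otimes> Y)) \<cdot> \<a> \<I> \<I> (X \<otimes> Y)) \<cdot> \<a> (\<I> \<otimes> \<I>) X Y"
    by (simp add: p)
  also have "\<dots> = (\<r> \<I> \<boxtimes> (\<one> X \<boxtimes> \<one> Y)) \<cdot> \<a> (\<I> \<otimes> \<I>) X Y"
    by (subst triangle) auto
  also have "\<dots> = \<a> \<I> X Y \<cdot> ((\<r> \<I> \<boxtimes> \<one> X) \<boxtimes> \<one> Y)"
    using a_nat[of "\<r> \<I>" "\<one> X" "\<one> Y"] by simp
  also have "\<r> \<I> \<boxtimes> \<one> X = (\<one> \<I> \<boxtimes> \<l> X) \<cdot> \<a> \<I> \<I> X"
    by (simp add: triangle)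
  also have "((\<one> \<I> \<boxtimes> \<l> X) \<cdot> \<a> \<I> \<I> X) \<boxtimes> \<one> Y = ((\<one> \<I> \<boxtimes> \<l> X) \<boxtimes> \<one> Y) \<cdot> (\<a> \<I> \<I> X \<boxtimes> \<one> Y)"
    by (simp add: interchange)
  also have "\<a> \<I> X Y \<cdot> \<dots> = (\<a> \<I> X Y \<cdot> ((\<one> \<I> \<boxtimes> \<l> X) \<boxtimes> \<one> Y)) \<cdot> (\<a> \<I> \<I> X \<boxtimes> \<one> Y)"
    by simp
  also have "\<dots> = (\<one> \<I> \<boxtimes> (\<l> X \<boxtimes> \<one> Y)) \<cdot> ?a"
    using a_nat[of "\<one> \<I>" "\<l> X" "\<one> Y"] by simp
  finally show "\<one> \<I> \<boxtimes> (\<l> (X \<otimes> Y) \<cdot> \<a> \<I> X Y) = \<one> \<I> \<boxtimes> (\<l> X \<boxtimes> \<one> Y)"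
    by (rule iso_cancel_right[OF iso]) auto
qed (auto simp: arrows_def)

text \<open>Naturality of \<open>\<l>\<close> at \<open>\<l> \<I>\<close> gives \<open>\<l> (\<I>
  \<otimes> \<I>) = \<one> \<I> \<boxtimes> \<l> \<I>\<close>; with this the left and the middle
  triangle have the same left-hand side.\<close>

lemma left_unitor_unit: "\<l> \<I> = \<r> \<I>"
proof (rule tensor_unit_cancel)
  have "\<l> (\<I> \<otimes> \<I>) = \<one> \<I> \<boxtimes> \<l> \<I>"
    by (rule iso_cancel_left[OF left_unitor_iso[of \<I>]]) (use l_nat[of "\<l> \<I>"] in auto)
  then show "\<l> \<I> \<boxtimes> \<one> \<I> = \<r> \<I> \<boxtimes> \<one> \<I>"
    using left_unitor_tensor[of \<I> \<I>] triangle[of \<I> \<I>] by simp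
qed (auto simp: arrows_def)

text \<open>Compose the hexagon on \<open>X, \<I>, \<I>\<close> with unitors. For
  \<open>f = \<l> X \<cdot> \<s> X \<I>\<close> it becomes \<open>f \<cdot> (\<r> X \<boxtimes>
  \<one> \<I>) = f \<cdot> (f \<boxtimes> \<one> \<I>)\<close>, and \<open>f\<close> is an
  isomorphism.\<close>

lemma left_unitor_symm:
  assumes [simp]: "X \<in> objs V"
  shows "\<l> X \<cdot> \<s> X \<I> = \<r> X"
proof (rule tensor_unit_cancel)
  have h: "\<a> \<I> \<I> X \<cdot> \<s> X (\<I> \<otimes> \<I>) \<cdot> \<a> X \<I> \<I> = (\<one> \<I> \<boxtimes> \<s> X \<I>) \<cdot> \<a> \<I> X \<I> \<cdot> (\<s> X \<I> \<boxtimes> \<one> \<I>)"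
    by (rule hexagon) auto
  let ?f = "\<l> X \<cdot> \<s> X \<I>"
  have iso: "is_iso V (X \<otimes> \<I>) X ?f"
    by (rule is_iso_comp[OF s_iso left_unitor_iso]) auto
  have "(\<one> \<I> \<boxtimes> \<l> X) \<cdot> \<a> \<I> \<I> X \<cdot> \<s> X (\<I> \<otimes> \<I>) \<cdot> \<a> X \<I> \<I>
      = ((\<one> \<I> \<boxtimes> \<l> X) \<cdot> \<a> \<I> \<I> X) \<cdot> \<s> X (\<I> \<otimes> \<I>) \<cdot> \<a> X \<I> \<I>" by simp
  also have "\<dots> = ((\<r> \<I> \<boxtimes> \<one> X) \<cdot> \<s> X (\<I> \<otimes> \<I>)) \<cdot> \<a> X \<I> \<I>"
    by (subst triangle) auto
  also have "\<dots> = (\<s> X \<I> \<cdot> (\<one> X \<boxtimes> \<l> \<I>)) \<cdot> \<a> X \<I> \<I>"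
    using s_nat[of "\<one> X" "\<r> \<I>"] by (simp add: left_unitor_unit)
  also have "\<dots> = \<s> X \<I> \<cdot> (\<r> X \<boxtimes> \<one> \<I>)"
    by (simp add: triangle)
  finally have 1: "(\<one> \<I> \<boxtimes> \<l> X) \<cdot> \<a> \<I> \<I> X \<cdot> \<s> X (\<I> \<otimes> \<I>) \<cdot> \<a> X \<I> \<I> = \<s> X \<I> \<cdot> (\<r> X \<boxtimes> \<one> \<I>)" .
  have "?f \<cdot> (\<r> X \<boxtimes> \<one> \<I>) = \<l> X \<cdot> (\<one> \<I> \<boxtimes> \<l> X) \<cdot> (\<one> \<I> \<boxtimes> \<s> X \<I>) \<cdot> \<a> \<I> X \<I> \<cdot> (\<s> X \<I> \<boxtimes> \<one> \<I>)"
    using 1 by (simp add: h)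
  also have "\<dots> = (\<l> X \<cdot> (\<one> \<I> \<boxtimes> ?f)) \<cdot> \<a> \<I> X \<I> \<cdot> (\<s> X \<I> \<boxtimes> \<one> \<I>)"
    by (simp add: interchange_assoc)
  also have "\<dots> = ?f \<cdot> (\<l> (X \<otimes> \<I>) \<cdot> \<a> \<I> X \<I>) \<cdot> (\<s> X \<I> \<boxtimes> \<one> \<I>)"
    using l_nat[of ?f] by simp
  also have "\<dots> = ?f \<cdot> (?f \<boxtimes> \<one> \<I>)"
    by (simp add: left_unitor_tensor interchange)
  finally show "?f \<boxtimes> \<one> \<I> = \<r> X \<boxtimes> \<one> \<I>"
    using iso_cancel_left[OF iso, of "\<r> X \<boxtimes> \<one> \<I>" "?f \<boxtimes> \<one> \<I>"] by simp
qed (auto simp: arrows_def)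

text \<open>The second hexagon, moving a product past a single factor. It is the inverse of the
  first, because the symmetry is its own inverse.\<close>

lemma hexagon_inverse:
  assumes [simp]: "X \<in> objs V" "Y \<in> objs V" "Z \<in> objs V"
  shows "\<s> (X \<otimes> Y) Z = \<a> Z X Y \<cdot> (\<s> X Z \<boxtimes> \<one> Y) \<cdot> \<a>\<^sup>- X Z Y \<cdot> (\<one> X \<boxtimes> \<s> Y Z) \<cdot> \<a> X Y Z"
proof -
  let ?h = "\<a> X Y Z \<cdot> \<s> Z (X \<otimes> Y) \<cdot> \<a> Z X Y"
  let ?k = "(\<s> X Z \<boxtimes> \<one> Y) \<cdot> \<a>\<^sup>- X Z Y \<cdot> (\<one> X \<boxtimes> \<s> Y Z)"
  have "?k \<cdot> ?h = \<one> ((Z \<otimes> X) \<otimes> Y)"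
    by (simp add: hexagon interchange interchange_assoc)
  then have "\<a> Z X Y \<cdot> (?k \<cdot> ?h) \<cdot> \<a>\<^sup>- Z X Y \<cdot> \<s> (X \<otimes> Y) Z = \<s> (X \<otimes> Y) Z" by simp
  then show ?thesis by simp
qed

text \<open>A form of the Yang-Baxter equation: both sides reverse three factors, one by moving
  \<open>N\<close> to the end first, the other by moving \<open>P\<close> to the front first. It
  transfers associativity of \<open>split\<close> to the reversed order of contexts.\<close>

lemma symm_reversal:
  assumes [simp]: "N \<in> objs V" "M \<in> objs V" "P \<in> objs V"
  shows "\<a> P M N \<cdot> (\<s> M P \<boxtimes> \<one> N) \<cdot> \<s> N (M \<otimes> P) \<cdot> \<a> N M P = (\<one> P \<boxtimes> \<s> N M) \<cdot> \<s> (N \<otimes> M) P"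
proof -
  have h1: "\<s> N (M \<otimes> P) \<cdot> \<a> N M P = \<a>\<^sup>- M P N \<cdot> (\<one> M \<boxtimes> \<s> N P) \<cdot> \<a> M N P \<cdot> (\<s> N M \<boxtimes> \<one> P)"
    by (subst hexagon[symmetric]) auto
  have "(\<one> P \<boxtimes> \<s> N M) \<cdot> \<a> P N M \<cdot> \<s> M (P \<otimes> N) \<cdot> \<a> M P N = \<a> P M N \<cdot> (\<s> M P \<boxtimes> \<one> N)"
    by (simp add: hexagon interchange_assoc)
  then have h2: "\<a> P M N \<cdot> (\<s> M P \<boxtimes> \<one> N) = (\<one> P \<boxtimes> \<s> N M) \<cdot> \<a> P N M \<cdot> \<s> M (P \<otimes> N) \<cdot> \<a> M P N" ..
  have h3: "\<s> M (N \<otimes> P) \<cdot> \<a> M N P = \<a>\<^sup>- N P M \<cdot> (\<one> N \<boxtimes> \<s> M P) \<cdot> \<a> N M P \<cdot> (\<s> M N \<boxtimes> \<one> P)"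
    by (subst hexagon[symmetric]) auto
  have "\<a> P M N \<cdot> (\<s> M P \<boxtimes> \<one> N) \<cdot> \<s> N (M \<otimes> P) \<cdot> \<a> N M P
      = (\<a> P M N \<cdot> (\<s> M P \<boxtimes> \<one> N)) \<cdot> \<a>\<^sup>- M P N \<cdot> (\<one> M \<boxtimes> \<s> N P) \<cdot> \<a> M N P \<cdot> (\<s> N M \<boxtimes> \<one> P)"
    by (simp add: h1)
  also have "\<dots> = (\<one> P \<boxtimes> \<s> N M) \<cdot> \<a> P N M \<cdot> (\<s> M (P \<otimes> N) \<cdot> (\<one> M \<boxtimes> \<s> N P)) \<cdot> \<a> M N P \<cdot> (\<s> N M \<boxtimes> \<one> P)"
    unfolding h2 by simp
  also have "\<dots> = (\<one> P \<boxtimes> \<s> N M) \<cdot> \<a> P N M \<cdot> (\<s> N P \<boxtimes> \<one> M) \<cdot> (\<s> M (N \<otimes> P) \<cdot> \<a> M N P) \<cdot> (\<s> N M \<boxtimes> \<one> P)"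
    using s_nat[of "\<one> M" "\<s> N P"] by simp
  also have "\<dots> = (\<one> P \<boxtimes> \<s> N M) \<cdot> \<s> (N \<otimes> M) P"
    unfolding h3 by (simp add: hexagon_inverse interchange)
  finally show ?thesis .
qed

end

section \<open>Named contexts\<close>

type_synonym 'o ctx = "('o \<times> nat) set"

text \<open>Any well-order does: it merely selects an order of the factors in \<open>tens\<close>,
  and it exists whatever the cardinality of the type of objects.\<close>

definition name_order :: "('a \<times> 'a) set" where
  "name_order = (SOME r. Well_order r \<and> Field r = UNIV)"

lemma name_order: "wo_rel name_order" "Field name_order = UNIV"
  using someI_ex[OF well_ordering] unfolding name_order_def wo_rel_def by auto

definition first_name :: "'a set \<Rightarrow> 'a" where
  "first_name N = wo_rel.minim name_order N"

lemma first_name_in: "N \<noteq> {} \<Longrightarrow> first_name N \<in> N"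
  unfolding first_name_def by (rule wo_rel.minim_in) (auto simp: name_order)

text \<open>Keeps the recursions of \<open>tens\<close> and \<open>split\<close> in step: the first
  name of a union is also first in the part that contains it, so all of them peel off the same
  factor.\<close>

lemma first_name_subset:
  assumes "first_name K \<in> N" "N \<subseteq> K"
  shows "first_name N = first_name K"
  unfolding first_name_def
proof (rule wo_rel.equals_minim[OF name_order(1), symmetric])
  show "wo_rel.minim name_order K \<in> N" using assms by (simp add: first_name_def)
  show "(wo_rel.minim name_order K, b) \<in> name_order" if "b \<in> N" for b
    using that assms by (intro wo_rel.minim_least[OF name_order(1)]) (auto simp: name_order)
qed (auto simp: name_order)

text \<open>Names carry a number besides their object precisely so that every object has infinitely
  many names.\<close>

lemma fresh_name:
  assumes "finite N"
  obtains x :: "'o \<times> nat" where "fst x = E" "x \<notin> N"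
proof -
  have "infinite (range (Pair E :: nat \<Rightarrow> 'o \<times> nat))"
    using finite_imageD[of "Pair E" UNIV] by (auto simp: inj_def)
  then have "\<not> range (Pair E) \<subseteq> N" using assms finite_subset by blast
  then obtain n where "(E, n) \<notin> N" by auto
  then show ?thesis using that[of "(E, n)"] by simp
qed

context smc_category
begin

text \<open>A context is a finite set of names, each carrying its object, and stands for the tensor product
  of these objects. Since the names are distinct, \<open>split\<close> can be made strictly symmetric and
  associative: arrows out of contexts can be composed as if the symmetry and the associator were
  identities.\<close>

function tens :: "'o ctx \<Rightarrow> 'o" where
  "tens N = (if finite N \<and> N \<noteq> {} then fst (first_name N) \<otimes> tens (N - {first_name N}) else \<I>)"
  by auto
termination
  by (relation "measure card") (auto intro: psubset_card_mono first_name_in simp: first_name_in card_gt_0_iff)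

text \<open>The shuffle isomorphism from \<open>tens (N \<union> M)\<close> to
  \<open>tens N \<otimes> tens M\<close>. If the first name lies in \<open>M\<close>, the two
  contexts exchange roles and a symmetry is applied afterwards, so that the symmetry law holds by
  construction. The last branch is a default value.\<close>

function split :: "'o ctx \<Rightarrow> 'o ctx \<Rightarrow> 'm" where
  "split N M =
    (if N = {} then \<l>\<^sup>- (tens M) else if M = {} then \<r>\<^sup>- (tens N)
     else if finite N \<and> finite M \<and> N \<inter> M = {} then
       (let m = first_name (N \<union> M) in
        if m \<in> N then \<a>\<^sup>- (fst m) (tens (N - {m})) (tens M) \<cdot> (\<one> (fst m) \<boxtimes> split (N - {m}) M)
        else \<s> (tens M) (tens N) \<cdot> \<a>\<^sup>- (fst m) (tens (M - {m})) (tens N) \<cdot> (\<one> (fst m) \<boxtimes> split (M - {m}) N))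
     else \<one> \<I>)"
  by auto
termination
proof (relation "measure (\<lambda>(N, M). card (N \<union> M))", goal_cases)
  case (2 N M x)
  then have "(N - {x}) \<union> M \<subset> N \<union> M" by auto
  then show ?case using 2 by (auto intro: psubset_card_mono)
next
  case (3 N M x)
  then have "x \<in> M" using first_name_in[of "N \<union> M"] by auto
  then have "(M - {x}) \<union> N \<subset> N \<union> M" using 3 by auto
  then show ?case using 3 by (auto intro: psubset_card_mono)
qed auto

declare tens.simps [simp del] split.simps [simp del]

definition vctx :: "'o ctx \<Rightarrow> bool" where
  "vctx N \<longleftrightarrow> finite N \<and> fst ` N \<subseteq> objs V"

lemma vctx_simps [simp]:
  "vctx {}" "vctx (insert x N) \<longleftrightarrow> fst x \<in> objs V \<and> vctx N" "vctx (N \<union> M) \<longleftrightarrow> vctx N \<and> vctx M"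
  by (auto simp: vctx_def)

lemma vctx_Diff [simp]: "vctx N \<Longrightarrow> vctx (N - M)"
  by (auto simp: vctx_def)

lemma vctx_finite: "vctx N \<Longrightarrow> finite N"
  by (simp add: vctx_def)

lemma vctx_name: "vctx N \<Longrightarrow> x \<in> N \<Longrightarrow> fst x \<in> objs V"
  by (auto simp: vctx_def)

lemma tens_empty [simp]: "tens {} = \<I>"
  by (simp add: tens.simps)

lemma tens_step:
  assumes "vctx N" "N \<noteq> {}"
  shows "tens N = fst (first_name N) \<otimes> tens (N - {first_name N})"
  using assms vctx_finite[OF assms(1)] by (subst tens.simps) simp

lemma tens_single [simp]: "tens {x} = fst x \<otimes> \<I>"
  using first_name_in[of "{x}"] by (subst tens.simps) simp

lemma tens_obj [simp]: "vctx N \<Longrightarrow> tens N \<in> objs V"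
proof (induction "card N" arbitrary: N rule: less_induct)
  case less
  show ?case
  proof (cases "N = {}")
    case False
    let ?m = "first_name N"
    have m: "?m \<in> N" by (rule first_name_in[OF False])
    have "tens (N - {?m}) \<in> objs V"
      using less.prems m card_Diff1_less[OF vctx_finite m] by (intro less.hyps) auto
    then show ?thesis using less.prems m False by (auto simp: tens_step vctx_name)
  qed simp
qed

lemma split_empty_left [simp]: "split {} M = \<l>\<^sup>- (tens M)"
  by (simp add: split.simps)

lemma unit_inverses: "\<l>\<^sup>- \<I> = \<r>\<^sup>- \<I>"
  by (simp add: left_unitor_unit)

lemma split_empty_right [simp]: "split N {} = \<r>\<^sup>- (tens N)"
  by (simp add: split.simps unit_inverses)

lemma split_step:
  assumes "vctx N" "vctx M" "N \<inter> M = {}" "M \<noteq> {}" "first_name (N \<union> M) \<in> N"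
  shows "split N M = \<a>\<^sup>- (fst (first_name N)) (tens (N - {first_name N})) (tens M)
    \<cdot> (\<one> (fst (first_name N)) \<boxtimes> split (N - {first_name N}) M)"
proof -
  have "first_name N = first_name (N \<union> M)" using assms by (intro first_name_subset) auto
  moreover have "N \<noteq> {}" using assms by auto
  ultimately show ?thesis using assms by (subst split.simps) (simp add: Let_def vctx_finite)
qed

lemma unitor_symm_inverse: "X \<in> objs V \<Longrightarrow> \<s> \<I> X \<cdot> \<l>\<^sup>- X = \<r>\<^sup>- X"
proof -
  assume [simp]: "X \<in> objs V"
  have "(\<r> X \<cdot> \<s> \<I> X) \<cdot> \<l>\<^sup>- X = \<one> X" by (simp add: left_unitor_symm[symmetric])
  then have "\<r>\<^sup>- X \<cdot> (\<r> X \<cdot> \<s> \<I> X) \<cdot> \<l>\<^sup>- X = \<r>\<^sup>- X" by simp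
  then show ?thesis by simp
qed

lemma ai_iso:
  "X \<in> objs V \<Longrightarrow> Y \<in> objs V \<Longrightarrow> Z \<in> objs V \<Longrightarrow> is_iso V (X \<otimes> (Y \<otimes> Z)) ((X \<otimes> Y) \<otimes> Z) (\<a>\<^sup>- X Y Z)"
  using is_iso_sym[OF a_inverse] is_iso_def by metis

lemma unitor_symm_inverse': "X \<in> objs V \<Longrightarrow> \<s> X \<I> \<cdot> \<r>\<^sup>- X = \<l>\<^sup>- X"
  by (simp flip: unitor_symm_inverse)

lemma li_iso: "X \<in> objs V \<Longrightarrow> is_iso V X (\<I> \<otimes> X) (\<l>\<^sup>- X)"
  using is_iso_sym[OF l_inverse] is_iso_def by metis

lemma ri_iso: "X \<in> objs V \<Longrightarrow> is_iso V X (X \<otimes> \<I>) (\<r>\<^sup>- X)"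
  using is_iso_sym[OF r_inverse] is_iso_def by metis

text \<open>If the first name lies in \<open>M\<close>, then \<open>split N M\<close> is by
  definition \<open>split M N\<close> followed by a symmetry. Invertibility is therefore inherited
  from the swapped pair, and both claims are handled together.\<close>

lemma split_typed_symm:
  assumes "vctx N" "vctx M" "N \<inter> M = {}"
  shows "is_iso V (tens (N \<union> M)) (tens N \<otimes> tens M) (split N M) \<and> split M N = \<s> (tens N) (tens M) \<cdot> split N M"
  using assms
proof (induction "card (N \<union> M)" arbitrary: N M rule: less_induct)
  case less
  \<comment> \<open>The case with the first name on the left, for arbitrary contexts, so that it can
    also be used with \<open>N\<close> and \<open>M\<close> exchanged.\<close>
  have first: "is_iso V (tens (N \<union> M)) (tens N \<otimes> tens M) (split N M) \<and> split M N = \<s> (tens N) (tens M) \<cdot> split N M"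
    if "N \<noteq> {}" "M \<noteq> {}" "vctx N" "vctx M" "N \<inter> M = {}" "first_name (N \<union> M) \<in> N"
      "card (N \<union> M) = k" "\<And>N' M'. card (N' \<union> M') < k \<Longrightarrow> vctx N' \<Longrightarrow> vctx M' \<Longrightarrow> N' \<inter> M' = {} \<Longrightarrow>
         is_iso V (tens (N' \<union> M')) (tens N' \<otimes> tens M') (split N' M')"
    for N M k
  proof -
    let ?m = "first_name N"
    have eq: "first_name (N \<union> M) = ?m" using that by (intro first_name_subset[symmetric]) auto
    have m: "?m \<in> N" "?m \<notin> M" using that first_name_in[of N] by auto
    have o [simp]: "fst ?m \<in> objs V" using m that vctx_name by blast
    have d: "N \<union> M - {?m} = (N - {?m}) \<union> M" using m by auto
    have tN: "tens N = fst ?m \<otimes> tens (N - {?m})" using that by (intro tens_step) auto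
    have tNM: "tens (N \<union> M) = fst ?m \<otimes> tens ((N - {?m}) \<union> M)"
      using that tens_step[of "N \<union> M"] by (simp add: eq d)
    have "card ((N - {?m}) \<union> M) < k"
      using that m by (auto intro!: psubset_card_mono simp: vctx_finite simp flip: \<open>card (N \<union> M) = k\<close>)
    then have "is_iso V (tens ((N - {?m}) \<union> M)) (tens (N - {?m}) \<otimes> tens M) (split (N - {?m}) M)"
      using that(3-5) by (intro that(8)) auto
    then have "is_iso V (tens (N \<union> M)) (tens N \<otimes> tens M) (split N M)"
      unfolding tNM tN split_step[OF that(3,4,5,2,6)] using that
      by (intro is_iso_comp[OF is_iso_tensor[OF is_iso_idt] ai_iso]) auto
    moreover have "split M N = \<s> (tens N) (tens M) \<cdot> split N M"
      using that m by (subst split.simps) (simp add: Let_def split_step vctx_finite Un_commute[of M] eq Int_commute)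
    ultimately show ?thesis by simp
  qed
  show ?case
  proof (cases "N = {} \<or> M = {}")
    case True
    then show ?thesis
      using less.prems li_iso[OF tens_obj] ri_iso[OF tens_obj] by (auto simp: unitor_symm_inverse unitor_symm_inverse')
  next
    case False
    show ?thesis
    proof (cases "first_name (N \<union> M) \<in> N")
      case True
      then show ?thesis using first[of N M] False less by blast
    next
      case f: False
      then have "first_name (M \<union> N) \<in> M" using first_name_in[of "N \<union> M"] False by (auto simp: Un_commute)
      then have i: "is_iso V (tens (M \<union> N)) (tens M \<otimes> tens N) (split M N)" "split N M = \<s> (tens M) (tens N) \<cdot> split M N"
        using first[of M N "card (M \<union> N)"] False less.prems less.hyps
        unfolding Un_commute[of N M] Int_commute[of N M] by blast+
      obtain k where k: "is_inverse V (tens (M \<union> N)) (tens M \<otimes> tens N) (split M N) k"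
        using i is_iso_def by metis
      show ?thesis unfolding i(2) using less.prems is_inverse_typed[OF k] is_iso_comp[OF i(1) s_iso]
        by (simp add: Un_commute)
    qed
  qed
qed

lemma split_iso: "vctx N \<Longrightarrow> vctx M \<Longrightarrow> N \<inter> M = {} \<Longrightarrow> is_iso V (tens (N \<union> M)) (tens N \<otimes> tens M) (split N M)"
  using split_typed_symm by simp

lemma split_symm: "vctx N \<Longrightarrow> vctx M \<Longrightarrow> N \<inter> M = {} \<Longrightarrow> split M N = \<s> (tens N) (tens M) \<cdot> split N M"
  using split_typed_symm by simp

lemma split_typed [simp]:
  assumes "vctx N" "vctx M" "N \<inter> M = {}"
  shows "split N M \<in> arrs V" "source V (split N M) = tens (N \<union> M)" "target V (split N M) = tens N \<otimes> tens M"
  using is_inverse_typed[OF inv_arr[OF split_iso[OF assms]]] by auto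

section \<open>Associativity of the shuffle isomorphism\<close>

definition split_assoc :: "'o ctx \<Rightarrow> 'o ctx \<Rightarrow> 'o ctx \<Rightarrow> bool" where
  "split_assoc N M P \<longleftrightarrow>
     \<a> (tens N) (tens M) (tens P) \<cdot> (split N M \<boxtimes> \<one> (tens P)) \<cdot> split (N \<union> M) P
     = (\<one> (tens N) \<boxtimes> split M P) \<cdot> split N (M \<union> P)"

text \<open>Each \<open>split\<close> is replaced by its mirror image followed by a symmetry; the
  symmetries that accumulate on the two sides agree by \<open>symm_reversal\<close>.\<close>

lemma split_assoc_reverse:
  assumes A: "split_assoc N M P" and [simp]: "vctx N" "vctx M" "vctx P"
    and [simp]: "N \<inter> M = {}" "M \<inter> P = {}" "N \<inter> P = {}"
  shows "split_assoc P M N"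
proof -
  have [simp]: "M \<inter> N = {}" "P \<inter> M = {}" "P \<inter> N = {}" "(N \<union> M) \<inter> P = {}" "N \<inter> (M \<union> P) = {}"
    "(M \<union> P) \<inter> N = {}" "P \<inter> (M \<union> N) = {}" "(M \<union> N) \<inter> P = {}" "(P \<union> M) \<inter> N = {}" "P \<inter> (N \<union> M) = {}"
    using assms(5-7) by blast+
  let ?n = "tens N" and ?m = "tens M" and ?p = "tens P"
  have sPM: "split P M = \<s> ?m ?p \<cdot> split M P" by (rule split_symm) auto
  have sMN: "split M N = \<s> ?n ?m \<cdot> split N M" by (rule split_symm) auto
  have s1: "split (M \<union> P) N = \<s> ?n (tens (M \<union> P)) \<cdot> split N (M \<union> P)" by (rule split_symm) auto
  have s2: "split P (N \<union> M) = \<s> (tens (N \<union> M)) ?p \<cdot> split (N \<union> M) P" by (rule split_symm) auto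
  have "\<a> ?p ?m ?n \<cdot> (split P M \<boxtimes> \<one> ?n) \<cdot> split (P \<union> M) N
      = \<a> ?p ?m ?n \<cdot> ((\<s> ?m ?p \<cdot> split M P) \<boxtimes> (\<one> ?n \<cdot> \<one> ?n)) \<cdot> \<s> ?n (tens (M \<union> P)) \<cdot> split N (M \<union> P)"
    by (simp add: sPM s1 Un_commute[of P])
  also have "\<dots> = \<a> ?p ?m ?n \<cdot> (\<s> ?m ?p \<boxtimes> \<one> ?n) \<cdot> ((split M P \<boxtimes> \<one> ?n) \<cdot> \<s> ?n (tens (M \<union> P))) \<cdot> split N (M \<union> P)"
    by (subst interchange[symmetric]) auto
  also have "(split M P \<boxtimes> \<one> ?n) \<cdot> \<s> ?n (tens (M \<union> P)) = \<s> ?n (?m \<otimes> ?p) \<cdot> (\<one> ?n \<boxtimes> split M P)"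
    using s_nat[of "\<one> ?n" "split M P"] by simp
  also have "\<a> ?p ?m ?n \<cdot> (\<s> ?m ?p \<boxtimes> \<one> ?n) \<cdot> (\<s> ?n (?m \<otimes> ?p) \<cdot> (\<one> ?n \<boxtimes> split M P)) \<cdot> split N (M \<union> P)
     = \<a> ?p ?m ?n \<cdot> (\<s> ?m ?p \<boxtimes> \<one> ?n) \<cdot> \<s> ?n (?m \<otimes> ?p) \<cdot> (\<one> ?n \<boxtimes> split M P) \<cdot> split N (M \<union> P)" by simp
  also have "\<dots> = (\<a> ?p ?m ?n \<cdot> (\<s> ?m ?p \<boxtimes> \<one> ?n) \<cdot> \<s> ?n (?m \<otimes> ?p) \<cdot> \<a> ?n ?m ?p) \<cdot> (split N M \<boxtimes> \<one> ?p) \<cdot> split (N \<union> M) P"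
    by (simp add: A[unfolded split_assoc_def, symmetric])
  also have "\<dots> = (\<one> ?p \<boxtimes> \<s> ?n ?m) \<cdot> (\<s> (?n \<otimes> ?m) ?p \<cdot> (split N M \<boxtimes> \<one> ?p)) \<cdot> split (N \<union> M) P"
    by (subst symm_reversal) auto
  also have "\<s> (?n \<otimes> ?m) ?p \<cdot> (split N M \<boxtimes> \<one> ?p) = (\<one> ?p \<boxtimes> split N M) \<cdot> \<s> (tens (N \<union> M)) ?p"
    using s_nat[of "split N M" "\<one> ?p"] by simp
  finally show ?thesis
    unfolding split_assoc_def by (simp add: sMN s2 Un_commute[of M N] interchange_assoc)
qed

text \<open>Moves the block \<open>M\<close> from the front to the middle. The symmetry between
  \<open>M \<union> P\<close> and \<open>N\<close> is decomposed by the second hexagon into swaps of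
  \<open>N\<close> with \<open>P\<close> and with \<open>M\<close>, and each of the two hypotheses
  handles one of the bracketings that arise.\<close>

lemma split_assoc_swap:
  assumes A: "split_assoc M N P" "split_assoc M P N" and [simp]: "vctx N" "vctx M" "vctx P"
    and [simp]: "N \<inter> M = {}" "M \<inter> P = {}" "N \<inter> P = {}"
  shows "split_assoc N M P"
proof -
  have [simp]: "M \<inter> N = {}" "P \<inter> M = {}" "P \<inter> N = {}" "(N \<union> M) \<inter> P = {}" "N \<inter> (M \<union> P) = {}"
    "(M \<union> P) \<inter> N = {}" "P \<inter> (M \<union> N) = {}" "(M \<union> N) \<inter> P = {}" "(P \<union> M) \<inter> N = {}" "P \<inter> (N \<union> M) = {}"
    "M \<inter> (N \<union> P) = {}" "M \<inter> (P \<union> N) = {}"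
    using assms(6-8) by blast+
  let ?n = "tens N" and ?m = "tens M" and ?p = "tens P"
  have sNM: "split N M = \<s> ?m ?n \<cdot> split M N" by (rule split_symm) auto
  have sPN: "split P N = \<s> ?n ?p \<cdot> split N P" by (rule split_symm) auto
  have s1: "split N (M \<union> P) = \<s> (tens (M \<union> P)) ?n \<cdot> split (M \<union> P) N" by (rule split_symm) auto
  have A1: "(split M N \<boxtimes> \<one> ?p) \<cdot> split (N \<union> M) P = \<a>\<^sup>- ?m ?n ?p \<cdot> (\<one> ?m \<boxtimes> split N P) \<cdot> split M (N \<union> P)"
    (is "?l = _")
  proof -
    have "?l = \<a>\<^sup>- ?m ?n ?p \<cdot> (\<a> ?m ?n ?p \<cdot> ?l)" by (simp add: Un_commute)
    also have "\<a> ?m ?n ?p \<cdot> ?l = (\<one> ?m \<boxtimes> split N P) \<cdot> split M (N \<union> P)"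
      using A(1) by (simp add: split_assoc_def Un_commute)
    finally show ?thesis .
  qed
  have A2: "(split M P \<boxtimes> \<one> ?n) \<cdot> split (M \<union> P) N
      = \<a>\<^sup>- ?m ?p ?n \<cdot> (\<one> ?m \<boxtimes> (\<s> ?n ?p \<cdot> split N P)) \<cdot> split M (N \<union> P)"
    (is "?l = _")
  proof -
    have "?l = \<a>\<^sup>- ?m ?p ?n \<cdot> (\<a> ?m ?p ?n \<cdot> ?l)" by simp
    also have "\<a> ?m ?p ?n \<cdot> ?l = (\<one> ?m \<boxtimes> split P N) \<cdot> split M (N \<union> P)"
      using A(2) by (simp add: split_assoc_def Un_commute)
    finally show ?thesis by (simp only: sPN)
  qed
  have "(\<one> ?n \<boxtimes> split M P) \<cdot> split N (M \<union> P) = ((\<one> ?n \<boxtimes> split M P) \<cdot> \<s> (tens (M \<union> P)) ?n) \<cdot> split (M \<union> P) N"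
    by (simp add: s1)
  also have "(\<one> ?n \<boxtimes> split M P) \<cdot> \<s> (tens (M \<union> P)) ?n = \<s> (?m \<otimes> ?p) ?n \<cdot> (split M P \<boxtimes> \<one> ?n)"
    using s_nat[of "split M P" "\<one> ?n"] by simp
  also have "(\<s> (?m \<otimes> ?p) ?n \<cdot> (split M P \<boxtimes> \<one> ?n)) \<cdot> split (M \<union> P) N
     = \<s> (?m \<otimes> ?p) ?n \<cdot> \<a>\<^sup>- ?m ?p ?n \<cdot> (\<one> ?m \<boxtimes> (\<s> ?n ?p \<cdot> split N P)) \<cdot> split M (N \<union> P)"
    by (simp add: A2)
  also have "\<dots> = \<a> ?n ?m ?p \<cdot> (\<s> ?m ?n \<boxtimes> \<one> ?p) \<cdot> \<a>\<^sup>- ?m ?n ?p \<cdot> (\<one> ?m \<boxtimes> \<s> ?p ?n) \<cdot> (\<one> ?m \<boxtimes> (\<s> ?n ?p \<cdot> split N P)) \<cdot> split M (N \<union> P)"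
    by (simp add: hexagon_inverse)
  also have "\<dots> = \<a> ?n ?m ?p \<cdot> (\<s> ?m ?n \<boxtimes> \<one> ?p) \<cdot> (split M N \<boxtimes> \<one> ?p) \<cdot> split (N \<union> M) P"
    by (simp add: interchange_assoc A1)
  also have "\<dots> = \<a> ?n ?m ?p \<cdot> (split N M \<boxtimes> \<one> ?p) \<cdot> split (N \<union> M) P"
    by (simp add: interchange_assoc sNM Un_commute[of M N])
  finally show ?thesis unfolding split_assoc_def ..
qed

lemma split_assoc_empty:
  assumes [simp]: "vctx M" "vctx P" "M \<inter> P = {}"
  shows "split_assoc {} M P"
proof -
  have "\<l>\<^sup>- (tens M) \<boxtimes> \<one> (tens P) = \<a>\<^sup>- \<I> (tens M) (tens P) \<cdot> \<l>\<^sup>- (tens M \<otimes> tens P)"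
  proof -
    have "(\<l> (tens M) \<boxtimes> \<one> (tens P)) \<cdot> \<a>\<^sup>- \<I> (tens M) (tens P) \<cdot> \<l>\<^sup>- (tens M \<otimes> tens P) = \<one> (tens M \<otimes> tens P)"
      by (simp flip: left_unitor_tensor)
    then have "(\<l>\<^sup>- (tens M) \<boxtimes> \<one> (tens P)) \<cdot> (\<l> (tens M) \<boxtimes> \<one> (tens P)) \<cdot> \<a>\<^sup>- \<I> (tens M) (tens P) \<cdot> \<l>\<^sup>- (tens M \<otimes> tens P)
       = \<l>\<^sup>- (tens M) \<boxtimes> \<one> (tens P)" by simp
    then show ?thesis by (simp add: interchange_assoc)
  qed
  then show ?thesis using li_nat[of "split M P"] by (simp add: split_assoc_def)
qed

text \<open>By \<open>split_assoc_reverse\<close> and \<open>split_assoc_swap\<close>, the first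
  name, or an empty context, may be assumed in the leftmost block. Then every \<open>split\<close>
  that involves this block peels off the same factor, and what remains is the pentagon and the
  induction hypothesis.\<close>

lemma split_assoc:
  assumes "vctx N" "vctx M" "vctx P" "N \<inter> M = {}" "M \<inter> P = {}" "N \<inter> P = {}"
  shows "split_assoc N M P"
  using assms
proof (induction "card (N \<union> M \<union> P)" arbitrary: N M P rule: less_induct)
  case less
  note IH = less.hyps
  have first: "split_assoc N M P"
    if "N = {} \<or> N \<noteq> {} \<and> M \<noteq> {} \<and> P \<noteq> {} \<and> first_name (N \<union> M \<union> P) \<in> N" and k: "card (N \<union> M \<union> P) = k"
      and v [simp]: "vctx N" "vctx M" "vctx P" "N \<inter> M = {}" "M \<inter> P = {}" "N \<inter> P = {}"
      and ih: "\<And>N' M' P'. \<lbrakk>card (N' \<union> M' \<union> P') < k; vctx N'; vctx M'; vctx P'; N' \<inter> M' = {}; M' \<inter> P' = {}; N' \<inter> P' = {}\<rbrakk>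
        \<Longrightarrow> split_assoc N' M' P'"
    for N M P k
  proof (cases "N = {}")
    case True
    then show ?thesis using that by (simp add: split_assoc_empty)
  next
    case False
    then have ne: "M \<noteq> {}" "P \<noteq> {}" and f: "first_name (N \<union> M \<union> P) \<in> N" using that by auto
    define m where "m = first_name N"
    define N' where "N' = N - {m}"
    have eqs: "first_name (N \<union> M \<union> P) = m" "first_name (N \<union> M) = m"
    proof -
      show "first_name (N \<union> M \<union> P) = m" unfolding m_def by (rule first_name_subset[OF f, symmetric]) auto
      then show "first_name (N \<union> M) = m" using f first_name_subset[of "N \<union> M \<union> P" "N \<union> M"] by auto
    qed
    have m: "m \<in> N" "m \<notin> M" "m \<notin> P" using first_name_in[OF False] unfolding m_def disjoint_iff[THEN iffD1, OF v(4)] by (simp_all add: v(4,6)[unfolded disjoint_iff])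
    have [simp]: "fst m \<in> objs V" using m v vctx_name by blast
    have N'[simp]: "vctx N'" by (simp add: N'_def)
    have [simp]: "N' \<inter> M = {}" "N' \<inter> P = {}" "(N' \<union> M) \<inter> P = {}" "N' \<inter> (M \<union> P) = {}"
      "N \<inter> (M \<union> P) = {}" "(N \<union> M) \<inter> P = {}"
      using v(4-6) unfolding N'_def by blast+
    have d: "N \<union> M - {m} = N' \<union> M" "N \<union> M \<union> P - {m} = N' \<union> M \<union> P" using m by (auto simp: N'_def)
    have "card (N' \<union> M \<union> P) < k"
      unfolding k[symmetric] d(2)[symmetric] using m v
      by (intro psubset_card_mono) (auto simp: vctx_finite)
    then have A: "split_assoc N' M P" using ih by simp
    let ?x = "fst m" and ?n = "tens N'" and ?m = "tens M" and ?p = "tens P"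
    have tN: "tens N = ?x \<otimes> ?n" using tens_step[of N] False by (simp add: m_def N'_def)
    have s1: "split N M = \<a>\<^sup>- ?x ?n ?m \<cdot> (\<one> ?x \<boxtimes> split N' M)"
      using split_step[of N M] ne eqs m by (simp add: m_def N'_def)
    have s2: "split (N \<union> M) P = \<a>\<^sup>- ?x (tens (N' \<union> M)) ?p \<cdot> (\<one> ?x \<boxtimes> split (N' \<union> M) P)"
      using split_step[of "N \<union> M" P] ne eqs m by (simp add: d)
    have s3: "split N (M \<union> P) = \<a>\<^sup>- ?x ?n (tens (M \<union> P)) \<cdot> (\<one> ?x \<boxtimes> split N' (M \<union> P))"
      using split_step[of N "M \<union> P"] ne eqs m by (simp add: m_def N'_def Un_assoc)
    \<comment> \<open>The pentagon with three of its associators inverted, the form in which peeling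
      produces it.\<close>
    have pent: "\<a> (?x \<otimes> ?n) ?m ?p \<cdot> (\<a>\<^sup>- ?x ?n ?m \<boxtimes> \<one> ?p) \<cdot> \<a>\<^sup>- ?x (?n \<otimes> ?m) ?p
        = \<a>\<^sup>- ?x ?n (?m \<otimes> ?p) \<cdot> (\<one> ?x \<boxtimes> \<a> ?n ?m ?p)"
    proof -
      have "\<a>\<^sup>- ?x ?n (?m \<otimes> ?p) \<cdot> (\<a> ?x ?n (?m \<otimes> ?p) \<cdot> \<a> (?x \<otimes> ?n) ?m ?p) \<cdot> (\<a>\<^sup>- ?x ?n ?m \<boxtimes> \<one> ?p) \<cdot> \<a>\<^sup>- ?x (?n \<otimes> ?m) ?p
        = \<a>\<^sup>- ?x ?n (?m \<otimes> ?p) \<cdot> (\<one> ?x \<boxtimes> \<a> ?n ?m ?p)"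
        unfolding pentagon[OF \<open>?x \<in> objs V\<close> tens_obj[OF N'] tens_obj[OF v(2)] tens_obj[OF v(3)]]
        by (simp add: interchange_assoc)
      then show ?thesis by simp
    qed
    have "\<a> (tens N) ?m ?p \<cdot> (split N M \<boxtimes> \<one> ?p) \<cdot> split (N \<union> M) P
      = \<a> (?x \<otimes> ?n) ?m ?p \<cdot> ((\<a>\<^sup>- ?x ?n ?m \<cdot> (\<one> ?x \<boxtimes> split N' M)) \<boxtimes> (\<one> ?p \<cdot> \<one> ?p)) \<cdot> \<a>\<^sup>- ?x (tens (N' \<union> M)) ?p \<cdot> (\<one> ?x \<boxtimes> split (N' \<union> M) P)"
      by (simp add: tN s1 s2)
    also have "\<dots> = \<a> (?x \<otimes> ?n) ?m ?p \<cdot> (\<a>\<^sup>- ?x ?n ?m \<boxtimes> \<one> ?p) \<cdot> (((\<one> ?x \<boxtimes> split N' M) \<boxtimes> \<one> ?p) \<cdot> \<a>\<^sup>- ?x (tens (N' \<union> M)) ?p) \<cdot> (\<one> ?x \<boxtimes> split (N' \<union> M) P)"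
      by (subst interchange[symmetric]) auto
    also have "((\<one> ?x \<boxtimes> split N' M) \<boxtimes> \<one> ?p) \<cdot> \<a>\<^sup>- ?x (tens (N' \<union> M)) ?p = \<a>\<^sup>- ?x (?n \<otimes> ?m) ?p \<cdot> (\<one> ?x \<boxtimes> (split N' M \<boxtimes> \<one> ?p))"
      using ai_nat[of "\<one> ?x" "split N' M" "\<one> ?p"] by simp
    also have "\<a> (?x \<otimes> ?n) ?m ?p \<cdot> (\<a>\<^sup>- ?x ?n ?m \<boxtimes> \<one> ?p) \<cdot> (\<a>\<^sup>- ?x (?n \<otimes> ?m) ?p \<cdot> (\<one> ?x \<boxtimes> (split N' M \<boxtimes> \<one> ?p))) \<cdot> (\<one> ?x \<boxtimes> split (N' \<union> M) P)
      = (\<a> (?x \<otimes> ?n) ?m ?p \<cdot> (\<a>\<^sup>- ?x ?n ?m \<boxtimes> \<one> ?p) \<cdot> \<a>\<^sup>- ?x (?n \<otimes> ?m) ?p) \<cdot> (\<one> ?x \<boxtimes> (split N' M \<boxtimes> \<one> ?p)) \<cdot> (\<one> ?x \<boxtimes> split (N' \<union> M) P)"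
      by simp
    also have "\<dots> = \<a>\<^sup>- ?x ?n (?m \<otimes> ?p) \<cdot> (\<one> ?x \<boxtimes> (\<a> ?n ?m ?p \<cdot> (split N' M \<boxtimes> \<one> ?p) \<cdot> split (N' \<union> M) P))"
      unfolding pent by (simp add: interchange)
    also have "\<dots> = \<a>\<^sup>- ?x ?n (?m \<otimes> ?p) \<cdot> (\<one> ?x \<boxtimes> (\<one> ?n \<boxtimes> split M P)) \<cdot> (\<one> ?x \<boxtimes> split N' (M \<union> P))"
      unfolding A[unfolded split_assoc_def] by (simp add: interchange)
    also have "\<dots> = (\<a>\<^sup>- ?x ?n (?m \<otimes> ?p) \<cdot> (\<one> ?x \<boxtimes> (\<one> ?n \<boxtimes> split M P))) \<cdot> (\<one> ?x \<boxtimes> split N' (M \<union> P))"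
      by simp
    also have "\<dots> = (\<one> (tens N) \<boxtimes> split M P) \<cdot> split N (M \<union> P)"
      using ai_nat[of "\<one> ?x" "\<one> ?n" "split M P"] by (simp add: s3 tN)
    finally show ?thesis unfolding split_assoc_def .
  qed
  \<comment> \<open>The union, hence the induction measure, is the same for all orders of the three
    blocks, so \<open>first\<close> applies to each order.\<close>
  have head: "split_assoc A B C"
    if "A = {} \<or> A \<noteq> {} \<and> B \<noteq> {} \<and> C \<noteq> {} \<and> first_name (A \<union> B \<union> C) \<in> A"
      "A \<union> B \<union> C = N \<union> M \<union> P" "vctx A" "vctx B" "vctx C" "A \<inter> B = {}" "B \<inter> C = {}" "A \<inter> C = {}" for A B C
    using first[of A B C "card (N \<union> M \<union> P)"] that IH by auto
  have e: "P \<union> M \<union> N = N \<union> M \<union> P" "M \<union> N \<union> P = N \<union> M \<union> P" "M \<union> P \<union> N = N \<union> M \<union> P" by auto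
  have disj: "M \<inter> N = {}" "P \<inter> M = {}" "P \<inter> N = {}" using less.prems by auto
  consider "N = {} \<or> N \<noteq> {} \<and> M \<noteq> {} \<and> P \<noteq> {} \<and> first_name (N \<union> M \<union> P) \<in> N"
    | "M = {} \<or> N \<noteq> {} \<and> M \<noteq> {} \<and> P \<noteq> {} \<and> first_name (N \<union> M \<union> P) \<in> M"
    | "P = {} \<or> N \<noteq> {} \<and> M \<noteq> {} \<and> P \<noteq> {} \<and> first_name (N \<union> M \<union> P) \<in> P"
    using first_name_in[of "N \<union> M \<union> P"] by auto
  then show ?case
  proof cases
    case 1
    then show ?thesis using head[of N M P] less.prems by simp
  next
    case 2
    then have "split_assoc M N P" "split_assoc M P N"
      using head[of M N P] head[of M P N] less.prems disj e by auto
    then show ?thesis by (rule split_assoc_swap) (use less.prems in auto)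
  next
    case 3
    then have "split_assoc P M N" using head[of P M N] less.prems disj e by auto
    then show ?thesis by (rule split_assoc_reverse) (use less.prems in auto)
  qed
qed

end

section \<open>Elements in context\<close>

text \<open>\<open>El N a\<close> is the element \<open>a : tens N \<rightarrow> E\<close> of \<open>E\<close> in the context \<open>N\<close>. An arrow of \<open>\<V>\<close> is determined
  by its action on elements, and on elements the structural isomorphisms act as expected.\<close>

datatype ('o, 'm) elem = El (ctx: "'o ctx") (arr: 'm)

context smc_category
begin

definition elem :: "('o, 'm) elem \<Rightarrow> bool" where
  "elem e \<longleftrightarrow> vctx (ctx e) \<and> arr e \<in> arrs V \<and> source V (arr e) = tens (ctx e)"

definition ty :: "('o, 'm) elem \<Rightarrow> 'o" where
  "ty e = target V (arr e)"

definition app :: "'m \<Rightarrow> ('o, 'm) elem \<Rightarrow> ('o, 'm) elem" (infixr "\<odot>" 56) where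
  "f \<odot> e = El (ctx e) (f \<cdot> arr e)"

text \<open>A linear pairing, meaningful for disjoint contexts: \<open>\<V>\<close> need not have
  diagonals, so a name is used only once in an expression.\<close>

definition pair :: "('o, 'm) elem \<Rightarrow> ('o, 'm) elem \<Rightarrow> ('o, 'm) elem" ("\<langle>_,/ _\<rangle>") where
  "\<langle>e, e'\<rangle> = El (ctx e \<union> ctx e') ((arr e \<boxtimes> arr e') \<cdot> split (ctx e) (ctx e'))"

definition unit_elem :: "('o, 'm) elem" where
  "unit_elem = El {} (\<one> \<I>)"

text \<open>The right unitor appears because \<open>tens\<close> ends in the unit:
  \<open>tens {x}\<close> is \<open>fst x \<otimes> \<I>\<close>.\<close>

definition var :: "'o \<times> nat \<Rightarrow> ('o, 'm) elem" where
  "var x = El {x} (\<r> (fst x))"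

lemma ctx_simps [simp]:
  "ctx (f \<odot> e) = ctx e" "ctx \<langle>e, e'\<rangle> = ctx e \<union> ctx e'" "ctx unit_elem = {}" "ctx (var x) = {x}"
  by (simp_all add: app_def pair_def unit_elem_def var_def)

lemma elem_vctx [simp]: "elem e \<Longrightarrow> vctx (ctx e)"
  by (simp add: elem_def)

lemma elem_obj [simp]: "elem e \<Longrightarrow> ty e \<in> objs V"
  by (simp add: elem_def ty_def)

lemma elem_app [simp]:
  assumes "elem e" "f \<in> arrs V" "source V f = ty e"
  shows "elem (f \<odot> e)" "ty (f \<odot> e) = target V f"
  using assms by (simp_all add: elem_def ty_def app_def)

lemma elem_pair [simp]:
  assumes "elem e" "elem e'" "ctx e \<inter> ctx e' = {}"
  shows "elem \<langle>e, e'\<rangle>" "ty \<langle>e, e'\<rangle> = ty e \<otimes> ty e'"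
  using assms by (simp_all add: elem_def ty_def pair_def)

lemma elem_unit [simp]: "elem unit_elem" "ty unit_elem = \<I>"
  by (simp_all add: elem_def ty_def unit_elem_def)

lemma elem_var [simp]: "fst x \<in> objs V \<Longrightarrow> elem (var x)" "fst x \<in> objs V \<Longrightarrow> ty (var x) = fst x"
  using is_inverse_typed[OF r_inverse] by (simp_all add: elem_def ty_def var_def)

lemma app_comp [simp]:
  assumes "elem e" "f \<in> arrs V" "g \<in> arrs V" "source V f = ty e" "source V g = target V f"
  shows "(g \<cdot> f) \<odot> e = g \<odot> f \<odot> e"
  using assms by (simp add: elem_def ty_def app_def)

lemma app_idt [simp]: "elem e \<Longrightarrow> ty e = X \<Longrightarrow> \<one> X \<odot> e = e"
  by (cases e) (auto simp: elem_def ty_def app_def)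

lemma app_pair [simp]:
  assumes "elem e" "elem e'" "ctx e \<inter> ctx e' = {}"
    "f \<in> arrs V" "source V f = ty e" "g \<in> arrs V" "source V g = ty e'"
  shows "(f \<boxtimes> g) \<odot> \<langle>e, e'\<rangle> = \<langle>f \<odot> e, g \<odot> e'\<rangle>"
  using assms by (simp add: elem_def ty_def app_def pair_def interchange_assoc)

text \<open>No trace of the symmetry is left in the context: a union forgets the order of its parts,
  and \<open>split_symm\<close> absorbs \<open>\<s>\<close>.\<close>

lemma app_symm [simp]:
  assumes "elem e" "elem e'" "ctx e \<inter> ctx e' = {}" "ty e = X" "ty e' = Y"
  shows "\<s> X Y \<odot> \<langle>e, e'\<rangle> = \<langle>e', e\<rangle>"
proof -
  note t = assms(1-3)[unfolded elem_def] and ty = assms(4,5)[symmetric, unfolded ty_def]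
  have "\<s> X Y \<cdot> (arr e \<boxtimes> arr e') \<cdot> split (ctx e) (ctx e') = (\<s> X Y \<cdot> (arr e \<boxtimes> arr e')) \<cdot> split (ctx e) (ctx e')"
    using t ty by simp
  also have "\<dots> = (arr e' \<boxtimes> arr e) \<cdot> split (ctx e') (ctx e)"
    using t ty s_nat[of "arr e" "arr e'"] split_symm[of "ctx e" "ctx e'"] by simp
  finally show ?thesis by (simp add: app_def pair_def Un_commute)
qed

lemma app_associator [simp]:
  assumes "elem e" "elem e'" "elem e''" "ctx e \<inter> ctx e' = {}" "ctx e' \<inter> ctx e'' = {}" "ctx e \<inter> ctx e'' = {}"
    "ty e = X" "ty e' = Y" "ty e'' = Z"
  shows "\<a> X Y Z \<odot> \<langle>\<langle>e, e'\<rangle>, e''\<rangle> = \<langle>e, \<langle>e', e''\<rangle>\<rangle>"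
proof -
  note t = assms(1-6)[unfolded elem_def] and ty = assms(7-9)[symmetric, unfolded ty_def]
  let ?N = "ctx e" and ?M = "ctx e'" and ?P = "ctx e''"
  have [simp]: "(?N \<union> ?M) \<inter> ?P = {}" "?N \<inter> (?M \<union> ?P) = {}" using assms by auto
  have A: "\<a> (tens ?N) (tens ?M) (tens ?P) \<cdot> (split ?N ?M \<boxtimes> \<one> (tens ?P)) \<cdot> split (?N \<union> ?M) ?P
     = (\<one> (tens ?N) \<boxtimes> split ?M ?P) \<cdot> split ?N (?M \<union> ?P)"
    using split_assoc[of ?N ?M ?P] t by (simp add: split_assoc_def)
  have "\<a> X Y Z \<cdot> (((arr e \<boxtimes> arr e') \<cdot> split ?N ?M) \<boxtimes> arr e'') \<cdot> split (?N \<union> ?M) ?P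
    = \<a> X Y Z \<cdot> ((arr e \<boxtimes> arr e') \<boxtimes> arr e'') \<cdot> (split ?N ?M \<boxtimes> \<one> (tens ?P)) \<cdot> split (?N \<union> ?M) ?P"
    using t ty by (simp add: interchange_assoc)
  also have "\<dots> = (\<a> X Y Z \<cdot> ((arr e \<boxtimes> arr e') \<boxtimes> arr e'')) \<cdot> (split ?N ?M \<boxtimes> \<one> (tens ?P)) \<cdot> split (?N \<union> ?M) ?P"
    using t ty by simp
  also have "\<dots> = (arr e \<boxtimes> (arr e' \<boxtimes> arr e'')) \<cdot> (\<one> (tens ?N) \<boxtimes> split ?M ?P) \<cdot> split ?N (?M \<union> ?P)"
    using t ty a_nat[of "arr e" "arr e'" "arr e''"] by (simp add: A)
  also have "\<dots> = (arr e \<boxtimes> ((arr e' \<boxtimes> arr e'') \<cdot> split ?M ?P)) \<cdot> split ?N (?M \<union> ?P)"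
    using t ty by (simp add: interchange_assoc)
  finally show ?thesis by (simp add: app_def pair_def Un_assoc)
qed

lemma app_left_unitor [simp]: "elem e \<Longrightarrow> ty e = X \<Longrightarrow> \<l> X \<odot> \<langle>unit_elem, e\<rangle> = e"
proof -
  assume e: "elem e" "ty e = X"
  note t = e(1)[unfolded elem_def] and ty = e(2)[symmetric, unfolded ty_def]
  have "\<l> X \<cdot> (\<one> \<I> \<boxtimes> arr e) \<cdot> \<l>\<^sup>- (tens (ctx e)) = (\<l> X \<cdot> (\<one> \<I> \<boxtimes> arr e)) \<cdot> \<l>\<^sup>- (tens (ctx e))"
    using t ty by simp
  also have "\<dots> = arr e" using t ty l_nat[of "arr e"] by simp
  finally show ?thesis by (cases e) (simp add: app_def pair_def unit_elem_def)
qed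

lemma app_right_unitor [simp]: "elem e \<Longrightarrow> ty e = X \<Longrightarrow> \<r> X \<odot> \<langle>e, unit_elem\<rangle> = e"
proof -
  assume e: "elem e" "ty e = X"
  then have "\<r> X \<odot> \<langle>e, unit_elem\<rangle> = \<l> X \<odot> \<s> X \<I> \<odot> \<langle>e, unit_elem\<rangle>"
    by (subst left_unitor_symm[symmetric]) auto
  then show ?thesis using e by simp
qed

lemma app_left_unitor_inverse [simp]: "elem e \<Longrightarrow> ty e = X \<Longrightarrow> \<l>\<^sup>- X \<odot> e = \<langle>unit_elem, e\<rangle>"
proof -
  assume e: "elem e" "ty e = X"
  have "\<l>\<^sup>- X \<odot> \<l> X \<odot> \<langle>unit_elem, e\<rangle> = \<langle>unit_elem, e\<rangle>"
    using e by (auto simp flip: app_comp simp del: app_left_unitor)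
  then show ?thesis using e by simp
qed

lemma app_right_unitor_inverse [simp]: "elem e \<Longrightarrow> ty e = X \<Longrightarrow> \<r>\<^sup>- X \<odot> e = \<langle>e, unit_elem\<rangle>"
proof -
  assume e: "elem e" "ty e = X"
  have "\<r>\<^sup>- X \<odot> \<r> X \<odot> \<langle>e, unit_elem\<rangle> = \<langle>e, unit_elem\<rangle>"
    using e by (auto simp flip: app_comp simp del: app_right_unitor)
  then show ?thesis using e by simp
qed

lemma app_unit: "a \<in> \<V> \<I> E \<Longrightarrow> a \<odot> unit_elem = El {} a"
  by (auto simp: app_def unit_elem_def dest: arrowsD)

section \<open>Universal elements: comparing and defining arrows on elements\<close>

definition generic :: "'o ctx \<Rightarrow> ('o, 'm) elem" where
  "generic N = El N (\<one> (tens N))"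

lemma generic_simps [simp]:
  "ctx (generic N) = N" "vctx N \<Longrightarrow> elem (generic N)" "vctx N \<Longrightarrow> ty (generic N) = tens N"
  by (simp_all add: generic_def elem_def ty_def)

lemma app_generic:
  assumes "elem e"
  shows "arr e \<in> \<V> (tens (ctx e)) (ty e)" "arr e \<odot> generic (ctx e) = e"
  using assms by (cases e; simp add: elem_def ty_def generic_def app_def arrows_def)+

text \<open>An arrow can be recovered from its value at such an element. Variables, the unit and
  disjoint pairs of universal elements qualify, so arrows out of tensor products may be compared on
  tuples of distinct variables.\<close>

definition universal :: "('o, 'm) elem \<Rightarrow> bool" where
  "universal e \<longleftrightarrow> elem e \<and> is_iso V (tens (ctx e)) (ty e) (arr e)"

lemma universal_elem: "universal e \<Longrightarrow> elem e"
  by (simp add: universal_def)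

lemma universal_var [simp]: "fst x \<in> objs V \<Longrightarrow> universal (var x)"
  using right_unitor_iso[of "fst x"] by (simp add: universal_def) (simp add: var_def)

lemma universal_generic [simp]: "vctx N \<Longrightarrow> universal (generic N)"
  using is_iso_idt[of "tens N"] by (simp add: universal_def) (simp add: generic_def)

lemma universal_unit [simp]: "universal unit_elem"
  using universal_generic[of "{}"] by (simp add: generic_def unit_elem_def)

lemma universal_pair [simp]:
  assumes "universal e" "universal e'" "ctx e \<inter> ctx e' = {}"
  shows "universal \<langle>e, e'\<rangle>"
  using assms is_iso_comp[OF split_iso is_iso_tensor]
  by (simp add: universal_def) (simp add: pair_def)

lemma universal_app:
  assumes "universal e" "is_iso V (ty e) E f"
  shows "universal (f \<odot> e)"
proof -
  have "f \<in> arrs V" "source V f = ty e" "target V f = E"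
    using is_inverse_typed[OF inv_arr[OF assms(2)]] by auto
  then show ?thesis using assms is_iso_comp[of "tens (ctx e)" "ty e" "arr e" E f]
    by (simp add: universal_def) (simp add: app_def)
qed

lemma universal_ext:
  assumes "f \<odot> e = g \<odot> e" "universal e" "f \<in> \<V> (ty e) G" "g \<in> \<V> (ty e) G"
  shows "f = g"
  by (rule iso_cancel_right[of "tens (ctx e)" "ty e" "arr e"])
    (use assms arrowsD[OF assms(3)] arrowsD[OF assms(4)] in \<open>auto simp: app_def universal_def\<close>)

lemma arr_ext:
  assumes "f \<odot> var x = g \<odot> var x" "f \<in> \<V> E G" "g \<in> \<V> E G" "fst x = E"
  shows "f = g"
  using assms arrows_dom[OF assms(2)] by (intro universal_ext[of f "var x" g G]) auto

lemma arr_ext2: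
  assumes "f \<odot> \<langle>var x, var y\<rangle> = g \<odot> \<langle>var x, var y\<rangle>" "f \<in> \<V> (fst x \<otimes> fst y) G" "g \<in> \<V> (fst x \<otimes> fst y) G"
    "fst x \<in> objs V" "fst y \<in> objs V" "x \<noteq> y"
  shows "f = g"
  using assms by (intro universal_ext[of f "\<langle>var x, var y\<rangle>" g G]) auto

lemma arr_ext3:
  assumes "f \<odot> \<langle>\<langle>var x, var y\<rangle>, var z\<rangle> = g \<odot> \<langle>\<langle>var x, var y\<rangle>, var z\<rangle>"
    "f \<in> \<V> ((fst x \<otimes> fst y) \<otimes> fst z) G" "g \<in> \<V> ((fst x \<otimes> fst y) \<otimes> fst z) G"
    "fst x \<in> objs V" "fst y \<in> objs V" "fst z \<in> objs V" "x \<noteq> y" "y \<noteq> z" "x \<noteq> z"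
  shows "f = g"
  using assms by (intro universal_ext[of f "\<langle>\<langle>var x, var y\<rangle>, var z\<rangle>" g G]) auto

text \<open>Abstraction: an expression \<open>z\<close> in the variables of a universal
  \<open>e\<close> is some arrow applied to \<open>e\<close>. This is how a construction on a
  generic element yields an arrow.\<close>

lemma abstract_elem:
  assumes "elem z" "universal e" "ctx z = ctx e" "ty e = E" "ty z = G"
  obtains q where "q \<in> \<V> E G" "z = q \<odot> e"
proof -
  obtain k where k: "is_inverse V (tens (ctx z)) (ty e) (arr e) k"
    using assms by (metis universal_def is_iso_def)
  note t = is_inverse_typed[OF k]
  have z: "arr z \<in> arrs V" "source V (arr z) = tens (ctx z)" "target V (arr z) = ty z"
    using assms(1) by (auto simp: elem_def ty_def)
  have "(arr z \<cdot> k) \<odot> e = z"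
    using t z assms(3) by (cases z) (simp add: app_def)
  then show ?thesis using that[of "arr z \<cdot> k"] t z assms(4,5) by (simp add: arrows_def)
qed

section \<open>The internal hom on elements\<close>

lemma curry_arr:
  assumes "X \<in> objs V" "Y \<in> objs V" "Z \<in> objs V" "f \<in> \<V> (Z \<otimes> X) Y"
  shows "curry_arr Z X Y f \<in> \<V> Z (X \<Rrightarrow> Y)" "\<e> X Y \<cdot> (curry_arr Z X Y f \<boxtimes> \<one> X) = f"
  using theI'[OF closed[OF assms]] unfolding curry_arr_def by auto

lemma e_typed [simp]:
  assumes "X \<in> objs V" "Y \<in> objs V"
  shows "\<e> X Y \<in> arrs V" "source V (\<e> X Y) = (X \<Rrightarrow> Y) \<otimes> X" "target V (\<e> X Y) = Y"
  using eval_arr[OF assms] by (auto simp: arrows_def)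

lemma curry_typed [simp]:
  assumes "X \<in> objs V" "Y \<in> objs V" "Z \<in> objs V" "f \<in> arrs V" "source V f = Z \<otimes> X" "target V f = Y"
  shows "curry_arr Z X Y f \<in> arrs V" "source V (curry_arr Z X Y f) = Z" "target V (curry_arr Z X Y f) = X \<Rrightarrow> Y"
  using curry_arr(1)[of X Y Z f] assms by (auto simp: arrows_def)

definition ev :: "'o \<Rightarrow> 'o \<Rightarrow> ('o, 'm) elem \<Rightarrow> ('o, 'm) elem \<Rightarrow> ('o, 'm) elem" where
  "ev X Y z x = \<e> X Y \<odot> \<langle>z, x\<rangle>"

lemma ctx_ev [simp]: "ctx (ev X Y z x) = ctx z \<union> ctx x"
  by (simp add: ev_def)

lemma elem_ev [simp]:
  assumes "elem z" "elem x" "ty z = X \<Rrightarrow> Y" "ty x = X" "ctx z \<inter> ctx x = {}" "Y \<in> objs V"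
  shows "elem (ev X Y z x)" "ty (ev X Y z x) = Y"
  using assms elem_obj[of x] by (simp_all add: ev_def)

lemma ev_curry [simp]:
  assumes "elem z" "elem x" "ty z = Z" "ty x = X" "ctx z \<inter> ctx x = {}"
    "f \<in> arrs V" "source V f = Z \<otimes> X" "target V f = Y"
  shows "ev X Y (curry_arr Z X Y f \<odot> z) x = f \<odot> \<langle>z, x\<rangle>"
proof -
  have [simp]: "X \<in> objs V" "Y \<in> objs V" "Z \<in> objs V" using assms elem_obj target_obj by blast+
  have "f \<odot> \<langle>z, x\<rangle> = (\<e> X Y \<cdot> (curry_arr Z X Y f \<boxtimes> \<one> X)) \<odot> \<langle>z, x\<rangle>"
    using assms curry_arr(2)[of X Y Z f] by (simp add: arrows_def)
  then show ?thesis using assms by (simp add: ev_def)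
qed

lemma curry_ext:
  assumes "f \<in> \<V> Z (X \<Rrightarrow> Y)" "g \<in> \<V> Z (X \<Rrightarrow> Y)" "X \<in> objs V" "Y \<in> objs V"
    and eq: "ev X Y (f \<odot> var z) (var x) = ev X Y (g \<odot> var z) (var x)" "fst z = Z" "fst x = X" "z \<noteq> x"
  shows "f = g"
proof -
  note [simp] = assms(3,4)
  have Z [simp]: "Z \<in> objs V" using arrows_dom[OF assms(1)] .
  note t = arrowsD[OF assms(1)] arrowsD[OF assms(2)]
  have "\<e> X Y \<cdot> (f \<boxtimes> \<one> X) = \<e> X Y \<cdot> (g \<boxtimes> \<one> X)"
    by (rule arr_ext2[of _ z x]) (use assms t in \<open>auto simp: ev_def arrows_def\<close>)
  moreover have "\<e> X Y \<cdot> (f \<boxtimes> \<one> X) \<in> \<V> (Z \<otimes> X) Y" using t by (simp add: arrows_def)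
  ultimately show ?thesis using closed[of X Y Z "\<e> X Y \<cdot> (f \<boxtimes> \<one> X)"] assms(1,2) by auto
qed

text \<open>Function extensionality in an arbitrary ambient context. One universal argument
  suffices, since \<open>\<langle>generic (ctx f), u\<rangle>\<close> is then universal and currying
  is unique.\<close>

lemma ev_ext:
  assumes "elem f" "elem g" "ty f = X \<Rrightarrow> Y" "ty g = X \<Rrightarrow> Y" "ctx f = ctx g" "X \<in> objs V" "Y \<in> objs V"
    and eq: "ev X Y f u = ev X Y g u" "universal u" "ty u = X" "ctx f \<inter> ctx u = {}"
  shows "f = g"
proof -
  note [simp] = assms(6,7)
  let ?t = "tens (ctx f)"
  have v [simp]: "vctx (ctx f)" "vctx (ctx g)" using assms by auto
  have f: "arr f \<in> \<V> ?t (X \<Rrightarrow> Y)" and g: "arr g \<in> \<V> ?t (X \<Rrightarrow> Y)"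
    using app_generic[OF assms(1)] app_generic[OF assms(2)] assms by auto
  note t = arrowsD[OF f] arrowsD[OF g]
  have f': "arr f \<odot> generic (ctx f) = f" and g': "arr g \<odot> generic (ctx f) = g"
    using app_generic(2)[OF assms(1)] app_generic(2)[OF assms(2)] assms(5) by auto
  have "\<e> X Y \<cdot> (arr f \<boxtimes> \<one> X) = \<e> X Y \<cdot> (arr g \<boxtimes> \<one> X)"
    by (rule universal_ext[of _ "\<langle>generic (ctx f), u\<rangle>" _ Y])
      (use t assms f' g' universal_elem[of u] in \<open>auto simp: ev_def arrows_def\<close>)
  moreover have "\<e> X Y \<cdot> (arr f \<boxtimes> \<one> X) \<in> \<V> (?t \<otimes> X) Y" using t by (simp add: arrows_def)
  ultimately have "arr f = arr g" using closed[of X Y ?t "\<e> X Y \<cdot> (arr f \<boxtimes> \<one> X)"] f g by auto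
  then show ?thesis using assms(5) by (simp add: elem.expand)
qed

end

section \<open>Graded morphisms of enriched categories\<close>

text \<open>\<open>Gm X Y e\<close> is an element \<open>e\<close> of \<open>C(X,Y)\<close>, regarded as a morphism \<open>X \<rightarrow> Y\<close> depending on the variables in
  the context of \<open>e\<close>. Morphisms with disjoint contexts compose strictly associatively, so enriched
  notions can be handled as in an ordinary category.\<close>

datatype ('a, 'o, 'm) gmor = Gm (gdom: 'a) (gcod: 'a) (gel: "('o, 'm) elem")

abbreviation gctx :: "('a, 'o, 'm) gmor \<Rightarrow> 'o ctx" where
  "gctx f \<equiv> ctx (gel f)"

declare Int_Un_distrib [simp] Int_Un_distrib2 [simp]

context smc_category
begin

definition gm :: "('a, 'o, 'm, 'z) vcat_scheme \<Rightarrow> ('a, 'o, 'm) gmor \<Rightarrow> bool" where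
  "gm C f \<longleftrightarrow> gdom f \<in> Ob C \<and> gcod f \<in> Ob C \<and> elem (gel f) \<and> ty (gel f) = Hom C (gdom f) (gcod f)"

definition gcomp :: "('a, 'o, 'm, 'z) vcat_scheme \<Rightarrow> ('a, 'o, 'm) gmor \<Rightarrow> ('a, 'o, 'm) gmor \<Rightarrow> ('a, 'o, 'm) gmor" where
  "gcomp C g f = Gm (gdom f) (gcod g) (Comp C (gdom f) (gcod f) (gcod g) \<odot> \<langle>gel g, gel f\<rangle>)"

definition gid :: "('a, 'o, 'm, 'z) vcat_scheme \<Rightarrow> 'a \<Rightarrow> ('a, 'o, 'm) gmor" where
  "gid C X = Gm X X (Ide C X \<odot> unit_elem)"

definition gmap :: "('a, 'b, 'm) vfun \<Rightarrow> ('a, 'o, 'm) gmor \<Rightarrow> ('b, 'o, 'm) gmor" where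
  "gmap F f = Gm (obj_map F (gdom f)) (obj_map F (gcod f)) (hom_map F (gdom f) (gcod f) \<odot> gel f)"

text \<open>The typing clauses of \<open>is_vcat\<close> alone. With them graded morphisms can be
  composed before the laws are known, as is needed while the laws of a new enriched category are
  being proved on graded morphisms.\<close>

definition vcat_typed :: "('a, 'o, 'm, 'z) vcat_scheme \<Rightarrow> bool" where
  "vcat_typed C \<longleftrightarrow>
     (\<forall>X \<in> Ob C. \<forall>Y \<in> Ob C. Hom C X Y \<in> objs V) \<and>
     (\<forall>X \<in> Ob C. \<forall>Y \<in> Ob C. \<forall>Z \<in> Ob C.
        Comp C X Y Z \<in> \<V> (Hom C Y Z \<otimes> Hom C X Y) (Hom C X Z)) \<and>
     (\<forall>X \<in> Ob C. Ide C X \<in> \<V> \<I> (Hom C X X))"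

definition vfun_typed :: "('a, 'o, 'm, 'y) vcat_scheme \<Rightarrow> ('b, 'o, 'm, 'z) vcat_scheme \<Rightarrow> ('a, 'b, 'm) vfun \<Rightarrow> bool" where
  "vfun_typed B C F \<longleftrightarrow>
     (\<forall>X \<in> Ob B. obj_map F X \<in> Ob C) \<and>
     (\<forall>X \<in> Ob B. \<forall>Y \<in> Ob B. hom_map F X Y \<in> \<V> (Hom B X Y) (Hom C (obj_map F X) (obj_map F Y)))"

lemma is_vcat_typed [simp]: "is_vcat C \<Longrightarrow> vcat_typed C"
  by (simp add: is_vcat_def vcat_typed_def)

lemma is_vfun_typed: "is_vfun B C F \<Longrightarrow> vfun_typed B C F"
  by (simp add: is_vfun_def vfun_typed_def)

lemma vcat_simps [simp]:
  assumes "vcat_typed C" "X \<in> Ob C" "Y \<in> Ob C"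
  shows "Hom C X Y \<in> objs V"
    "Z \<in> Ob C \<Longrightarrow> Comp C X Y Z \<in> arrs V"
    "Z \<in> Ob C \<Longrightarrow> source V (Comp C X Y Z) = Hom C Y Z \<otimes> Hom C X Y"
    "Z \<in> Ob C \<Longrightarrow> target V (Comp C X Y Z) = Hom C X Z"
  using assms unfolding vcat_typed_def arrows_def by auto

lemma vcat_Ide_simps [simp]:
  assumes "vcat_typed C" "X \<in> Ob C"
  shows "Ide C X \<in> arrs V" "source V (Ide C X) = \<I>" "target V (Ide C X) = Hom C X X"
  using assms unfolding vcat_typed_def arrows_def by auto

lemma vfun_simps:
  assumes "vfun_typed B C F" "X \<in> Ob B"
  shows "obj_map F X \<in> Ob C"
    "Y \<in> Ob B \<Longrightarrow> hom_map F X Y \<in> arrs V"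
    "Y \<in> Ob B \<Longrightarrow> source V (hom_map F X Y) = Hom B X Y"
    "Y \<in> Ob B \<Longrightarrow> target V (hom_map F X Y) = Hom C (obj_map F X) (obj_map F Y)"
  using assms unfolding vfun_typed_def arrows_def by auto

lemma gm_simps:
  assumes "gm C f"
  shows "gdom f \<in> Ob C" "gcod f \<in> Ob C" "elem (gel f)" "ty (gel f) = Hom C (gdom f) (gcod f)"
  using assms by (auto simp: gm_def)

lemma gcomp_simps [simp]:
  "gdom (gcomp C g f) = gdom f" "gcod (gcomp C g f) = gcod g" "gctx (gcomp C g f) = gctx g \<union> gctx f"
  by (simp_all add: gcomp_def)

lemma gid_simps [simp]: "gdom (gid C X) = X" "gcod (gid C X) = X" "gctx (gid C X) = {}"
  by (simp_all add: gid_def)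

lemma gmap_simps [simp]:
  "gdom (gmap F f) = obj_map F (gdom f)" "gcod (gmap F f) = obj_map F (gcod f)" "gctx (gmap F f) = gctx f"
  by (simp_all add: gmap_def)

lemma gm_gcomp [simp]:
  assumes "vcat_typed C" "gm C f" "gm C g" "gcod f = gdom g" "gctx g \<inter> gctx f = {}"
  shows "gm C (gcomp C g f)"
  using assms gm_simps[OF assms(2)] gm_simps[OF assms(3)] by (simp add: gm_def) (simp add: gcomp_def)

lemma gm_gid [simp]: "vcat_typed C \<Longrightarrow> X \<in> Ob C \<Longrightarrow> gm C (gid C X)"
  by (simp add: gm_def) (simp add: gid_def)

lemma gm_gmap:
  assumes "vfun_typed B C F" "gm B f"
  shows "gm C (gmap F f)"
  using gm_simps[OF assms(2)] vfun_simps[OF assms(1)] by (simp add: gm_def) (simp add: gmap_def)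

lemma gm_Gm [simp]: "gm C (Gm X Y e) \<longleftrightarrow> X \<in> Ob C \<and> Y \<in> Ob C \<and> elem e \<and> ty e = Hom C X Y"
  by (simp add: gm_def)

lemma gm_vctx [simp]: "gm C f \<Longrightarrow> vctx (gctx f)"
  by (simp add: gm_def)

text \<open>The enriched associativity law evaluated at the nested pair of \<open>h\<close>,
  \<open>g\<close> and \<open>f\<close>: on elements the associator merely rebrackets the
  pair.\<close>

lemma gassoc [simp]:
  assumes C: "is_vcat C" and "gm C f" "gm C g" "gm C h" "gcod f = gdom g" "gcod g = gdom h"
    "gctx h \<inter> gctx g = {}" "gctx g \<inter> gctx f = {}" "gctx h \<inter> gctx f = {}"
  shows "gcomp C (gcomp C h g) f = gcomp C h (gcomp C g f)"
proof -
  note f = gm_simps[OF assms(2)] and g = gm_simps[OF assms(3)] and h = gm_simps[OF assms(4)]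
  have t: "vcat_typed C" using C by simp
  let ?W = "gdom f" and ?X = "gdom g" and ?Y = "gdom h" and ?Z = "gcod h"
  have "(Comp C ?W ?X ?Z \<cdot> (Comp C ?X ?Y ?Z \<boxtimes> \<one> (Hom C ?W ?X))) \<odot> \<langle>\<langle>gel h, gel g\<rangle>, gel f\<rangle> =
     (Comp C ?W ?Y ?Z \<cdot> (\<one> (Hom C ?Y ?Z) \<boxtimes> Comp C ?W ?X ?Y) \<cdot> \<a> (Hom C ?Y ?Z) (Hom C ?X ?Y) (Hom C ?W ?X))
       \<odot> \<langle>\<langle>gel h, gel g\<rangle>, gel f\<rangle>"
    using C f(1) g(1) h(1,2) unfolding is_vcat_def by (metis (no_types))
  then show ?thesis using t f g h assms by (simp add: gcomp_def)
qed

lemma gid_left [simp]: "is_vcat C \<Longrightarrow> gm C f \<Longrightarrow> gcod f = X \<Longrightarrow> gcomp C (gid C X) f = f"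
proof -
  assume C: "is_vcat C" and f: "gm C f" "gcod f = X"
  note g = gm_simps[OF f(1)]
  have "(Comp C (gdom f) X X \<cdot> (Ide C X \<boxtimes> \<one> (Hom C (gdom f) X))) \<odot> \<langle>unit_elem, gel f\<rangle> = \<l> (Hom C (gdom f) X) \<odot> \<langle>unit_elem, gel f\<rangle>"
    using C f g unfolding is_vcat_def by (metis (no_types))
  then show ?thesis using C f g by (cases f) (simp add: gcomp_def gid_def)
qed

lemma gid_right [simp]: "is_vcat C \<Longrightarrow> gm C f \<Longrightarrow> gdom f = X \<Longrightarrow> gcomp C f (gid C X) = f"
proof -
  assume C: "is_vcat C" and f: "gm C f" "gdom f = X"
  note g = gm_simps[OF f(1)]
  have "(Comp C X X (gcod f) \<cdot> (\<one> (Hom C X (gcod f)) \<boxtimes> Ide C X)) \<odot> \<langle>gel f, unit_elem\<rangle> = \<r> (Hom C X (gcod f)) \<odot> \<langle>gel f, unit_elem\<rangle>"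
    using C f g unfolding is_vcat_def by (metis (no_types))
  then show ?thesis using C f g by (cases f) (simp add: gcomp_def gid_def)
qed

text \<open>The laws are instantiated at graded morphisms given by distinct variables of the
  hom-objects; there they become equations at universal elements, hence equations of arrows.\<close>

lemma is_vcatI:
  assumes t [simp]: "vcat_typed C"
    and assoc: "\<And>f g h. \<lbrakk>gm C f; gm C g; gm C h; gcod f = gdom g; gcod g = gdom h;
      gctx h \<inter> gctx g = {}; gctx g \<inter> gctx f = {}; gctx h \<inter> gctx f = {}\<rbrakk>
      \<Longrightarrow> gcomp C (gcomp C h g) f = gcomp C h (gcomp C g f)"
    and ids: "\<And>f. gm C f \<Longrightarrow> gcomp C (gid C (gcod f)) f = f" "\<And>f. gm C f \<Longrightarrow> gcomp C f (gid C (gdom f)) = f"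
  shows "is_vcat C"
  unfolding is_vcat_def
proof (intro conjI ballI)
  fix W X Y Z assume [simp]: "W \<in> Ob C" "X \<in> Ob C" "Y \<in> Ob C" "Z \<in> Ob C"
  let ?x = "(Hom C W X, 0)" and ?y = "(Hom C X Y, 1)" and ?z = "(Hom C Y Z, 2)"
  let ?f = "Gm W X (var ?x)" and ?g = "Gm X Y (var ?y)" and ?h = "Gm Y Z (var ?z)"
  have "gcomp C (gcomp C ?h ?g) ?f = gcomp C ?h (gcomp C ?g ?f)"
    by (rule assoc) auto
  then show "Comp C W X Z \<cdot> (Comp C X Y Z \<boxtimes> \<one> (Hom C W X)) =
        Comp C W Y Z \<cdot> (\<one> (Hom C Y Z) \<boxtimes> Comp C W X Y) \<cdot> \<a> (Hom C Y Z) (Hom C X Y) (Hom C W X)"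
    by (intro arr_ext3[of _ ?z ?y ?x _ "Hom C W Z"]) (auto simp: gcomp_def arrows_def)
next
  fix X Y assume [simp]: "X \<in> Ob C" "Y \<in> Ob C"
  let ?x = "(Hom C X Y, 0)" and ?u = "(\<I>, 1)"
  let ?f = "Gm X Y (var ?x)"
  show "Comp C X Y Y \<cdot> (Ide C Y \<boxtimes> \<one> (Hom C X Y)) = \<l> (Hom C X Y)"
    using ids(1)[of ?f]
    by (intro universal_ext[of _ "\<langle>unit_elem, var ?x\<rangle>" _ "Hom C X Y"])
      (auto simp: gcomp_def gid_def arrows_def)
  show "Comp C X X Y \<cdot> (\<one> (Hom C X Y) \<boxtimes> Ide C X) = \<r> (Hom C X Y)"
    using ids(2)[of ?f]
    by (intro universal_ext[of _ "\<langle>var ?x, unit_elem\<rangle>" _ "Hom C X Y"])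
      (auto simp: gcomp_def gid_def arrows_def)
qed (use t in \<open>auto simp: vcat_typed_def\<close>)

lemma gmap_gcomp:
  assumes F: "is_vfun B C F" and B: "vcat_typed B" and C: "vcat_typed C"
    and "gm B f" "gm B g" "gcod f = gdom g" "gctx g \<inter> gctx f = {}"
  shows "gmap F (gcomp B g f) = gcomp C (gmap F g) (gmap F f)"
proof -
  note f = gm_simps[OF assms(4)] and g = gm_simps[OF assms(5)]
  note t = vfun_simps[OF is_vfun_typed[OF F]]
  let ?X = "gdom f" and ?Y = "gdom g" and ?Z = "gcod g"
  have "(hom_map F ?X ?Z \<cdot> Comp B ?X ?Y ?Z) \<odot> \<langle>gel g, gel f\<rangle> =
    (Comp C (obj_map F ?X) (obj_map F ?Y) (obj_map F ?Z) \<cdot> (hom_map F ?Y ?Z \<boxtimes> hom_map F ?X ?Y)) \<odot> \<langle>gel g, gel f\<rangle>"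
    using F f(1) g(1,2) unfolding is_vfun_def by (metis (no_types))
  then show ?thesis using f g t B C assms by (simp add: gcomp_def gmap_def)
qed

lemma gmap_gid:
  assumes F: "is_vfun B C F" and B: "vcat_typed B" and "X \<in> Ob B"
  shows "gmap F (gid B X) = gid C (obj_map F X)"
proof -
  have "(hom_map F X X \<cdot> Ide B X) \<odot> unit_elem = Ide C (obj_map F X) \<odot> unit_elem"
    using assms unfolding is_vfun_def by (metis (no_types))
  then show ?thesis using assms vfun_simps[OF is_vfun_typed[OF F]] by (simp add: gid_def gmap_def)
qed

lemma is_vfunI:
  assumes B [simp]: "vcat_typed B" and C [simp]: "vcat_typed C" and F: "vfun_typed B C F"
    and comp: "\<And>f g. \<lbrakk>gm B f; gm B g; gcod f = gdom g; gctx g \<inter> gctx f = {}\<rbrakk>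
      \<Longrightarrow> gmap F (gcomp B g f) = gcomp C (gmap F g) (gmap F f)"
    and id: "\<And>X. X \<in> Ob B \<Longrightarrow> gmap F (gid B X) = gid C (obj_map F X)"
  shows "is_vfun B C F"
  unfolding is_vfun_def
proof (intro conjI ballI)
  note [simp] = vfun_simps[OF F]
  {
    fix X Y Z assume [simp]: "X \<in> Ob B" "Y \<in> Ob B" "Z \<in> Ob B"
    let ?x = "(Hom B X Y, 0)" and ?y = "(Hom B Y Z, 1)"
    have "gmap F (gcomp B (Gm Y Z (var ?y)) (Gm X Y (var ?x)))
        = gcomp C (gmap F (Gm Y Z (var ?y))) (gmap F (Gm X Y (var ?x)))"
      by (rule comp) auto
    then show "hom_map F X Z \<cdot> Comp B X Y Z =
        Comp C (obj_map F X) (obj_map F Y) (obj_map F Z) \<cdot> (hom_map F Y Z \<boxtimes> hom_map F X Y)"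
      by (intro arr_ext2[of _ ?y ?x _ "Hom C (obj_map F X) (obj_map F Z)"]) (auto simp: gcomp_def gmap_def arrows_def)
  }
  fix X assume [simp]: "X \<in> Ob B"
  show "hom_map F X X \<cdot> Ide B X = Ide C (obj_map F X)"
    using id[of X]
    by (intro universal_ext[of _ unit_elem _ "Hom C (obj_map F X) (obj_map F X)"])
      (auto simp: gid_def gmap_def arrows_def)
qed (use F in \<open>auto simp: vfun_typed_def\<close>)

lemma gmap_ext:
  assumes "vfun_typed B C F" "vfun_typed B C G" "X \<in> Ob B" "Y \<in> Ob B" "vcat_typed B"
    "gmap F (Gm X Y (var (Hom B X Y, 0))) = gmap G (Gm X Y (var (Hom B X Y, 0)))"
  shows "hom_map F X Y = hom_map G X Y"
  using assms vfun_simps[OF assms(1)] vfun_simps[OF assms(2)]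
  by (intro arr_ext[of _ "(Hom B X Y, 0)" _ "Hom B X Y" "Hom C (obj_map F X) (obj_map F Y)"])
    (auto simp: gmap_def arrows_def)

lemma gmap_vfun_comp:
  assumes "vfun_typed B C F" "vfun_typed C D G" "gm B f"
  shows "gmap (vfun_comp G F) f = gmap G (gmap F f)"
  using gm_simps[OF assms(3)] vfun_simps[OF assms(1)] vfun_simps[OF assms(2)]
  by (simp add: gmap_def vfun_comp_def)

lemma vfun_typed_comp:
  assumes "vfun_typed B C F" "vfun_typed C D G"
  shows "vfun_typed B D (vfun_comp G F)"
  using vfun_simps[OF assms(1)] vfun_simps[OF assms(2)]
  by (auto simp: vfun_typed_def vfun_comp_def arrows_def)

lemma is_vfun_comp:
  assumes "is_vfun B C F" "is_vfun C D G" "vcat_typed B" "vcat_typed C" "vcat_typed D"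
  shows "is_vfun B D (vfun_comp G F)"
proof (rule is_vfunI)
  note F = is_vfun_typed[OF assms(1)] and G = is_vfun_typed[OF assms(2)]
  show "vfun_typed B D (vfun_comp G F)" by (rule vfun_typed_comp[OF F G])
  show "gmap (vfun_comp G F) (gcomp B g f) = gcomp D (gmap (vfun_comp G F) g) (gmap (vfun_comp G F) f)"
    if "gm B f" "gm B g" "gcod f = gdom g" "gctx g \<inter> gctx f = {}" for f g
    using that assms(3-5)
    by (simp add: gmap_vfun_comp[OF F G] gmap_gcomp[OF assms(1)] gmap_gcomp[OF assms(2)] gm_gmap[OF F])
  show "gmap (vfun_comp G F) (gid B X) = gid D (obj_map (vfun_comp G F) X)" if "X \<in> Ob B" for X
    using that assms(3-5) vfun_simps[OF F]
    by (simp add: gmap_vfun_comp[OF F G] gmap_gid[OF assms(1)] gmap_gid[OF assms(2)]) (simp add: vfun_comp_def)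
qed (use assms in auto)

text \<open>A component \<open>t X\<close> is a graded morphism with empty context, and pairing with
  it absorbs the inverse unitors of the enriched square. What is left is an ordinary naturality
  square for each graded \<open>f\<close>.\<close>

lemma is_vnat_iff:
  assumes B [simp]: "vcat_typed B" and C [simp]: "vcat_typed C" and F: "vfun_typed B C F" and G: "vfun_typed B C G"
  shows "is_vnat B C F G t \<longleftrightarrow>
     (\<forall>X \<in> Ob B. t X \<in> \<V> \<I> (Hom C (obj_map F X) (obj_map G X))) \<and>
     (\<forall>f. gm B f \<longrightarrow>
        gcomp C (Gm (obj_map F (gcod f)) (obj_map G (gcod f)) (El {} (t (gcod f)))) (gmap F f) =
        gcomp C (gmap G f) (Gm (obj_map F (gdom f)) (obj_map G (gdom f)) (El {} (t (gdom f)))))"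
proof (cases "\<forall>X \<in> Ob B. t X \<in> \<V> \<I> (Hom C (obj_map F X) (obj_map G X))")
  case True
  note [simp] = vfun_simps[OF F] vfun_simps[OF G]
  have t [simp]: "t X \<in> arrs V" "source V (t X) = \<I>" "target V (t X) = Hom C (obj_map F X) (obj_map G X)"
    "El {} (t X) = t X \<odot> unit_elem"
    if "X \<in> Ob B" for X using True that by (auto simp: app_unit dest: arrowsD)
  let ?l = "\<lambda>X Y. Comp C (obj_map F X) (obj_map F Y) (obj_map G Y) \<cdot> (t Y \<boxtimes> hom_map F X Y)
          \<cdot> \<l>\<^sup>- (Hom B X Y)"
  let ?r = "\<lambda>X Y. Comp C (obj_map F X) (obj_map G X) (obj_map G Y) \<cdot> (hom_map G X Y \<boxtimes> t X)
          \<cdot> \<r>\<^sup>- (Hom B X Y)"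
  have l: "Gm (obj_map F X) (obj_map G Y) (?l X Y \<odot> e) = gcomp C (Gm (obj_map F Y) (obj_map G Y) (El {} (t Y))) (gmap F (Gm X Y e))"
    if "X \<in> Ob B" "Y \<in> Ob B" "elem e" "ty e = Hom B X Y" for X Y e
    using that by (simp add: gcomp_def gmap_def)
  have r: "Gm (obj_map F X) (obj_map G Y) (?r X Y \<odot> e) = gcomp C (gmap G (Gm X Y e)) (Gm (obj_map F X) (obj_map G X) (El {} (t X)))"
    if "X \<in> Ob B" "Y \<in> Ob B" "elem e" "ty e = Hom B X Y" for X Y e
    using that by (simp add: gcomp_def gmap_def)
  have "?l X Y = ?r X Y \<longleftrightarrow> (\<forall>e. elem e \<longrightarrow> ty e = Hom B X Y \<longrightarrow> ?l X Y \<odot> e = ?r X Y \<odot> e)"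
    if "X \<in> Ob B" "Y \<in> Ob B" for X Y
  proof
    assume "\<forall>e. elem e \<longrightarrow> ty e = Hom B X Y \<longrightarrow> ?l X Y \<odot> e = ?r X Y \<odot> e"
    then have "?l X Y \<odot> var (Hom B X Y, 0) = ?r X Y \<odot> var (Hom B X Y, 0)" using that by simp
    then show "?l X Y = ?r X Y"
      by (rule arr_ext[where E = "Hom B X Y" and G = "Hom C (obj_map F X) (obj_map G Y)"])
        (use that in \<open>auto simp: arrows_def\<close>)
  qed simp
  then have "is_vnat B C F G t \<longleftrightarrow> (\<forall>X \<in> Ob B. \<forall>Y \<in> Ob B. \<forall>e. elem e \<longrightarrow> ty e = Hom B X Y \<longrightarrow> ?l X Y \<odot> e = ?r X Y \<odot> e)"
    using True unfolding is_vnat_def by (simp del: app_comp)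
  also have "\<dots> \<longleftrightarrow> (\<forall>f. gm B f \<longrightarrow> Gm (obj_map F (gdom f)) (obj_map G (gcod f)) (?l (gdom f) (gcod f) \<odot> gel f)
      = Gm (obj_map F (gdom f)) (obj_map G (gcod f)) (?r (gdom f) (gcod f) \<odot> gel f))"
    (is "?A \<longleftrightarrow> ?B")
  proof
    show "?A \<Longrightarrow> ?B" by (simp add: gm_def del: app_comp)
    show "?A" if ?B
      using that gm_Gm[of B] by (metis (no_types, lifting) gmor.sel gmor.inject)
  qed
  also have "\<dots> \<longleftrightarrow> (\<forall>f. gm B f \<longrightarrow>
        gcomp C (Gm (obj_map F (gcod f)) (obj_map G (gcod f)) (El {} (t (gcod f)))) (gmap F f) =
        gcomp C (gmap G f) (Gm (obj_map F (gdom f)) (obj_map G (gdom f)) (El {} (t (gdom f)))))"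
  proof (intro iff_allI imp_cong refl)
    fix f assume f: "gm B f"
    note s = gm_simps[OF f]
    have f_eq: "Gm (gdom f) (gcod f) (gel f) = f" by simp
    show "Gm (obj_map F (gdom f)) (obj_map G (gcod f)) (?l (gdom f) (gcod f) \<odot> gel f)
      = Gm (obj_map F (gdom f)) (obj_map G (gcod f)) (?r (gdom f) (gcod f) \<odot> gel f) \<longleftrightarrow>
        gcomp C (Gm (obj_map F (gcod f)) (obj_map G (gcod f)) (El {} (t (gcod f)))) (gmap F f) =
        gcomp C (gmap G f) (Gm (obj_map F (gdom f)) (obj_map G (gdom f)) (El {} (t (gdom f))))"
      unfolding l[OF s] r[OF s] f_eq ..
  qed
  finally show ?thesis using True by simp
qed (auto simp: is_vnat_def)

text \<open>The inverse unitor in \<open>ucomp\<close> is \<open>split {} {}\<close>, so composition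
  in the underlying category is composition of graded morphisms with empty context.\<close>

lemma ucomp_iff:
  assumes "vcat_typed C" "X \<in> Ob C" "Y \<in> Ob C" "f \<in> \<V> \<I> (Hom C X Y)" "g \<in> \<V> \<I> (Hom C Y X)"
  shows "ucomp C X Y X g f = Ide C X \<longleftrightarrow> gcomp C (Gm Y X (El {} g)) (Gm X Y (El {} f)) = gid C X"
proof -
  note t = arrowsD[OF assms(4)] arrowsD[OF assms(5)]
  have "Comp C X Y X \<cdot> (g \<boxtimes> f) \<cdot> \<l>\<^sup>- \<I> = arr (Comp C X Y X \<odot> \<langle>El {} g, El {} f\<rangle>)"
    by (simp add: app_def pair_def unit_inverses)
  then show ?thesis using assms t
    by (simp add: ucomp_def gcomp_def gid_def app_unit arrows_def) (simp add: app_def pair_def unit_inverses)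
qed

end

section \<open>Cotensors\<close>

context smc_category
begin

context
  fixes C :: "('a, 'o, 'm, 'z) vcat_scheme" and J X D c
  assumes C [simp]: "is_vcat C" and J [simp]: "J \<in> objs V" and X [simp]: "X \<in> Ob C" and D [simp]: "D \<in> Ob C"
    and c: "c \<in> \<V> J (Hom C D X)"
begin

lemma counit_typed [simp]: "c \<in> arrs V" "source V c = J" "target V c = Hom C D X"
  using c arrowsD by auto

lemma comparison_typed [simp]:
  assumes [simp]: "Y \<in> Ob C"
  shows "cotensor_comparison C J X D c Y \<in> arrs V" "source V (cotensor_comparison C J X D c Y) = Hom C Y D"
    "target V (cotensor_comparison C J X D c Y) = J \<Rrightarrow> Hom C Y X"
  by (simp_all add: cotensor_comparison_def)

lemma ev_comparison [simp]:
  assumes [simp]: "Y \<in> Ob C" and "elem h" "ty h = Hom C Y D" "elem e" "ty e = J" "ctx h \<inter> ctx e = {}" "ctx e \<inter> ctx h = {}"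
  shows "ev J (Hom C Y X) (cotensor_comparison C J X D c Y \<odot> h) e = Comp C Y D X \<odot> \<langle>c \<odot> e, h\<rangle>"
  using assms by (simp add: cotensor_comparison_def)

lemma cotensor_comparison_ext:
  assumes "gm C h" "gm C h'" "gdom h' = gdom h" "gcod h = D" "gcod h' = D" "gctx h' = gctx h" "universal e" "ty e = J" "gctx h \<inter> ctx e = {}"
    and eq: "gcomp C (Gm D X (c \<odot> e)) h = gcomp C (Gm D X (c \<odot> e)) h'"
  shows "cotensor_comparison C J X D c (gdom h) \<odot> gel h = cotensor_comparison C J X D c (gdom h) \<odot> gel h'"
proof -
  have [simp]: "ctx e \<inter> gctx h = {}" using assms(9) by blast
  show ?thesis
    by (rule ev_ext[where X = J and Y = "Hom C (gdom h) X" and u = e])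
      (use assms gm_simps[OF assms(1)] gm_simps[OF assms(2)] universal_elem[of e] in \<open>simp_all add: gcomp_def\<close>)
qed

text \<open>Lifting the evaluation \<open>ev y j\<close>, the generic morphism with an additional
  index, yields an inverse of the comparison map, which is two-sided because lifts are unique. The
  universal property thus reads: morphisms to \<open>X\<close> with an extra index in
  \<open>J\<close> correspond to morphisms to \<open>D\<close>.\<close>

lemma is_cotensorI:
  assumes ex: "\<And>k j N. \<lbrakk>gm C k; gcod k = X; gctx k = insert j N; j \<notin> N; fst j = J; vctx N\<rbrakk>
      \<Longrightarrow> \<exists>h. gm C h \<and> gdom h = gdom k \<and> gcod h = D \<and> gctx h = N \<and> gcomp C (Gm D X (c \<odot> var j)) h = k"
    and uniq: "\<And>h h' j. \<lbrakk>gm C h; gm C h'; gdom h' = gdom h; gcod h = D; gcod h' = D; gctx h' = gctx h; fst j = J; j \<notin> gctx h;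
      gcomp C (Gm D X (c \<odot> var j)) h = gcomp C (Gm D X (c \<odot> var j)) h'\<rbrakk> \<Longrightarrow> h = h'"
  shows "is_cotensor C J X D c"
  unfolding is_cotensor_def
proof (intro conjI ballI)
  fix Y assume Y [simp]: "Y \<in> Ob C"
  let ?c = "cotensor_comparison C J X D c Y" and ?E = "J \<Rrightarrow> Hom C Y X"
  define y where "y = (?E, 0 :: nat)"
  define j where "j = (J, 1 :: nat)"
  have [simp]: "y \<noteq> j" "j \<noteq> y" "fst y = ?E" "fst j = J" by (auto simp: y_def j_def)
  have "\<exists>h. gm C h \<and> gdom h = gdom (Gm Y X (ev J (Hom C Y X) (var y) (var j))) \<and> gcod h = D \<and> gctx h = {y}
      \<and> gcomp C (Gm D X (c \<odot> var j)) h = Gm Y X (ev J (Hom C Y X) (var y) (var j))"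
    by (rule ex) auto
  then obtain h where h: "gm C h" "gdom h = Y" "gcod h = D" "gctx h = {y}"
      "gcomp C (Gm D X (c \<odot> var j)) h = Gm Y X (ev J (Hom C Y X) (var y) (var j))" by auto
  obtain H where H: "H \<in> \<V> ?E (Hom C Y D)" "gel h = H \<odot> var y"
    by (rule abstract_elem[of "gel h" "var y"]) (use h gm_simps[OF h(1)] in auto)
  note Ht [simp] = arrowsD[OF H(1)]
  have "?c \<cdot> H = \<one> ?E"
  proof (rule curry_ext[where Z = ?E and X = J and Y = "Hom C Y X" and z = y and x = j])
    show "ev J (Hom C Y X) ((?c \<cdot> H) \<odot> var y) (var j) = ev J (Hom C Y X) (\<one> ?E \<odot> var y) (var j)"
      using h H(2) by (cases h) (simp add: gcomp_def)
  qed (auto simp: arrows_def)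
  moreover have "H \<cdot> ?c = \<one> (Hom C Y D)"
  proof -
    define z where "z = (Hom C Y D, 0 :: nat)"
    have [simp]: "fst z = Hom C Y D" by (simp add: z_def)
    obtain j' :: "'o \<times> nat" where j' [simp]: "fst j' = J" "j' \<notin> {z}" by (rule fresh_name[of "{z}" J]) auto
    have [simp]: "z \<noteq> j'" "j' \<noteq> z" using j' by auto
    have cH: "?c \<odot> H \<odot> e = e" if "elem e" "ty e = ?E" for e
      using \<open>?c \<cdot> H = \<one> ?E\<close> app_comp[of e H ?c] that by simp
    have "Gm Y D (H \<odot> ?c \<odot> var z) = Gm Y D (var z)"
    proof (rule uniq[of _ _ j'])
      have "Comp C Y D X \<odot> \<langle>c \<odot> var j', H \<odot> ?c \<odot> var z\<rangle> = ev J (Hom C Y X) (?c \<odot> H \<odot> ?c \<odot> var z) (var j')"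
        by simp
      also have "\<dots> = Comp C Y D X \<odot> \<langle>c \<odot> var j', var z\<rangle>"
        by (simp add: cH)
      finally show "gcomp C (Gm D X (c \<odot> var j')) (Gm Y D (H \<odot> ?c \<odot> var z)) = gcomp C (Gm D X (c \<odot> var j')) (Gm Y D (var z))"
        by (simp add: gcomp_def)
    qed auto
    then show ?thesis
      by (intro arr_ext[of _ z _ "Hom C Y D" "Hom C Y D"]) (auto simp: arrows_def)
  qed
  ultimately have "is_inverse V (Hom C Y D) ?E ?c H" by (simp add: is_inverse_def arrows_def)
  then show "is_iso V (Hom C Y D) ?E ?c" using is_iso_def by metis
qed (use c in auto)

context
  assumes cot: "is_cotensor C J X D c"
begin

lemma comparison_iso: "Y \<in> Ob C \<Longrightarrow> is_iso V (Hom C Y D) (J \<Rrightarrow> Hom C Y X) (cotensor_comparison C J X D c Y)"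
  using cot by (simp add: is_cotensor_def)

lemma cotensor_ext:
  assumes "gm C h" "gm C h'" "gdom h' = gdom h" "gcod h = D" "gcod h' = D" "gctx h' = gctx h" "universal e" "ty e = J" "gctx h \<inter> ctx e = {}"
    and "gcomp C (Gm D X (c \<odot> e)) h = gcomp C (Gm D X (c \<odot> e)) h'"
  shows "h = h'"
proof -
  note g = gm_simps[OF assms(1)] gm_simps[OF assms(2)]
  let ?c = "cotensor_comparison C J X D c (gdom h)"
  obtain k where k: "is_inverse V (Hom C (gdom h) D) (J \<Rrightarrow> Hom C (gdom h) X) ?c k"
    using comparison_iso g(1) is_iso_def by metis
  note t = is_inverse_typed[OF k]
  have "gel h = k \<odot> ?c \<odot> gel h" using app_comp[of "gel h" ?c k] t g assms by simp
  also have "\<dots> = k \<odot> ?c \<odot> gel h'" using cotensor_comparison_ext[OF assms] by simp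
  also have "\<dots> = gel h'" using app_comp[of "gel h'" ?c k] t g assms by simp
  finally show ?thesis using assms by (cases h; cases h') auto
qed

lemma cotensor_curry:
  assumes "Y \<in> Ob C" "E \<in> objs V" "q \<in> \<V> (E \<otimes> J) (Hom C Y X)"
  shows "\<exists>!H. H \<in> \<V> E (Hom C Y D) \<and> cotensor_comparison C J X D c Y \<cdot> H = curry_arr E J (Hom C Y X) q"
proof -
  let ?c = "cotensor_comparison C J X D c Y" and ?q = "curry_arr E J (Hom C Y X) q"
  note [simp] = assms(1,2) and q [simp] = arrowsD[OF assms(3)]
  obtain k where k: "is_inverse V (Hom C Y D) (J \<Rrightarrow> Hom C Y X) ?c k"
    using comparison_iso[of Y] unfolding is_iso_def by auto
  note t = is_inverse_typed[OF k]
  have "k \<cdot> ?q \<in> \<V> E (Hom C Y D)" "?c \<cdot> k \<cdot> ?q = ?q"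
    using t is_inverse_assoc[OF k] by (auto simp: arrows_def)
  moreover have "H = k \<cdot> ?q" if "H \<in> \<V> E (Hom C Y D)" "?c \<cdot> H = ?q" for H
    using that t is_inverse_assoc(1)[OF k, of H] arrowsD by auto
  ultimately show ?thesis by blast
qed

lemma cotensor_curry_app:
  assumes "Y \<in> Ob C" "q \<in> \<V> (E \<otimes> J) (Hom C Y X)" "H \<in> \<V> E (Hom C Y D)"
    "cotensor_comparison C J X D c Y \<cdot> H = curry_arr E J (Hom C Y X) q"
    "elem e" "ty e = J" "elem n" "ty n = E" "ctx e \<inter> ctx n = {}"
  shows "gcomp C (Gm D X (c \<odot> e)) (Gm Y D (H \<odot> n)) = Gm Y X (q \<odot> \<langle>n, e\<rangle>)"
proof -
  let ?c = "cotensor_comparison C J X D c Y"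
  note [simp] = assms(1) arrowsD[OF assms(2)] arrowsD[OF assms(3)] elem_obj[OF assms(7), unfolded assms(8)]
  have [simp]: "ctx n \<inter> ctx e = {}" using assms by blast
  have "Comp C Y D X \<odot> \<langle>c \<odot> e, H \<odot> n\<rangle> = ev J (Hom C Y X) ((?c \<cdot> H) \<odot> n) e"
    using assms(5-) by simp
  then show ?thesis unfolding assms(4) using assms(5-) by (simp add: gcomp_def)
qed

text \<open>The index is an arbitrary universal \<open>e\<close> rather than a variable, so that a
  lift along a pair of indices is available in one go.\<close>

lemma cotensor_ex:
  assumes "gm C k" "gcod k = X" "gctx k = ctx e \<union> N" "ctx e \<inter> N = {}" "universal e" "ty e = J" "vctx N"
  obtains h where "gm C h" "gdom h = gdom k" "gcod h = D" "gctx h = N" "gcomp C (Gm D X (c \<odot> e)) h = k"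
proof -
  note g = gm_simps[OF assms(1)]
  let ?Y = "gdom k" and ?E = "tens N"
  have d: "N \<inter> ctx e = {}" using assms(4) by blast
  obtain q where q: "q \<in> \<V> (?E \<otimes> J) (Hom C ?Y X)" "gel k = q \<odot> \<langle>generic N, e\<rangle>"
    by (rule abstract_elem[of "gel k" "\<langle>generic N, e\<rangle>"]) (use g assms d universal_elem[of e] in \<open>auto simp: Un_commute\<close>)
  obtain H where H: "H \<in> \<V> ?E (Hom C ?Y D)" "cotensor_comparison C J X D c ?Y \<cdot> H = curry_arr ?E J (Hom C ?Y X) q"
    using cotensor_curry[OF g(1) _ q(1)] assms by auto
  note [simp] = arrowsD[OF H(1)]
  have "gcomp C (Gm D X (c \<odot> e)) (Gm ?Y D (H \<odot> generic N)) = Gm ?Y X (gel k)"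
    unfolding q(2) by (rule cotensor_curry_app[OF g(1) q(1) H]) (use assms universal_elem in auto)
  then show ?thesis
    using g assms by (intro that[of "Gm ?Y D (H \<odot> generic N)"]) (simp_all add: gmor.expand)
qed

lemma cotensor_ex_var:
  assumes "gm C k" "gcod k = X" "gctx k = insert j N" "j \<notin> N" "fst j = J" "vctx N"
  obtains h where "gm C h" "gdom h = gdom k" "gcod h = D" "gctx h = N" "gcomp C (Gm D X (c \<odot> var j)) h = k"
  by (rule cotensor_ex[of k "var j" N]) (use assms in auto)

text \<open>Starting from an arrow \<open>q\<close> instead of an expression in one variable makes
  the equation hold for all elements \<open>e\<close> at once, compound ones included. The lift
  lives in the empty context, through the unitor at \<open>J\<close>.\<close>

lemma cotensor_ex_closed:
  assumes "q \<in> \<V> J (Hom C Y X)" "Y \<in> Ob C"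
  obtains h where "gm C h" "gdom h = Y" "gcod h = D" "gctx h = {}"
    "\<And>e. elem e \<Longrightarrow> ty e = J \<Longrightarrow> gcomp C (Gm D X (c \<odot> e)) h = Gm Y X (q \<odot> e)"
proof -
  note [simp] = arrowsD[OF assms(1)] assms(2)
  have q: "q \<cdot> \<l> J \<in> \<V> (\<I> \<otimes> J) (Hom C Y X)"
    using is_inverse_typed[OF l_inverse[OF J]] by (simp add: arrows_def)
  obtain H where H: "H \<in> \<V> \<I> (Hom C Y D)" "cotensor_comparison C J X D c Y \<cdot> H = curry_arr \<I> J (Hom C Y X) (q \<cdot> \<l> J)"
    using cotensor_curry[OF assms(2) _ q] by auto
  note [simp] = arrowsD[OF H(1)]
  have "gcomp C (Gm D X (c \<odot> e)) (Gm Y D (H \<odot> unit_elem)) = Gm Y X (q \<odot> e)" if "elem e" "ty e = J" for e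
    using cotensor_curry_app[OF assms(2) q H, of e unit_elem] that is_inverse_typed[OF l_inverse[OF J]] by simp
  then show ?thesis by (intro that[of "Gm Y D (H \<odot> unit_elem)"]) auto
qed

end
end

lemma cotensor_lift:
  assumes [simp]: "is_vcat C" "J \<in> objs V" "X \<in> Ob C" "Y \<in> Ob C" "E \<in> objs V"
    and cot: "is_cotensor C J X (cotensor_ob C J X) (counit C J X)" and f: "f \<in> \<V> (E \<otimes> J) (Hom C Y X)"
  shows "cotensor_lift C J X E Y f \<in> \<V> E (Hom C Y (cotensor_ob C J X))"
    "\<lbrakk>elem e; ty e = J; elem n; ty n = E; ctx e \<inter> ctx n = {}\<rbrakk> \<Longrightarrow>
      gcomp C (Gm (cotensor_ob C J X) X (counit C J X \<odot> e)) (Gm Y (cotensor_ob C J X) (cotensor_lift C J X E Y f \<odot> n))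
      = Gm Y X (f \<odot> \<langle>n, e\<rangle>)"
proof -
  let ?D = "cotensor_ob C J X" and ?c = "counit C J X"
  have D: "?D \<in> Ob C" and c: "?c \<in> \<V> J (Hom C ?D X)" using cot by (auto simp: is_cotensor_def)
  have *: "cotensor_lift C J X E Y f \<in> \<V> E (Hom C Y ?D)"
     "cotensor_comparison C J X ?D ?c Y \<cdot> cotensor_lift C J X E Y f = curry_arr E J (Hom C Y X) f"
    using theI'[OF cotensor_curry[OF _ _ _ D c cot _ _ f]] unfolding cotensor_lift_def by auto
  then show "cotensor_lift C J X E Y f \<in> \<V> E (Hom C Y ?D)" by simp
  show "gcomp C (Gm ?D X (?c \<odot> e)) (Gm Y ?D (cotensor_lift C J X E Y f \<odot> n)) = Gm Y X (f \<odot> \<langle>n, e\<rangle>)"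
    if "elem e" "ty e = J" "elem n" "ty n = E" "ctx e \<inter> ctx n = {}"
    by (rule cotensor_curry_app[OF _ _ _ D c cot _ f *]) (use that in auto)
qed

text \<open>Any two cotensors of \<open>X\<close> by \<open>J\<close> are isomorphic.\<close>

lemma cotensor_transfer:
  assumes [simp]: "is_vcat B" "is_vcat C" and F: "is_vfun B C F" and [simp]: "J \<in> objs V" "X \<in> Ob B"
    and B0: "is_cotensor B J X D0 c0" and C0: "is_cotensor C J (obj_map F X) (obj_map F D0) (hom_map F D0 X \<cdot> c0)"
    and B1: "is_cotensor B J X D c"
  shows "is_cotensor C J (obj_map F X) (obj_map F D) (hom_map F D X \<cdot> c)"
proof -
  note Ft = vfun_simps[OF is_vfun_typed[OF F]] and Fg = gm_gmap[OF is_vfun_typed[OF F]]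
  have D0 [simp]: "D0 \<in> Ob B" and c0: "c0 \<in> \<V> J (Hom B D0 X)" using B0 by (auto simp: is_cotensor_def)
  have D [simp]: "D \<in> Ob B" and c: "c \<in> \<V> J (Hom B D X)" using B1 by (auto simp: is_cotensor_def)
  note [simp] = arrowsD[OF c0] arrowsD[OF c] Ft
  note b0 = \<open>is_vcat B\<close> \<open>J \<in> objs V\<close> \<open>X \<in> Ob B\<close> D0 c0 and b1 = \<open>is_vcat B\<close> \<open>J \<in> objs V\<close> \<open>X \<in> Ob B\<close> D c
  let ?X = "obj_map F X" and ?D = "obj_map F D" and ?E = "obj_map F D0"
  let ?c = "hom_map F D X \<cdot> c" and ?b = "hom_map F D0 X \<cdot> c0"
  have cc: "?c \<in> \<V> J (Hom C ?D ?X)" and cc0: "?b \<in> \<V> J (Hom C ?E ?X)" by (auto simp: arrows_def)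
  have X': "?X \<in> Ob C" and D': "?D \<in> Ob C" and D0': "?E \<in> Ob C" by auto
  note t0 = \<open>is_vcat C\<close> \<open>J \<in> objs V\<close> X' D0' cc0 and t1 = \<open>is_vcat C\<close> \<open>J \<in> objs V\<close> X' D' cc
  \<comment> \<open>\<open>i\<close> and \<open>i'\<close> compare the two cotensors, and
    \<open>i\<close> is a retraction of \<open>i'\<close>. The image of \<open>i\<close> turns lifts
    to the image of \<open>D0\<close> into lifts to that of \<open>D\<close>, and the image of
    \<open>i'\<close> carries uniqueness over. Preservation therefore needs to be checked on one
    cotensor for each \<open>J\<close> and \<open>X\<close>.\<close>
  obtain i where i: "gm B i" "gdom i = D0" "gcod i = D" "gctx i = {}"
    "\<And>e. elem e \<Longrightarrow> ty e = J \<Longrightarrow> gcomp B (Gm D X (c \<odot> e)) i = Gm D0 X (c0 \<odot> e)"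
    by (rule cotensor_ex_closed[OF b1 B1 c0]) auto
  obtain i' where i': "gm B i'" "gdom i' = D" "gcod i' = D0" "gctx i' = {}"
    "\<And>e. elem e \<Longrightarrow> ty e = J \<Longrightarrow> gcomp B (Gm D0 X (c0 \<odot> e)) i' = Gm D X (c \<odot> e)"
    by (rule cotensor_ex_closed[OF b0 B0 c]) auto
  have ii': "gcomp B i i' = gid B D"
  proof (rule cotensor_ext[OF b1 B1, where e = "var (J, 0)"])
    have "gcomp B (Gm D X (c \<odot> var (J, 0))) (gcomp B i i') = gcomp B (gcomp B (Gm D X (c \<odot> var (J, 0))) i) i'"
      using i(1-4) i'(1-4) by simp
    then show "gcomp B (Gm D X (c \<odot> var (J, 0))) (gcomp B i i') = gcomp B (Gm D X (c \<odot> var (J, 0))) (gid B D)"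
      by (simp add: i i')
  qed (use i i' in auto)
  have Fc: "Gm ?D ?X (?c \<odot> e) = gmap F (Gm D X (c \<odot> e))" "Gm ?E ?X (?b \<odot> e) = gmap F (Gm D0 X (c0 \<odot> e))"
    if "elem e" "ty e = J" for e
    using that by (simp_all add: gmap_def)
  have ci: "gcomp C (Gm ?D ?X (?c \<odot> e)) (gmap F i) = Gm ?E ?X (?b \<odot> e)"
    "gcomp C (Gm ?E ?X (?b \<odot> e)) (gmap F i') = Gm ?D ?X (?c \<odot> e)" if "elem e" "ty e = J" for e
  proof -
    show "gcomp C (Gm ?D ?X (?c \<odot> e)) (gmap F i) = Gm ?E ?X (?b \<odot> e)"
      unfolding Fc[OF that] i(5)[OF that, symmetric] using that i by (subst gmap_gcomp[OF F]) auto
    show "gcomp C (Gm ?E ?X (?b \<odot> e)) (gmap F i') = Gm ?D ?X (?c \<odot> e)"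
      unfolding Fc[OF that] i'(5)[OF that, symmetric] using that i' by (subst gmap_gcomp[OF F]) auto
  qed
  have Fii': "gcomp C (gmap F i) (gmap F i') = gid C ?D"
    using i i' by (simp add: gmap_gcomp[OF F, symmetric] ii' gmap_gid[OF F])
  have Fi [simp]: "gm C (gmap F i)" "gm C (gmap F i')" using Fg i i' by auto
  show ?thesis
  proof (rule is_cotensorI[OF t1])
    fix k j N assume k: "gm C k" "gcod k = ?X" "gctx k = insert j N" "j \<notin> N" "fst j = J" "vctx N"
    obtain h where h: "gm C h" "gdom h = gdom k" "gcod h = ?E" "gctx h = N" "gcomp C (Gm ?E ?X (?b \<odot> var j)) h = k"
      by (rule cotensor_ex_var[OF t0 C0 k])
    have "gcomp C (Gm ?D ?X (?c \<odot> var j)) (gcomp C (gmap F i) h) = gcomp C (gcomp C (Gm ?D ?X (?c \<odot> var j)) (gmap F i)) h"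
      using h(1-4) i k by (subst gassoc) auto
    also have "\<dots> = k" using ci(1)[of "var j"] h(5) k by simp
    finally show "\<exists>h. gm C h \<and> gdom h = gdom k \<and> gcod h = ?D \<and> gctx h = N \<and> gcomp C (Gm ?D ?X (?c \<odot> var j)) h = k"
      using h i by (intro exI[of _ "gcomp C (gmap F i) h"]) auto
  next
    fix h h' j assume h: "gm C h" "gm C h'" "gdom h' = gdom h" "gcod h = ?D" "gcod h' = ?D" "gctx h' = gctx h" "fst j = J"
      "j \<notin> gctx h" and eq: "gcomp C (Gm ?D ?X (?c \<odot> var j)) h = gcomp C (Gm ?D ?X (?c \<odot> var j)) h'"
    have *: "gcomp C (Gm ?E ?X (?b \<odot> var j)) (gcomp C (gmap F i') h) = gcomp C (Gm ?D ?X (?c \<odot> var j)) h"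
      if "gm C h" "gcod h = ?D" "j \<notin> gctx h" for h
    proof -
      have "gcomp C (Gm ?E ?X (?b \<odot> var j)) (gcomp C (gmap F i') h)
        = gcomp C (gcomp C (Gm ?E ?X (?b \<odot> var j)) (gmap F i')) h"
        using that i' h(7) by (subst gassoc) auto
      then show ?thesis using ci(2)[of "var j"] h(7) by simp
    qed
    have "gcomp C (gmap F i') h = gcomp C (gmap F i') h'"
      by (rule cotensor_ext[OF t0 C0, of _ _ "var j"]) (use h i' eq *[of h] *[of h'] in auto)
    then have "gcomp C (gmap F i) (gcomp C (gmap F i') h) = gcomp C (gmap F i) (gcomp C (gmap F i') h')" by simp
    moreover have "gcomp C (gmap F i) (gcomp C (gmap F i') h) = h" if "gm C h" "gcod h = ?D" for h
    proof -
      have "gcomp C (gmap F i) (gcomp C (gmap F i') h) = gcomp C (gcomp C (gmap F i) (gmap F i')) h"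
        using that i i' by (subst gassoc) auto
      then show ?thesis using Fii' that by simp
    qed
    ultimately show "h = h'" using h by simp
  qed
qed

abbreviation designated :: "('a, 'o, 'm, 'z) cotensored_vcat_scheme \<Rightarrow> 'o \<Rightarrow> 'a \<Rightarrow> bool" where
  "designated C J X \<equiv> is_cotensor C J X (cotensor_ob C J X) (counit C J X)"

text \<open>The projection of the power \<open>[J,X]\<close> with index \<open>e\<close>. For
  universal \<open>e\<close> it is left cancellable on disjoint contexts, by
  \<open>designated_ext\<close>.\<close>

definition cu :: "('a, 'o, 'm, 'z) cotensored_vcat_scheme \<Rightarrow> 'o \<Rightarrow> 'a \<Rightarrow> ('o, 'm) elem \<Rightarrow> ('a, 'o, 'm) gmor" where
  "cu C J X e = Gm (cotensor_ob C J X) X (counit C J X \<odot> e)"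

lemma cu_simps [simp]:
  "gdom (cu C J X e) = cotensor_ob C J X" "gcod (cu C J X e) = X" "gctx (cu C J X e) = ctx e"
  by (simp_all add: cu_def)

lemma designated_simps:
  assumes "designated C J X"
  shows "cotensor_ob C J X \<in> Ob C" "counit C J X \<in> \<V> J (Hom C (cotensor_ob C J X) X)"
    "counit C J X \<in> arrs V" "source V (counit C J X) = J" "target V (counit C J X) = Hom C (cotensor_ob C J X) X"
  using assms by (auto simp: is_cotensor_def dest: arrowsD)

lemma gm_cu [simp]: "designated C J X \<Longrightarrow> X \<in> Ob C \<Longrightarrow> elem e \<Longrightarrow> ty e = J \<Longrightarrow> gm C (cu C J X e)"
  using designated_simps[of C J X] by (simp add: cu_def)

lemma designated_ext:
  assumes "is_vcat C" "designated C J X" "X \<in> Ob C"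
    "gm C h" "gm C h'" "gdom h' = gdom h" "gcod h = cotensor_ob C J X" "gcod h' = cotensor_ob C J X" "gctx h' = gctx h"
    "universal e" "ty e = J" "gctx h \<inter> ctx e = {}"
    and "gcomp C (cu C J X e) h = gcomp C (cu C J X e) h'"
  shows "h = h'"
proof (rule cotensor_ext[OF assms(1) _ assms(3) _ _ assms(2)])
  show "gcomp C (Gm (cotensor_ob C J X) X (counit C J X \<odot> e)) h = gcomp C (Gm (cotensor_ob C J X) X (counit C J X \<odot> e)) h'"
    using assms(13) by (simp add: cu_def)
  show "J \<in> objs V" using assms(11) elem_obj[OF universal_elem[OF assms(10)]] by simp
qed (use designated_simps[OF assms(2)] assms in auto)

lemma designated_ex:
  assumes "is_vcat C" "designated C J X" "X \<in> Ob C"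
    "gm C k" "gcod k = X" "gctx k = ctx e \<union> N" "ctx e \<inter> N = {}" "universal e" "ty e = J" "vctx N"
  obtains h where "gm C h" "gdom h = gdom k" "gcod h = cotensor_ob C J X" "gctx h = N" "gcomp C (cu C J X e) h = k"
proof -
  have "J \<in> objs V" using assms(9) elem_obj[OF universal_elem[OF assms(8)]] by simp
  then show ?thesis
    using cotensor_ex[OF assms(1) _ assms(3) designated_simps(1,2)[OF assms(2)] assms(2,4-10)] that
    unfolding cu_def by blast
qed

subsection \<open>The functor \<open>[J,-]\<close>\<close>

definition cot_fun :: "('a, 'o, 'm, 'z) cotensored_vcat_scheme \<Rightarrow> 'o \<Rightarrow> ('a, 'a, 'm) vfun" where
  "cot_fun C J = \<lparr>obj_map = cotensor_ob C J, hom_map = cot_map C J\<rparr>"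

lemma obj_cot_fun [simp]: "obj_map (cot_fun C J) X = cotensor_ob C J X"
  by (simp add: cot_fun_def)

context
  fixes C :: "('a, 'o, 'm, 'z) cotensored_vcat_scheme" and J
  assumes C [simp]: "is_vcat C" and J [simp]: "J \<in> objs V" and des [simp]: "\<And>X. X \<in> Ob C \<Longrightarrow> designated C J X"
begin

lemma cot_fun_cotensor_simps [simp]:
  assumes "X \<in> Ob C"
  shows "cotensor_ob C J X \<in> Ob C"
    "counit C J X \<in> arrs V" "source V (counit C J X) = J" "target V (counit C J X) = Hom C (cotensor_ob C J X) X"
  using designated_simps[OF des[OF assms]] by auto

lemma cot_map_arr:
  assumes [simp]: "X \<in> Ob C" "Y \<in> Ob C"
  shows "cot_map C J X Y \<in> \<V> (Hom C X Y) (Hom C (cotensor_ob C J X) (cotensor_ob C J Y))"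
  unfolding cot_map_def by (rule cotensor_lift(1)) (auto simp: arrows_def)

lemma cot_fun_typed [simp]: "vfun_typed C C (cot_fun C J)"
  using cot_map_arr by (simp add: vfun_typed_def cot_fun_def)

lemma gm_cot_fun [simp]: "gm C f \<Longrightarrow> gm C (gmap (cot_fun C J) f)"
  by (rule gm_gmap[OF cot_fun_typed])

text \<open>This naturality characterises \<open>[J,f]\<close>: the functor laws follow from it by
  composing with the projection at a fresh variable.\<close>

lemma cot_fun_natural:
  assumes f: "gm C f" and e: "elem e" "ty e = J" "ctx e \<inter> gctx f = {}" "gctx f \<inter> ctx e = {}" and Y: "gcod f = Y"
  shows "gcomp C (cu C J Y e) (gmap (cot_fun C J) f) = gcomp C f (cu C J (gdom f) e)"
proof -
  note g [simp] = gm_simps[OF f]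
  let ?D = "cotensor_ob C J (gdom f)" and ?E = "cotensor_ob C J (gcod f)"
  let ?h = "Comp C ?D (gdom f) (gcod f) \<cdot> (\<one> (Hom C (gdom f) (gcod f)) \<boxtimes> counit C J (gdom f))"
  have "gcomp C (Gm ?E (gcod f) (counit C J (gcod f) \<odot> e)) (Gm ?D ?E (cot_map C J (gdom f) (gcod f) \<odot> gel f))
     = Gm ?D (gcod f) (?h \<odot> \<langle>gel f, e\<rangle>)"
    unfolding cot_map_def by (rule cotensor_lift(2)) (use e in \<open>auto simp: arrows_def\<close>)
  then show ?thesis unfolding Y[symmetric] using e by (simp add: cu_def gcomp_def gmap_def cot_fun_def)
qed

lemma is_vfun_cot_fun: "is_vfun C C (cot_fun C J)"
proof (rule is_vfunI)
  fix f g assume fg: "gm C f" "gm C g" "gcod f = gdom g" "gctx g \<inter> gctx f = {}"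
  note gm_simps[OF fg(1), simp] gm_simps[OF fg(2), simp]
  obtain x where x: "fst x = J" "x \<notin> gctx f \<union> gctx g"
    using fresh_name[of "gctx f \<union> gctx g"] fg(1,2) by (metis gm_vctx vctx_finite finite_UnI)
  show "gmap (cot_fun C J) (gcomp C g f) = gcomp C (gmap (cot_fun C J) g) (gmap (cot_fun C J) f)"
  proof (rule designated_ext[where e = "var x" and X = "gcod g"])
    have "gcomp C (cu C J (gcod g) (var x)) (gmap (cot_fun C J) (gcomp C g f)) = gcomp C (gcomp C g f) (cu C J (gdom f) (var x))"
      using fg x by (simp add: cot_fun_natural)
    also have "\<dots> = gcomp C g (gcomp C (cu C J (gdom g) (var x)) (gmap (cot_fun C J) f))"
      using fg x cot_fun_natural[of f "var x"] by simp
    also have "\<dots> = gcomp C (gcomp C g (cu C J (gdom g) (var x))) (gmap (cot_fun C J) f)"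
      using fg x by (subst gassoc) auto
    also have "\<dots> = gcomp C (gcomp C (cu C J (gcod g) (var x)) (gmap (cot_fun C J) g)) (gmap (cot_fun C J) f)"
      using fg x cot_fun_natural[of g "var x"] by simp
    also have "\<dots> = gcomp C (cu C J (gcod g) (var x)) (gcomp C (gmap (cot_fun C J) g) (gmap (cot_fun C J) f))"
      using fg x by (subst gassoc) auto
    finally show "gcomp C (cu C J (gcod g) (var x)) (gmap (cot_fun C J) (gcomp C g f))
      = gcomp C (cu C J (gcod g) (var x)) (gcomp C (gmap (cot_fun C J) g) (gmap (cot_fun C J) f))" .
  qed (use fg x in auto)
next
  fix X assume [simp]: "X \<in> Ob C"
  show "gmap (cot_fun C J) (gid C X) = gid C (obj_map (cot_fun C J) X)"
  proof (rule designated_ext[where e = "var (J, 0)" and X = X and J = J])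
    have "gcomp C (cu C J X (var (J, 0))) (gmap (cot_fun C J) (gid C X)) = cu C J X (var (J, 0))"
      using cot_fun_natural[of "gid C X" "var (J, 0)" X] by simp
    also have "\<dots> = gcomp C (cu C J X (var (J, 0))) (gid C (cotensor_ob C J X))"
      by (rule gid_right[symmetric]) simp_all
    finally show "gcomp C (cu C J X (var (J, 0))) (gmap (cot_fun C J) (gid C X)) =
      gcomp C (cu C J X (var (J, 0))) (gid C (obj_map (cot_fun C J) X))" by simp
  qed simp_all
qed simp_all

text \<open>Projections with an index in \<open>J\<close> and with an index in \<open>K\<close> may
  be taken in either order (\<open>key\<close>), so a lift through one cotensor can be followed by a
  lift through the other.\<close>

lemma cot_fun_cotensor:
  assumes K [simp]: "K \<in> objs V" and X [simp]: "X \<in> Ob C" and cot: "is_cotensor C K X D c"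
  shows "is_cotensor C K (cotensor_ob C J X) (cotensor_ob C J D) (cot_map C J D X \<cdot> c)"
proof -
  have D [simp]: "D \<in> Ob C" and c: "c \<in> \<V> K (Hom C D X)" using cot by (auto simp: is_cotensor_def)
  note [simp] = arrowsD[OF c] arrowsD[OF cot_map_arr]
  let ?F = "gmap (cot_fun C J)" and ?k = "\<lambda>e. Gm D X (c \<odot> e)"
  have k: "Gm (cotensor_ob C J D) (cotensor_ob C J X) ((cot_map C J D X \<cdot> c) \<odot> e) = ?F (?k e)"
    if "elem e" "ty e = K" for e using that by (simp add: gmap_def cot_fun_def)
  have key: "gcomp C (cu C J X (var x)) (gcomp C (?F (?k (var j))) h) = gcomp C (?k (var j)) (gcomp C (cu C J D (var x)) h)"
    if "gm C h" "gcod h = cotensor_ob C J D" "fst x = J" "fst j = K" "x \<noteq> j" "x \<notin> gctx h" "j \<notin> gctx h" for h x j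
  proof -
    have "gcomp C (cu C J X (var x)) (gcomp C (?F (?k (var j))) h) = gcomp C (gcomp C (cu C J X (var x)) (?F (?k (var j)))) h"
      using that by (subst gassoc) auto
    also have "\<dots> = gcomp C (gcomp C (?k (var j)) (cu C J D (var x))) h"
      using that by (simp add: cot_fun_natural)
    also have "\<dots> = gcomp C (?k (var j)) (gcomp C (cu C J D (var x)) h)"
      using that by simp
    finally show ?thesis .
  qed
  show ?thesis
  proof (rule is_cotensorI)
    fix k j N assume *: "gm C k" "gcod k = cotensor_ob C J X" "gctx k = insert j N" "j \<notin> N" "fst j = K" "vctx N"
    obtain x where x: "fst x = J" "x \<notin> insert j N"
      using fresh_name[of "insert j N"] *(6) by (metis finite_insert vctx_finite)
    obtain h' where h': "gm C h'" "gdom h' = gdom k" "gcod h' = D" "gctx h' = insert x N"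
        "gcomp C (?k (var j)) h' = gcomp C (cu C J X (var x)) k"
      by (rule cotensor_ex_var[OF C K X D c cot, of "gcomp C (cu C J X (var x)) k" j "insert x N"]) (use * x in auto)
    obtain h where h: "gm C h" "gdom h = gdom k" "gcod h = cotensor_ob C J D" "gctx h = N"
        "gcomp C (cu C J D (var x)) h = h'"
      by (rule designated_ex[of C J D h' "var x" N]) (use * x h' in auto)
    have "gcomp C (?F (?k (var j))) h = k"
      by (rule designated_ext[where e = "var x" and X = X]) (use * x h h' key[of h x j] in auto)
    then show "\<exists>h. gm C h \<and> gdom h = gdom k \<and> gcod h = cotensor_ob C J D \<and> gctx h = N \<and>
        gcomp C (Gm (cotensor_ob C J D) (cotensor_ob C J X) ((cot_map C J D X \<cdot> c) \<odot> var j)) h = k"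
      using h * by (subst k) auto
  next
    fix h h' j assume *: "gm C h" "gm C h'" "gdom h' = gdom h" "gcod h = cotensor_ob C J D" "gcod h' = cotensor_ob C J D"
      "gctx h' = gctx h" "fst j = K" "j \<notin> gctx h"
      and eq: "gcomp C (Gm (cotensor_ob C J D) (cotensor_ob C J X) ((cot_map C J D X \<cdot> c) \<odot> var j)) h
        = gcomp C (Gm (cotensor_ob C J D) (cotensor_ob C J X) ((cot_map C J D X \<cdot> c) \<odot> var j)) h'"
    obtain x where x: "fst x = J" "x \<notin> insert j (gctx h)"
      using fresh_name[of "insert j (gctx h)"] *(1) by (metis finite_insert vctx_finite gm_vctx)
    have "gcomp C (?F (?k (var j))) h = gcomp C (?F (?k (var j))) h'" using eq * by (simp add: k del: app_comp)
    then have "gcomp C (?k (var j)) (gcomp C (cu C J D (var x)) h) = gcomp C (?k (var j)) (gcomp C (cu C J D (var x)) h')"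
      using key[of h x j] key[of h' x j] * x by auto
    then have "gcomp C (cu C J D (var x)) h = gcomp C (cu C J D (var x)) h'"
      by - (rule cotensor_ext[OF C K X D c cot, of _ _ "var j"]; use * x in auto)
    then show "h = h'"
      by - (rule designated_ext[where e = "var x" and X = D]; use * x in auto)
  qed (auto simp: arrows_def)
qed

end

end

context system_of_arities
begin

subsection \<open>The functor \<open>[-,X]\<close>\<close>

lemma arity_obj [simp]: "J \<in> \<J> \<Longrightarrow> J \<in> objs V"
  using arities_subset by auto

lemma arities_op_simps [simp]: "Ob arities_op = \<J>" "Hom arities_op X Y = Y \<Rrightarrow> X"
  by (simp_all add: arities_op_def op_vcat_def full_sub_def self_vcat_def)

text \<open>A graded morphism \<open>f\<close> of \<open>arities_op\<close> is an element of the
  internal hom from \<open>gcod f\<close> to \<open>gdom f\<close>, a function in the opposite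
  direction; \<open>gev\<close> applies it to an argument.\<close>

definition gev :: "('o, 'o, 'm) gmor \<Rightarrow> ('o, 'm) elem \<Rightarrow> ('o, 'm) elem" where
  "gev f k = ev (gcod f) (gdom f) (gel f) k"

lemma ctx_gev [simp]: "ctx (gev f k) = gctx f \<union> ctx k"
  by (simp add: gev_def)

lemma elem_gev [simp]:
  assumes "gm arities_op f" "elem k" "ty k = gcod f" "gctx f \<inter> ctx k = {}"
  shows "elem (gev f k)" "ty (gev f k) = gdom f"
  using assms gm_simps[OF assms(1)] by (simp_all add: gev_def)

lemma gev_ext:
  assumes "gm arities_op f" "gm arities_op g" "gdom g = gdom f" "gcod g = gcod f" "gctx g = gctx f"
    "gev f u = gev g u" "universal u" "ty u = gcod f" "gctx f \<inter> ctx u = {}"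
  shows "f = g"
proof -
  have "gel f = gel g"
    by (rule ev_ext[of _ _ "gcod f" "gdom f" u])
      (use assms gm_simps[OF assms(1)] gm_simps[OF assms(2)] in \<open>auto simp: gev_def\<close>)
  then show ?thesis using assms by (simp add: gmor.expand)
qed

lemma comp_arities_op:
  "Comp arities_op X Y Z = curry_arr ((Y \<Rrightarrow> X) \<otimes> (Z \<Rrightarrow> Y)) Z X
     (\<e> Y X \<cdot> (\<one> (Y \<Rrightarrow> X) \<boxtimes> \<e> Z Y) \<cdot> \<a> (Y \<Rrightarrow> X) (Z \<Rrightarrow> Y) Z) \<cdot> \<s> (Z \<Rrightarrow> Y) (Y \<Rrightarrow> X)"
  by (simp add: arities_op_def op_vcat_def full_sub_def self_vcat_def)

lemma ide_arities_op: "Ide arities_op X = curry_arr \<I> X X (\<l> X)"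
  by (simp add: arities_op_def op_vcat_def full_sub_def self_vcat_def)

lemma arities_op_typed [simp]: "vcat_typed arities_op"
  by (auto simp: vcat_typed_def comp_arities_op ide_arities_op arrows_def)

lemma gev_gcomp [simp]:
  assumes "gm arities_op f" "gm arities_op g" "gcod f = gdom g" "gctx g \<inter> gctx f = {}"
    "elem k" "ty k = gcod g" "gctx f \<inter> ctx k = {}" "gctx g \<inter> ctx k = {}"
  shows "gev (gcomp arities_op g f) k = gev f (gev g k)"
proof -
  have [simp]: "gctx f \<inter> gctx g = {}" using assms by blast
  show ?thesis
    using assms gm_simps[OF assms(1)] gm_simps[OF assms(2)]
    by (simp add: gev_def gcomp_def comp_arities_op) (simp add: ev_def)
qed

lemma gev_gid [simp]: "X \<in> \<J> \<Longrightarrow> elem k \<Longrightarrow> ty k = X \<Longrightarrow> gev (gid arities_op X) k = k"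
  by (simp add: gev_def gid_def ide_arities_op)

lemma is_vcat_arities_op [simp]: "is_vcat arities_op"
proof (rule is_vcatI)
  fix f g h assume *: "gm arities_op f" "gm arities_op g" "gm arities_op h" "gcod f = gdom g" "gcod g = gdom h"
    "gctx h \<inter> gctx g = {}" "gctx g \<inter> gctx f = {}" "gctx h \<inter> gctx f = {}"
  obtain x where x: "fst x = gcod h" "x \<notin> gctx f \<union> gctx g \<union> gctx h"
    using fresh_name[of "gctx f \<union> gctx g \<union> gctx h"] *(1-3) by (metis gm_vctx vctx_finite finite_UnI)
  have "gctx g \<inter> gctx h = {}" "gctx f \<inter> gctx h = {}" "gctx f \<inter> gctx g = {}" using * by blast+
  then show "gcomp arities_op (gcomp arities_op h g) f = gcomp arities_op h (gcomp arities_op g f)"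
    by - (rule gev_ext[where u = "var x"]; use * x gm_simps[OF *(3)] in auto)
next
  fix f assume *: "gm arities_op f"
  note g = gm_simps[OF *]
  obtain x where x: "fst x = gcod f" "x \<notin> gctx f"
    using fresh_name[of "gctx f"] * by (metis gm_vctx vctx_finite)
  show "gcomp arities_op (gid arities_op (gcod f)) f = f"
    by (rule gev_ext[where u = "var x"]) (use * x g in auto)
  show "gcomp arities_op f (gid arities_op (gdom f)) = f"
    by (rule gev_ext[where u = "var x"]) (use * x g in auto)
qed simp_all

text \<open>Currying: a function on \<open>J \<otimes> K\<close> is a \<open>J\<close>-indexed
  function on \<open>K\<close>. The isomorphism \<open>c\<close> is a parameter so that
  \<open>S\<close> is covered as a cotensor of \<open>\<I>\<close> too, with the right unitor for
  \<open>c\<close>.\<close>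

lemma arities_op_cotensor:
  assumes JK [simp]: "J \<in> \<J>" "K \<in> \<J>" "D \<in> \<J>" and iso: "is_iso V (J \<otimes> K) D c"
  shows "is_cotensor arities_op J K D (curry_arr J K D c)"
proof -
  have [simp]: "c \<in> arrs V" "source V c = J \<otimes> K" "target V c = D"
    using is_inverse_typed[OF inv_arr[OF iso]] by auto
  let ?c = "\<lambda>e. Gm D K (curry_arr J K D c \<odot> e)"
  have c [simp]: "gm arities_op (?c (var j))" if "fst j = J" for j using that by simp
  have gev_c: "gev (?c e) k = c \<odot> \<langle>e, k\<rangle>" if "elem e" "elem k" "ty e = J" "ty k = K" "ctx e \<inter> ctx k = {}" for e k
    using that by (simp add: gev_def)
  have univ: "universal (c \<odot> \<langle>var j, var x\<rangle>)" if "fst j = J" "fst x = K" "j \<noteq> x" for j x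
    using that iso by (intro universal_app[where E = D]) auto
  show ?thesis
  proof (rule is_cotensorI)
    fix k j N assume *: "gm arities_op k" "gcod k = K" "gctx k = insert j N" "j \<notin> N" "fst j = J" "vctx N"
    note g = gm_simps[OF *(1)]
    obtain x where x: "fst x = K" "x \<notin> insert j N"
      using fresh_name[of "insert j N"] *(6) by (metis finite_insert vctx_finite)
    let ?u = "c \<odot> \<langle>var j, var x\<rangle>"
    have u: "universal ?u" "elem ?u" "ty ?u = D" using univ[of j x] x * by (auto intro: universal_elem)
    \<comment> \<open>\<open>gev k (var x)\<close> depends on both indices \<open>j\<close> and
      \<open>x\<close>; abstracting over the single universal element \<open>?u\<close> built from
      them turns it into a function on \<open>D\<close>.\<close>
    obtain q where q: "q \<in> \<V> (tens N \<otimes> D) (gdom k)" "gev k (var x) = q \<odot> \<langle>generic N, ?u\<rangle>"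
      by (rule abstract_elem[of "gev k (var x)" "\<langle>generic N, ?u\<rangle>"]) (use * x u g in \<open>auto simp del: app_pair\<close>)
    note [simp] = arrowsD[OF q(1)]
    let ?h = "Gm (gdom k) D (curry_arr (tens N) D (gdom k) q \<odot> generic N)"
    have h: "gm arities_op ?h" using * g by simp
    have "gcomp arities_op (?c (var j)) ?h = k"
    proof (rule gev_ext[where u = "var x"])
      have "gev (gcomp arities_op (?c (var j)) ?h) (var x) = gev ?h (gev (?c (var j)) (var x))"
        using h * x by (intro gev_gcomp) auto
      also have "\<dots> = gev ?h ?u" using * x by (subst gev_c) auto
      also have "\<dots> = gev k (var x)" unfolding q(2) using * x u g by (simp add: gev_def)
      finally show "gev (gcomp arities_op (?c (var j)) ?h) (var x) = gev k (var x)" .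
    qed (use h * x g in auto)
    then show "\<exists>h. gm arities_op h \<and> gdom h = gdom k \<and> gcod h = D \<and> gctx h = N \<and> gcomp arities_op (?c (var j)) h = k"
      using h by (intro exI[of _ ?h]) auto
  next
    fix h h' j assume *: "gm arities_op h" "gm arities_op h'" "gdom h' = gdom h" "gcod h = D" "gcod h' = D"
      "gctx h' = gctx h" "fst j = J" "j \<notin> gctx h"
      and eq: "gcomp arities_op (?c (var j)) h = gcomp arities_op (?c (var j)) h'"
    obtain x where x: "fst x = K" "x \<notin> insert j (gctx h)"
      using fresh_name[of "insert j (gctx h)"] *(1) by (metis finite_insert vctx_finite gm_vctx)
    have "gev h (gev (?c (var j)) (var x)) = gev h' (gev (?c (var j)) (var x))"
      using gev_gcomp[of h "?c (var j)" "var x"] gev_gcomp[of h' "?c (var j)" "var x"] eq * x by auto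
    then show "h = h'"
      using gev_c[of "var j" "var x"] univ[of j x] * x
      by - (rule gev_ext[where u = "c \<odot> \<langle>var j, var x\<rangle>"]; auto)
  qed (auto simp: arrows_def)
qed

definition comap_fun :: "('a, 'o, 'm, 'z) cotensored_vcat_scheme \<Rightarrow> 'a \<Rightarrow> ('o, 'a, 'm) vfun" where
  "comap_fun C X = \<lparr>obj_map = (\<lambda>J. cotensor_ob C J X), hom_map = cot_comap C X\<rparr>"

lemma obj_comap_fun [simp]: "obj_map (comap_fun C X) J = cotensor_ob C J X"
  by (simp add: comap_fun_def)

context
  fixes C :: "('a, 'o, 'm, 'z) cotensored_vcat_scheme" and X
  assumes C [simp]: "is_vcat C" and X [simp]: "X \<in> Ob C" and des [simp]: "\<And>J. J \<in> \<J> \<Longrightarrow> designated C J X"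
begin

lemma comap_cotensor_simps [simp]:
  assumes "J \<in> \<J>"
  shows "cotensor_ob C J X \<in> Ob C"
    "counit C J X \<in> arrs V" "source V (counit C J X) = J" "target V (counit C J X) = Hom C (cotensor_ob C J X) X"
  using designated_simps[OF des[OF assms]] by auto

lemma cot_comap_arr:
  assumes [simp]: "J \<in> \<J>" "K \<in> \<J>"
  shows "cot_comap C X J K \<in> \<V> (K \<Rrightarrow> J) (Hom C (cotensor_ob C J X) (cotensor_ob C K X))"
  unfolding cot_comap_def by (rule cotensor_lift(1)) (auto simp: arrows_def)

lemma comap_fun_typed [simp]: "vfun_typed arities_op C (comap_fun C X)"
  using cot_comap_arr by (simp add: vfun_typed_def comap_fun_def)

lemma gm_comap_fun [simp]: "gm arities_op f \<Longrightarrow> gm C (gmap (comap_fun C X) f)"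
  by (rule gm_gmap[OF comap_fun_typed])

text \<open>Characterises \<open>[f,X]\<close> as reindexing: the projection with index
  \<open>k\<close> becomes the projection with index \<open>f(k)\<close>.\<close>

lemma comap_fun_natural:
  assumes f: "gm arities_op f" and k: "elem k" "ty k = gcod f" "ctx k \<inter> gctx f = {}" and K: "gcod f = K"
  shows "gcomp C (cu C K X k) (gmap (comap_fun C X) f) = cu C (gdom f) X (gev f k)"
proof -
  note g [simp] = gm_simps[OF f, simplified]
  have [simp]: "gctx f \<inter> ctx k = {}" using k by blast
  let ?J = "gdom f" and ?K = "gcod f"
  have "gcomp C (Gm (cotensor_ob C ?K X) X (counit C ?K X \<odot> k)) (Gm (cotensor_ob C ?J X) (cotensor_ob C ?K X) (cot_comap C X ?J ?K \<odot> gel f))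
     = Gm (cotensor_ob C ?J X) X ((counit C ?J X \<cdot> \<e> ?K ?J) \<odot> \<langle>gel f, k\<rangle>)"
    unfolding cot_comap_def by (rule cotensor_lift(2)) (use k in \<open>auto simp: arrows_def\<close>)
  then show ?thesis unfolding K[symmetric] using k by (simp add: cu_def gcomp_def gmap_def comap_fun_def gev_def ev_def)
qed

lemma is_vfun_comap_fun: "is_vfun arities_op C (comap_fun C X)"
proof (rule is_vfunI)
  fix f g assume fg: "gm arities_op f" "gm arities_op g" "gcod f = gdom g" "gctx g \<inter> gctx f = {}"
  note gm_simps[OF fg(1), simplified, simp] gm_simps[OF fg(2), simplified, simp]
  obtain x where x: "fst x = gcod g" "x \<notin> gctx f \<union> gctx g"
    using fresh_name[of "gctx f \<union> gctx g"] fg(1,2) by (metis gm_vctx vctx_finite finite_UnI)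
  have d: "gctx f \<inter> gctx g = {}" using fg by blast
  let ?F = "gmap (comap_fun C X)"
  show "?F (gcomp arities_op g f) = gcomp C (?F g) (?F f)"
  proof (rule designated_ext[where e = "var x" and J = "gcod g" and X = X])
    have "gcomp C (cu C (gcod g) X (var x)) (?F (gcomp arities_op g f)) = cu C (gdom f) X (gev f (gev g (var x)))"
      using fg x by (simp add: comap_fun_natural)
    also have "\<dots> = gcomp C (cu C (gdom g) X (gev g (var x))) (?F f)"
      using fg x d by (simp add: comap_fun_natural)
    also have "\<dots> = gcomp C (gcomp C (cu C (gcod g) X (var x)) (?F g)) (?F f)"
      using fg x comap_fun_natural[of g "var x"] by simp
    also have "\<dots> = gcomp C (cu C (gcod g) X (var x)) (gcomp C (?F g) (?F f))"
      using fg x by (subst gassoc) auto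
    finally show "gcomp C (cu C (gcod g) X (var x)) (?F (gcomp arities_op g f))
      = gcomp C (cu C (gcod g) X (var x)) (gcomp C (?F g) (?F f))" .
  qed (use fg x in auto)
next
  fix J assume [simp]: "J \<in> Ob arities_op"
  then have [simp]: "J \<in> \<J>" by simp
  show "gmap (comap_fun C X) (gid arities_op J) = gid C (obj_map (comap_fun C X) J)"
    by (rule designated_ext[where e = "var (J, 0)" and X = X and J = J])
      (use comap_fun_natural[of "gid arities_op J" "var (J, 0)" J] in auto)
qed simp_all

text \<open>\<open>[J,[K,X]]\<close> is \<open>[J \<otimes> K,X]\<close>: projecting with
  \<open>j\<close> and then with \<open>x\<close> is projecting with the pair of both. This pair is
  universal, so lifts along it exist and are unique.\<close>

lemma comap_fun_tensor:
  assumes [simp]: "J \<in> \<J>" "K \<in> \<J>"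
  shows "is_cotensor C J (cotensor_ob C K X) (cotensor_ob C (J \<otimes> K) X)
    (cot_comap C X (J \<otimes> K) K \<cdot> curry_arr J K (J \<otimes> K) (\<one> (J \<otimes> K)))"
proof -
  let ?T = "J \<otimes> K" and ?F = "gmap (comap_fun C X)"
  have [simp]: "?T \<in> \<J>" by (simp add: arities_tensor)
  let ?c = "\<lambda>e. Gm ?T K (curry_arr J K ?T (\<one> ?T) \<odot> e)"
  note [simp] = arrowsD[OF cot_comap_arr]
  have Fc: "Gm (cotensor_ob C ?T X) (cotensor_ob C K X) ((cot_comap C X ?T K \<cdot> curry_arr J K ?T (\<one> ?T)) \<odot> e) = ?F (?c e)"
    if "elem e" "ty e = J" for e using that by (simp add: gmap_def comap_fun_def)
  have gc [simp]: "gm C (?F (?c (var j)))" if "fst j = J" for j using that by (intro gm_comap_fun) simp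
  have key: "gcomp C (cu C K X (var x)) (gcomp C (?F (?c (var j))) h) = gcomp C (cu C ?T X \<langle>var j, var x\<rangle>) h"
    if "gm C h" "gcod h = cotensor_ob C ?T X" "fst x = K" "fst j = J" "x \<noteq> j" "x \<notin> gctx h" "j \<notin> gctx h" for h x j
  proof -
    have "gcomp C (cu C K X (var x)) (gcomp C (?F (?c (var j))) h) = gcomp C (gcomp C (cu C K X (var x)) (?F (?c (var j)))) h"
      using that by (subst gassoc) auto
    also have "gcomp C (cu C K X (var x)) (?F (?c (var j))) = cu C ?T X (gev (?c (var j)) (var x))"
      using that by (subst comap_fun_natural) auto
    also have "gev (?c (var j)) (var x) = \<langle>var j, var x\<rangle>" using that by (simp add: gev_def)
    finally show ?thesis .
  qed
  show ?thesis
  proof (rule is_cotensorI)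
    fix k j N assume *: "gm C k" "gcod k = cotensor_ob C K X" "gctx k = insert j N" "j \<notin> N" "fst j = J" "vctx N"
    obtain x where x: "fst x = K" "x \<notin> insert j N"
      using fresh_name[of "insert j N"] *(6) by (metis finite_insert vctx_finite)
    obtain h where h: "gm C h" "gdom h = gdom k" "gcod h = cotensor_ob C ?T X" "gctx h = N"
        "gcomp C (cu C ?T X \<langle>var j, var x\<rangle>) h = gcomp C (cu C K X (var x)) k"
      by (rule designated_ex[of C ?T X "gcomp C (cu C K X (var x)) k" "\<langle>var j, var x\<rangle>" N]) (use * x in auto)
    have "gcomp C (?F (?c (var j))) h = k"
      by (rule designated_ext[where e = "var x" and X = X and J = K]) (use * x h key[of h x j] in auto)
    then show "\<exists>h. gm C h \<and> gdom h = gdom k \<and> gcod h = cotensor_ob C ?T X \<and> gctx h = N \<and>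
        gcomp C (Gm (cotensor_ob C ?T X) (cotensor_ob C K X) ((cot_comap C X ?T K \<cdot> curry_arr J K ?T (\<one> ?T)) \<odot> var j)) h = k"
      using h * by (subst Fc) auto
  next
    fix h h' j assume *: "gm C h" "gm C h'" "gdom h' = gdom h" "gcod h = cotensor_ob C ?T X" "gcod h' = cotensor_ob C ?T X"
      "gctx h' = gctx h" "fst j = J" "j \<notin> gctx h"
      and eq: "gcomp C (Gm (cotensor_ob C ?T X) (cotensor_ob C K X) ((cot_comap C X ?T K \<cdot> curry_arr J K ?T (\<one> ?T)) \<odot> var j)) h
        = gcomp C (Gm (cotensor_ob C ?T X) (cotensor_ob C K X) ((cot_comap C X ?T K \<cdot> curry_arr J K ?T (\<one> ?T)) \<odot> var j)) h'"
    obtain x where x: "fst x = K" "x \<notin> insert j (gctx h)"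
      using fresh_name[of "insert j (gctx h)"] *(1) by (metis finite_insert vctx_finite gm_vctx)
    have "gcomp C (?F (?c (var j))) h = gcomp C (?F (?c (var j))) h'" using eq * by (simp add: Fc del: app_comp)
    then have "gcomp C (cu C ?T X \<langle>var j, var x\<rangle>) h = gcomp C (cu C ?T X \<langle>var j, var x\<rangle>) h'"
      using key[of h x j] key[of h' x j] * x by auto
    then show "h = h'"
      by - (rule designated_ext[where e = "\<langle>var j, var x\<rangle>" and X = X and J = ?T]; use * x in auto)
  qed (auto simp: arrows_def)
qed

text \<open>By \<open>cotensor_transfer\<close> only the cotensor \<open>J \<otimes> K\<close> of
  \<open>K\<close> has to be considered.\<close>

lemma comap_fun_preserves: "preserves_cotensors arities_op C (comap_fun C X)"
  unfolding preserves_cotensors_def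
proof (intro ballI allI impI)
  fix J K D c assume JK [simp]: "J \<in> \<J>" "K \<in> Ob arities_op" and c: "is_cotensor arities_op J K D c"
  have [simp]: "K \<in> \<J>" "J \<otimes> K \<in> \<J>" using JK arities_tensor by auto
  have B: "is_cotensor arities_op J K (J \<otimes> K) (curry_arr J K (J \<otimes> K) (\<one> (J \<otimes> K)))"
    by (rule arities_op_cotensor) (auto intro: is_iso_idt)
  show "is_cotensor C J (obj_map (comap_fun C X) K) (obj_map (comap_fun C X) D) (hom_map (comap_fun C X) D K \<cdot> c)"
    by (rule cotensor_transfer[OF _ _ is_vfun_comap_fun _ _ B _ c])
      (use comap_fun_tensor[of J K] in \<open>auto simp: comap_fun_def\<close>)
qed

end

end

section \<open>The enriched category of algebras of a theory\<close>

context system_of_arities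
begin

lemma admissible_simps:
  assumes "admissible C"
  shows "is_vcat C" "J \<in> \<J> \<Longrightarrow> X \<in> Ob C \<Longrightarrow> designated C J X"
    "X \<in> Ob C \<Longrightarrow> cotensor_ob C \<I> X = X" "X \<in> Ob C \<Longrightarrow> counit C \<I> X = Ide C X"
  using assms by (auto simp: admissible_def has_designated_cotensors_def)

lemma theory_simps:
  assumes "is_theory T"
  shows "is_vcat T" "Ob T = \<J>" "is_vfun arities_op T (str T)" "J \<in> \<J> \<Longrightarrow> obj_map (str T) J = J"
  using assms by (auto simp: is_theory_def)

text \<open>Evaluation at \<open>S\<close>, packaged as a functor so that the component of a graded
  homomorphism is its image under \<open>gmap\<close>.\<close>

definition evalf :: "('o, 'm) jtheory \<Rightarrow> ('c, 'o, 'm, 'z) cotensored_vcat_scheme \<Rightarrow> 'o \<Rightarrow> (('o, 'c, 'm) vfun, 'c, 'm) vfun" where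
  "evalf T C S = \<lparr>obj_map = (\<lambda>A. obj_map A S), hom_map = (\<lambda>A B. alg_proj T C A B S)\<rparr>"

lemma obj_evalf [simp]: "obj_map (evalf T C S) A = obj_map A S"
  by (simp add: evalf_def)

abbreviation comp_at :: "('o, 'm) jtheory \<Rightarrow> ('c, 'o, 'm, 'z) cotensored_vcat_scheme \<Rightarrow> 'o \<Rightarrow>
    (('o, 'c, 'm) vfun, 'o, 'm) gmor \<Rightarrow> ('c, 'o, 'm) gmor" where
  "comp_at T C S \<equiv> gmap (evalf T C S)"

lemma Alg_simps [simp]:
  "Ob (Alg_vcat T C) = {A. is_talg T C A}" "Hom (Alg_vcat T C) = alg_hom T C"
  "cotensor_ob (Alg_vcat T C) = alg_cot C"
  by (simp_all add: Alg_vcat_def)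

lemma obj_alg_cot [simp]: "obj_map (alg_cot C J A) S = cotensor_ob C J (obj_map A S)"
  by (simp add: alg_cot_def)

lemma alg_cot_eq: "alg_cot C J A = vfun_comp (cot_fun C J) A"
  by (simp add: alg_cot_def vfun_comp_def cot_fun_def)

context
  fixes T :: "('o, 'm) jtheory" and C :: "('c, 'o, 'm, 'z) cotensored_vcat_scheme"
  assumes adm: "admissible C" and th: "is_theory T"
begin

abbreviation "Al \<equiv> Alg_vcat T C"

lemma alg_context_simps [simp]:
  "is_vcat C" "is_vcat T" "J \<in> \<J> \<Longrightarrow> X \<in> Ob C \<Longrightarrow> designated C J X" "Ob T = \<J>"
  using admissible_simps[OF adm] theory_simps[OF th] by auto

lemma talg_vfun: "is_talg T C A \<Longrightarrow> is_vfun T C A"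
  by (simp add: is_talg_def)

lemma talg_typed [simp]: "is_talg T C A \<Longrightarrow> vfun_typed T C A"
  by (simp add: is_talg_def is_vfun_typed)

lemma talg_simps [simp]:
  assumes "is_talg T C A" "S \<in> \<J>"
  shows "obj_map A S \<in> Ob C"
    "S' \<in> \<J> \<Longrightarrow> hom_map A S S' \<in> arrs V"
    "S' \<in> \<J> \<Longrightarrow> source V (hom_map A S S') = Hom T S S'"
    "S' \<in> \<J> \<Longrightarrow> target V (hom_map A S S') = Hom C (obj_map A S) (obj_map A S')"
  using vfun_simps[OF talg_typed[OF assms(1)]] assms(2) by auto

lemma gm_talg [simp]: "is_talg T C A \<Longrightarrow> gm T t \<Longrightarrow> gm C (gmap A t)"
  by (rule gm_gmap[OF talg_typed])

lemma wedge_natural: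
  assumes w: "is_wedge T C A B E p" and A: "is_talg T C A" and B: "is_talg T C B"
    and e: "elem e" "ty e = E" and t: "gm T t" "ctx e \<inter> gctx t = {}" "gctx t \<inter> ctx e = {}"
    and p: "\<And>S. S \<in> \<J> \<Longrightarrow> p S \<in> \<V> E (Hom C (obj_map A S) (obj_map B S))"
  shows "gcomp C (Gm (obj_map A (gcod t)) (obj_map B (gcod t)) (p (gcod t) \<odot> e)) (gmap A t)
     = gcomp C (gmap B t) (Gm (obj_map A (gdom t)) (obj_map B (gdom t)) (p (gdom t) \<odot> e))"
proof -
  note g [simp] = gm_simps[OF t(1), simplified]
  let ?S = "gdom t" and ?R = "gcod t"
  have "(Comp C (obj_map A ?S) (obj_map A ?R) (obj_map B ?R) \<cdot> (p ?R \<boxtimes> hom_map A ?S ?R)) \<odot> \<langle>e, gel t\<rangle> =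
        (Comp C (obj_map A ?S) (obj_map B ?S) (obj_map B ?R) \<cdot> (hom_map B ?S ?R \<boxtimes> p ?S) \<cdot> \<s> E (Hom T ?S ?R)) \<odot> \<langle>e, gel t\<rangle>"
    using w g(1,2) unfolding is_wedge_def by simp
  then show ?thesis using e t A B arrowsD[OF p[OF g(1)]] arrowsD[OF p[OF g(2)]] elem_obj[OF e(1)]
    by (simp add: gcomp_def gmap_def)
qed

text \<open>Naturality is required only for \<open>t\<close> in general position: \<open>M\<close>
  collects names that occur elsewhere in an argument and that \<open>t\<close> may be assumed to
  avoid.\<close>

lemma wedgeI:
  assumes A: "is_talg T C A" and B: "is_talg T C B" and e: "universal e" "ty e = E" and M: "finite M"
    and p: "\<And>S. S \<in> \<J> \<Longrightarrow> p S \<in> \<V> E (Hom C (obj_map A S) (obj_map B S))"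
    and nat: "\<And>t. \<lbrakk>gm T t; ctx e \<inter> gctx t = {}; gctx t \<inter> ctx e = {}; gctx t \<inter> M = {}\<rbrakk> \<Longrightarrow>
      gcomp C (Gm (obj_map A (gcod t)) (obj_map B (gcod t)) (p (gcod t) \<odot> e)) (gmap A t)
      = gcomp C (gmap B t) (Gm (obj_map A (gdom t)) (obj_map B (gdom t)) (p (gdom t) \<odot> e))"
  shows "is_wedge T C A B E p"
  unfolding is_wedge_def
proof (intro conjI ballI)
  have el [simp]: "elem e" using e universal_elem by auto
  show E [simp]: "E \<in> objs V" using elem_obj[OF el] e by simp
  fix S R assume "S \<in> Ob T" "R \<in> Ob T"
  then have [simp]: "S \<in> \<J>" "R \<in> \<J>" by auto
  note [simp] = arrowsD[OF p[of S]] arrowsD[OF p[of R]] A B e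
  obtain x where x: "fst x = Hom T S R" "x \<notin> ctx e \<union> M"
    using fresh_name[of "ctx e \<union> M"] M el by (metis elem_vctx vctx_finite finite_UnI)
  then have [simp]: "x \<notin> ctx e" "x \<notin> M" "fst x = Hom T S R" by auto
  show "Comp C (obj_map A S) (obj_map A R) (obj_map B R) \<cdot> (p R \<boxtimes> hom_map A S R) =
        Comp C (obj_map A S) (obj_map B S) (obj_map B R) \<cdot> (hom_map B S R \<boxtimes> p S) \<cdot> \<s> E (Hom T S R)"
  proof (rule universal_ext[where e = "\<langle>e, var x\<rangle>" and G = "Hom C (obj_map A S) (obj_map B R)"])
    show "(Comp C (obj_map A S) (obj_map A R) (obj_map B R) \<cdot> (p R \<boxtimes> hom_map A S R)) \<odot> \<langle>e, var x\<rangle> =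
        (Comp C (obj_map A S) (obj_map B S) (obj_map B R) \<cdot> (hom_map B S R \<boxtimes> p S) \<cdot> \<s> E (Hom T S R)) \<odot> \<langle>e, var x\<rangle>"
      using nat[of "Gm S R (var x)"] by (simp add: gcomp_def gmap_def)
  qed (auto simp: arrows_def)
qed (use p in auto)

context
  fixes A B
  assumes A [simp]: "is_talg T C A" and B [simp]: "is_talg T C B"
begin

lemma alg_is_end: "is_end T C A B (alg_hom T C A B) (alg_proj T C A B)"
proof -
  have "\<exists>Ep. is_end T C A B (fst Ep) (snd Ep)" using adm th A B by (auto simp: admissible_def)
  then show ?thesis unfolding alg_hom_def alg_proj_def alg_end_def by (rule someI_ex)
qed

lemma alg_is_wedge: "is_wedge T C A B (alg_hom T C A B) (alg_proj T C A B)"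
  using alg_is_end by (simp add: is_end_def)

lemma alg_hom_obj [simp]: "alg_hom T C A B \<in> objs V"
  using alg_is_wedge by (simp add: is_wedge_def)

lemma alg_proj_arr: "S \<in> \<J> \<Longrightarrow> alg_proj T C A B S \<in> \<V> (alg_hom T C A B) (Hom C (obj_map A S) (obj_map B S))"
  using alg_is_wedge by (simp add: is_wedge_def)

lemma alg_proj_typed [simp]:
  assumes "S \<in> \<J>"
  shows "alg_proj T C A B S \<in> arrs V" "source V (alg_proj T C A B S) = alg_hom T C A B"
    "target V (alg_proj T C A B S) = Hom C (obj_map A S) (obj_map B S)"
  using arrowsD[OF alg_proj_arr[OF assms]] by auto

lemma alg_lift:
  assumes "is_wedge T C A B E q"
  shows "alg_lift T C A B E q \<in> \<V> E (alg_hom T C A B)" "S \<in> \<J> \<Longrightarrow> alg_proj T C A B S \<cdot> alg_lift T C A B E q = q S"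
  using theI'[of "\<lambda>h. h \<in> \<V> E (alg_hom T C A B) \<and> (\<forall>S \<in> Ob T. alg_proj T C A B S \<cdot> h = q S)"] alg_is_end assms
  unfolding is_end_def alg_lift_def by auto

text \<open>Uniqueness in the universal property of the end, for the wedge of projections composed
  with \<open>f\<close>. Equations between homomorphisms can thereby be checked on
  components.\<close>

lemma alg_proj_monic:
  assumes "\<And>S. S \<in> \<J> \<Longrightarrow> alg_proj T C A B S \<cdot> f = alg_proj T C A B S \<cdot> g"
    "f \<in> \<V> E (alg_hom T C A B)" "g \<in> \<V> E (alg_hom T C A B)"
  shows "f = g"
proof -
  note [simp] = arrowsD[OF assms(2)] arrows_dom[OF assms(2)]
  have "is_wedge T C A B E (\<lambda>S. alg_proj T C A B S \<cdot> f)"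
  proof (rule wedgeI[where e = "var (E, 0)" and M = "{}"])
    fix t assume t: "gm T t" "ctx (var (E, 0)) \<inter> gctx t = {}" "gctx t \<inter> ctx (var (E, 0)) = {}"
    then show "gcomp C (Gm (obj_map A (gcod t)) (obj_map B (gcod t)) ((alg_proj T C A B (gcod t) \<cdot> f) \<odot> var (E, 0))) (gmap A t)
      = gcomp C (gmap B t) (Gm (obj_map A (gdom t)) (obj_map B (gdom t)) ((alg_proj T C A B (gdom t) \<cdot> f) \<odot> var (E, 0)))"
      using wedge_natural[OF alg_is_wedge A B, of "f \<odot> var (E, 0)" t] alg_proj_arr gm_simps[OF t(1)] by simp
  qed (auto simp: arrows_def)
  then have "\<exists>!h. h \<in> \<V> E (alg_hom T C A B) \<and> (\<forall>S \<in> Ob T. alg_proj T C A B S \<cdot> h = alg_proj T C A B S \<cdot> f)"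
    using alg_is_end by (simp add: is_end_def)
  then show ?thesis using assms by (metis alg_context_simps(4))
qed

end

lemma evalf_typed [simp]: "S \<in> \<J> \<Longrightarrow> vfun_typed Al C (evalf T C S)"
  using alg_proj_arr by (simp add: vfun_typed_def evalf_def)

lemma gm_comp_at [simp]: "gm Al \<alpha> \<Longrightarrow> S \<in> \<J> \<Longrightarrow> gm C (comp_at T C S \<alpha>)"
  by (rule gm_gmap[OF evalf_typed])

lemma gm_Al: "gm Al \<alpha> \<Longrightarrow> is_talg T C (gdom \<alpha>)" "gm Al \<alpha> \<Longrightarrow> is_talg T C (gcod \<alpha>)"
  by (auto simp: gm_def)

lemma comp_at_natural:
  assumes a: "gm Al \<alpha>" and t: "gm T t" "gctx \<alpha> \<inter> gctx t = {}" and A: "gdom \<alpha> = A" "gcod \<alpha> = B" "gdom t = S" "gcod t = R"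
  shows "gcomp C (comp_at T C R \<alpha>) (gmap A t) = gcomp C (gmap B t) (comp_at T C S \<alpha>)"
proof -
  have d: "gctx t \<inter> gctx \<alpha> = {}" using t(2) by blast
  note g = gm_simps[OF a]
  show ?thesis
    using wedge_natural[OF alg_is_wedge _ _ g(3) _ t d, of "gdom \<alpha>" "gcod \<alpha>"] alg_proj_arr g
    unfolding A[symmetric] by (simp add: gmap_def evalf_def)
qed

text \<open>Two naturality squares, for the generic homomorphisms \<open>?b\<close> and
  \<open>?a\<close>, pasted side by side.\<close>

lemma comp_wedge:
  assumes [simp]: "is_talg T C A" "is_talg T C B" "is_talg T C D"
  shows "is_wedge T C A D (alg_hom T C B D \<otimes> alg_hom T C A B)
    (\<lambda>S. Comp C (obj_map A S) (obj_map B S) (obj_map D S) \<cdot> (alg_proj T C B D S \<boxtimes> alg_proj T C A B S))"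
proof (rule wedgeI)
  let ?b = "Gm B D (var (alg_hom T C B D, 0))" and ?a = "Gm A B (var (alg_hom T C A B, 1))"
  let ?e = "\<langle>gel ?b, gel ?a\<rangle>"
  have [simp]: "gm Al ?b" "gm Al ?a" by auto
  show "universal ?e" by simp
  show "ty ?e = alg_hom T C B D \<otimes> alg_hom T C A B" by simp
  fix t assume t: "gm T t" "ctx ?e \<inter> gctx t = {}" "gctx t \<inter> ctx ?e = {}"
  then have [simp]: "(alg_hom T C B D, 0) \<notin> gctx t" "(alg_hom T C A B, 1) \<notin> gctx t" by auto
  note [simp] = gm_simps[OF t(1), simplified]
  have b: "gcomp C (comp_at T C S ?b) (comp_at T C S ?a) = Gm (obj_map A S) (obj_map D S)
     ((Comp C (obj_map A S) (obj_map B S) (obj_map D S) \<cdot> (alg_proj T C B D S \<boxtimes> alg_proj T C A B S)) \<odot> ?e)" if "S \<in> \<J>" for S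
    using that by (simp add: gcomp_def gmap_def evalf_def)
  let ?S = "gdom t" and ?R = "gcod t"
  have "gcomp C (gcomp C (comp_at T C ?R ?b) (comp_at T C ?R ?a)) (gmap A t) = gcomp C (comp_at T C ?R ?b) (gcomp C (comp_at T C ?R ?a) (gmap A t))"
    using t by (intro gassoc) auto
  also have "\<dots> = gcomp C (comp_at T C ?R ?b) (gcomp C (gmap B t) (comp_at T C ?S ?a))"
    using t comp_at_natural[of ?a t A B ?S ?R] by simp
  also have "\<dots> = gcomp C (gcomp C (comp_at T C ?R ?b) (gmap B t)) (comp_at T C ?S ?a)"
    using t by (intro gassoc[symmetric]) auto
  also have "\<dots> = gcomp C (gcomp C (gmap D t) (comp_at T C ?S ?b)) (comp_at T C ?S ?a)"
    using t comp_at_natural[of ?b t B D ?S ?R] by simp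
  also have "\<dots> = gcomp C (gmap D t) (gcomp C (comp_at T C ?S ?b) (comp_at T C ?S ?a))"
    using t by (intro gassoc) auto
  finally show "gcomp C (Gm (obj_map A ?R) (obj_map D ?R)
       ((Comp C (obj_map A ?R) (obj_map B ?R) (obj_map D ?R) \<cdot> (alg_proj T C B D ?R \<boxtimes> alg_proj T C A B ?R)) \<odot> ?e)) (gmap A t)
     = gcomp C (gmap D t) (Gm (obj_map A ?S) (obj_map D ?S)
       ((Comp C (obj_map A ?S) (obj_map B ?S) (obj_map D ?S) \<cdot> (alg_proj T C B D ?S \<boxtimes> alg_proj T C A B ?S)) \<odot> ?e))"
    by (simp only: b \<open>?S \<in> \<J>\<close> \<open>?R \<in> \<J>\<close>)
qed (auto simp: arrows_def)

lemma ide_wedge: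
  assumes [simp]: "is_talg T C A"
  shows "is_wedge T C A A \<I> (\<lambda>S. Ide C (obj_map A S))"
proof (rule wedgeI)
  show "universal unit_elem" "ty unit_elem = \<I>" by auto
  fix t assume t: "gm T t"
  note [simp] = gm_simps[OF t, simplified]
  show "gcomp C (Gm (obj_map A (gcod t)) (obj_map A (gcod t)) (Ide C (obj_map A (gcod t)) \<odot> unit_elem)) (gmap A t) =
         gcomp C (gmap A t) (Gm (obj_map A (gdom t)) (obj_map A (gdom t)) (Ide C (obj_map A (gdom t)) \<odot> unit_elem))"
    using t by (simp flip: gid_def)
qed (auto simp: arrows_def)

lemma Al_Comp:
  assumes "is_talg T C A" "is_talg T C B" "is_talg T C D"
  shows "Comp Al A B D \<in> \<V> (alg_hom T C B D \<otimes> alg_hom T C A B) (alg_hom T C A D)"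
    "S \<in> \<J> \<Longrightarrow> alg_proj T C A D S \<cdot> Comp Al A B D =
      Comp C (obj_map A S) (obj_map B S) (obj_map D S) \<cdot> (alg_proj T C B D S \<boxtimes> alg_proj T C A B S)"
  using alg_lift[OF assms(1,3) comp_wedge[OF assms]] by (simp_all add: Alg_vcat_def)

lemma Al_Ide:
  assumes "is_talg T C A"
  shows "Ide Al A \<in> \<V> \<I> (alg_hom T C A A)" "S \<in> \<J> \<Longrightarrow> alg_proj T C A A S \<cdot> Ide Al A = Ide C (obj_map A S)"
  using alg_lift[OF assms assms ide_wedge[OF assms]] by (simp_all add: Alg_vcat_def)

lemma Al_typed [simp]: "vcat_typed Al"
  using Al_Comp(1) Al_Ide(1) alg_hom_obj by (simp add: vcat_typed_def)

lemma comp_at_gcomp [simp]: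
  assumes "gm Al \<alpha>" "gm Al \<beta>" "gcod \<alpha> = gdom \<beta>" "gctx \<beta> \<inter> gctx \<alpha> = {}" and S [simp]: "S \<in> \<J>"
  shows "comp_at T C S (gcomp Al \<beta> \<alpha>) = gcomp C (comp_at T C S \<beta>) (comp_at T C S \<alpha>)"
proof -
  note a = gm_simps[OF assms(1), simplified] and b = gm_simps[OF assms(2), simplified]
  have "(alg_proj T C (gdom \<alpha>) (gcod \<beta>) S \<cdot> Comp Al (gdom \<alpha>) (gdom \<beta>) (gcod \<beta>)) \<odot> \<langle>gel \<beta>, gel \<alpha>\<rangle> =
     (Comp C (obj_map (gdom \<alpha>) S) (obj_map (gdom \<beta>) S) (obj_map (gcod \<beta>) S) \<cdot>
       (alg_proj T C (gdom \<beta>) (gcod \<beta>) S \<boxtimes> alg_proj T C (gdom \<alpha>) (gdom \<beta>) S)) \<odot> \<langle>gel \<beta>, gel \<alpha>\<rangle>"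
    using a b by (simp only: Al_Comp(2) S)
  then show ?thesis using a b assms arrowsD[OF Al_Comp(1)[OF a(1) b(1,2)]]
    by (simp add: gcomp_def gmap_def evalf_def)
qed

lemma comp_at_gid [simp]:
  assumes [simp]: "is_talg T C A" "S \<in> \<J>"
  shows "comp_at T C S (gid Al A) = gid C (obj_map A S)"
proof -
  have "(alg_proj T C A A S \<cdot> Ide Al A) \<odot> unit_elem = Ide C (obj_map A S) \<odot> unit_elem"
    by (simp only: Al_Ide(2) assms)
  then show ?thesis using arrowsD[OF Al_Ide(1)] by (simp add: gid_def gmap_def evalf_def)
qed

lemma Al_ext:
  assumes "gm Al \<alpha>" "gm Al \<beta>" "gdom \<beta> = gdom \<alpha>" "gcod \<beta> = gcod \<alpha>" "gctx \<beta> = gctx \<alpha>"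
    and eq: "\<And>S. S \<in> \<J> \<Longrightarrow> comp_at T C S \<alpha> = comp_at T C S \<beta>"
  shows "\<alpha> = \<beta>"
proof -
  note a = gm_simps[OF assms(1), simplified] and b = gm_simps[OF assms(2), simplified]
  have "arr (gel \<alpha>) = arr (gel \<beta>)"
  proof (rule alg_proj_monic[OF a(1,2)])
    show "alg_proj T C (gdom \<alpha>) (gcod \<alpha>) S \<cdot> arr (gel \<alpha>) = alg_proj T C (gdom \<alpha>) (gcod \<alpha>) S \<cdot> arr (gel \<beta>)" if "S \<in> \<J>" for S
      using eq[OF that] assms by (simp add: gmap_def evalf_def app_def)
    show "arr (gel \<alpha>) \<in> \<V> (tens (gctx \<alpha>)) (alg_hom T C (gdom \<alpha>) (gcod \<alpha>))" using app_generic(1)[OF a(3)] a by simp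
    show "arr (gel \<beta>) \<in> \<V> (tens (gctx \<alpha>)) (alg_hom T C (gdom \<alpha>) (gcod \<alpha>))" using app_generic(1)[OF b(3)] b assms by simp
  qed
  then show ?thesis using assms by (simp add: gmor.expand elem.expand)
qed

lemma is_vcat_Al [simp]: "is_vcat Al"
proof (rule is_vcatI)
  fix f g h assume *: "gm Al f" "gm Al g" "gm Al h" "gcod f = gdom g" "gcod g = gdom h"
    "gctx h \<inter> gctx g = {}" "gctx g \<inter> gctx f = {}" "gctx h \<inter> gctx f = {}"
  show "gcomp Al (gcomp Al h g) f = gcomp Al h (gcomp Al g f)"
    by (rule Al_ext) (use * in \<open>auto simp: Un_assoc\<close>)
next
  fix f assume *: "gm Al f"
  note [simp] = gm_Al[OF *]
  show "gcomp Al (gid Al (gcod f)) f = f" by (rule Al_ext) (use * in auto)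
  show "gcomp Al f (gid Al (gdom f)) = f" by (rule Al_ext) (use * in auto)
qed auto

text \<open>The converse of \<open>comp_at_natural\<close>: a family that commutes with the
  operations in general position is a wedge on \<open>tens N\<close>, and the end supplies the
  homomorphism.\<close>

lemma Al_ex:
  assumes A: "is_talg T C A" and B: "is_talg T C B" and N: "vctx N" and M: "finite M"
    and q: "\<And>S. S \<in> \<J> \<Longrightarrow> gm C (q S) \<and> gdom (q S) = obj_map A S \<and> gcod (q S) = obj_map B S \<and> gctx (q S) = N"
    and nat: "\<And>t. \<lbrakk>gm T t; gctx t \<inter> N = {}; N \<inter> gctx t = {}; gctx t \<inter> M = {}\<rbrakk>
       \<Longrightarrow> gcomp C (q (gcod t)) (gmap A t) = gcomp C (gmap B t) (q (gdom t))"
  obtains \<alpha> where "gm Al \<alpha>" "gdom \<alpha> = A" "gcod \<alpha> = B" "gctx \<alpha> = N" "\<And>S. S \<in> \<J> \<Longrightarrow> comp_at T C S \<alpha> = q S"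
proof -
  define p where "p S = arr (gel (q S))" for S
  have p: "p S \<in> \<V> (tens N) (Hom C (obj_map A S) (obj_map B S))"
    "Gm (obj_map A S) (obj_map B S) (p S \<odot> generic N) = q S" if "S \<in> \<J>" for S
    using app_generic[of "gel (q S)"] q[OF that] gm_simps[of C "q S"] by (auto simp: p_def gmor.expand)
  have w: "is_wedge T C A B (tens N) p"
  proof (rule wedgeI[OF A B, where e = "generic N" and M = M])
    fix t assume t: "gm T t" "ctx (generic N) \<inter> gctx t = {}" "gctx t \<inter> ctx (generic N) = {}" "gctx t \<inter> M = {}"
    then show "gcomp C (Gm (obj_map A (gcod t)) (obj_map B (gcod t)) (p (gcod t) \<odot> generic N)) (gmap A t)
      = gcomp C (gmap B t) (Gm (obj_map A (gdom t)) (obj_map B (gdom t)) (p (gdom t) \<odot> generic N))"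
      using nat[of t] gm_simps[OF t(1)] by (simp add: p(2))
  qed (use N M p in auto)
  note l = alg_lift[OF A B w]
  let ?a = "Gm A B (alg_lift T C A B (tens N) p \<odot> generic N)"
  note [simp] = arrowsD[OF l(1)]
  show ?thesis
  proof (rule that[of ?a])
    show "comp_at T C S ?a = q S" if "S \<in> \<J>" for S
    proof -
      have "(alg_proj T C A B S \<cdot> alg_lift T C A B (tens N) p) \<odot> generic N = p S \<odot> generic N"
        using l(2)[OF that] by simp
      then show ?thesis using that A B N p(2)[OF that] by (simp add: gmap_def evalf_def)
    qed
  qed (use A B N in auto)
qed

subsection \<open>Pointwise cotensors\<close>

text \<open>\<open>[J,-]\<close> is an enriched functor that preserves cotensors, so composing an
  algebra with it gives an algebra.\<close>

lemma talg_cot [simp]: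
  assumes J [simp]: "J \<in> \<J>" and A: "is_talg T C A"
  shows "is_talg T C (alg_cot C J A)"
  unfolding is_talg_def alg_cot_eq
proof
  have F: "is_vfun C C (cot_fun C J)" by (rule is_vfun_cot_fun) auto
  show "is_vfun T C (vfun_comp (cot_fun C J) A)"
    by (rule is_vfun_comp[OF talg_vfun[OF A] F]) auto
  show "preserves_cotensors T C (vfun_comp (cot_fun C J) A)"
    unfolding preserves_cotensors_def
  proof (intro ballI allI impI)
    fix K X D c assume K [simp]: "K \<in> \<J>" and "X \<in> Ob T" and c: "is_cotensor T K X D c"
    then have [simp]: "X \<in> \<J>" "D \<in> \<J>" and ct: "c \<in> \<V> K (Hom T D X)" by (auto simp: is_cotensor_def)
    have "is_cotensor C K (obj_map A X) (obj_map A D) (hom_map A D X \<cdot> c)"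
      using A c by (auto simp: is_talg_def preserves_cotensors_def)
    then have "is_cotensor C K (cotensor_ob C J (obj_map A X)) (cotensor_ob C J (obj_map A D))
        (cot_map C J (obj_map A D) (obj_map A X) \<cdot> hom_map A D X \<cdot> c)"
      using A by (intro cot_fun_cotensor) auto
    moreover have "(cot_map C J (obj_map A D) (obj_map A X) \<cdot> hom_map A D X) \<cdot> c
        = cot_map C J (obj_map A D) (obj_map A X) \<cdot> hom_map A D X \<cdot> c"
      using A arrowsD[OF ct] arrowsD[OF cot_map_arr[of C J "obj_map A D" "obj_map A X"]] by simp
    ultimately show "is_cotensor C K (obj_map (vfun_comp (cot_fun C J) A) X) (obj_map (vfun_comp (cot_fun C J) A) D)
       (hom_map (vfun_comp (cot_fun C J) A) D X \<cdot> c)"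
      by (simp add: vfun_comp_def cot_fun_def)
  qed
qed

lemma gmap_alg_cot:
  assumes "is_talg T C A" "J \<in> \<J>" "gm T t"
  shows "gmap (alg_cot C J A) t = gmap (cot_fun C J) (gmap A t)"
  unfolding alg_cot_eq by (rule gmap_vfun_comp[of T C A C]) (use assms in auto)

context
  fixes J A
  assumes J [simp]: "J \<in> \<J>" and A [simp]: "is_talg T C A"
begin

lemma counit_wedge: "is_wedge T C (alg_cot C J A) A J (\<lambda>S. counit C J (obj_map A S))"
proof (rule wedgeI)
  fix t assume t: "gm T t" "ctx (var (J, 0)) \<inter> gctx t = {}" "gctx t \<inter> ctx (var (J, 0)) = {}"
  note [simp] = gm_simps[OF t(1), simplified]
  have "gcomp C (cu C J (obj_map A (gcod t)) (var (J, 0))) (gmap (alg_cot C J A) t)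
      = gcomp C (gmap A t) (cu C J (obj_map A (gdom t)) (var (J, 0)))"
    using t by (simp add: gmap_alg_cot cot_fun_natural)
  then show "gcomp C (Gm (obj_map (alg_cot C J A) (gcod t)) (obj_map A (gcod t)) (counit C J (obj_map A (gcod t)) \<odot> var (J, 0))) (gmap (alg_cot C J A) t)
     = gcomp C (gmap A t) (Gm (obj_map (alg_cot C J A) (gdom t)) (obj_map A (gdom t)) (counit C J (obj_map A (gdom t)) \<odot> var (J, 0)))"
    by (simp add: cu_def)
next
  fix S assume "S \<in> \<J>"
  then show "counit C J (obj_map A S) \<in> \<V> J (Hom C (obj_map (alg_cot C J A) S) (obj_map A S))"
    using designated_simps(2)[of C J "obj_map A S"] by simp
qed auto

lemma Al_counit:
  "counit Al J A \<in> \<V> J (alg_hom T C (alg_cot C J A) A)"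
  "S \<in> \<J> \<Longrightarrow> alg_proj T C (alg_cot C J A) A S \<cdot> counit Al J A = counit C J (obj_map A S)"
  using alg_lift[OF _ _ counit_wedge] by (simp_all add: Alg_vcat_def)

lemma gm_cu_Al: "elem e \<Longrightarrow> ty e = J \<Longrightarrow> gm Al (cu Al J A e)"
  using arrowsD[OF Al_counit(1)] by (simp add: cu_def)

lemma comp_at_cu [simp]:
  assumes "elem e" "ty e = J" "S \<in> \<J>"
  shows "comp_at T C S (cu Al J A e) = cu C J (obj_map A S) e"
proof -
  have "(alg_proj T C (alg_cot C J A) A S \<cdot> counit Al J A) \<odot> e = counit C J (obj_map A S) \<odot> e"
    using Al_counit(2)[OF assms(3)] by simp
  then show ?thesis using assms arrowsD[OF Al_counit(1)] by (simp add: cu_def gmap_def evalf_def)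
qed

text \<open>Lifts are taken in \<open>C\<close> for each \<open>S\<close>. They commute with the
  operations because the projection \<open>cu\<close> at \<open>j\<close> is natural and left
  cancellable.\<close>

lemma designated_Al [simp]: "designated Al J A"
proof (rule is_cotensorI)
  show "counit Al J A \<in> \<V> J (Hom Al (cotensor_ob Al J A) A)" using Al_counit(1) by simp
  fix k j N assume *: "gm Al k" "gcod k = A" "gctx k = insert j N" "j \<notin> N" "fst j = J" "vctx N"
  note [simp] = gm_Al(1)[OF *(1)] *(1)
  have jt [simp]: "fst j \<in> objs V" using *(5) by simp
  have "\<exists>h. gm C h \<and> gdom h = obj_map (gdom k) S \<and> gcod h = cotensor_ob C J (obj_map A S) \<and> gctx h = N
      \<and> gcomp C (cu C J (obj_map A S) (var j)) h = comp_at T C S k" if S [simp]: "S \<in> \<J>" for S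
    by (rule designated_ex[of C J "obj_map A S" "comp_at T C S k" "var j" N]) (use * in auto)
  then obtain h where h: "gm C (h S) \<and> gdom (h S) = obj_map (gdom k) S \<and> gcod (h S) = cotensor_ob C J (obj_map A S) \<and> gctx (h S) = N"
     and hk: "gcomp C (cu C J (obj_map A S) (var j)) (h S) = comp_at T C S k" if "S \<in> \<J>" for S
    by metis
  obtain \<alpha> where \<alpha>: "gm Al \<alpha>" "gdom \<alpha> = gdom k" "gcod \<alpha> = alg_cot C J A" "gctx \<alpha> = N" "\<And>S. S \<in> \<J> \<Longrightarrow> comp_at T C S \<alpha> = h S"
  \<comment> \<open>\<open>{j}\<close> is the set of names to avoid: \<open>k\<close> depends on
    \<open>j\<close>, whereas the lifts \<open>h S\<close> do not.\<close>
  proof (rule Al_ex[of "gdom k" "alg_cot C J A" N "{j}" h])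
    fix t assume t: "gm T t" "gctx t \<inter> N = {}" "N \<inter> gctx t = {}" "gctx t \<inter> {j} = {}"
    note [simp] = gm_simps[OF t(1), simplified]
    have [simp]: "gctx k \<inter> gctx t = {}" "j \<notin> gctx t" using t * by auto
    note hS = h[of "gdom t", simplified] and hR = h[of "gcod t", simplified]
    let ?c = "\<lambda>S. cu C J (obj_map A S) (var j)"
    show "gcomp C (h (gcod t)) (gmap (gdom k) t) = gcomp C (gmap (alg_cot C J A) t) (h (gdom t))"
    proof (rule designated_ext[where e = "var j" and X = "obj_map A (gcod t)" and J = J])
      have "gcomp C (?c (gcod t)) (gcomp C (h (gcod t)) (gmap (gdom k) t)) = gcomp C (gcomp C (?c (gcod t)) (h (gcod t))) (gmap (gdom k) t)"
        using hR t * by (intro gassoc[symmetric]) auto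
      also have "\<dots> = gcomp C (gmap A t) (comp_at T C (gdom t) k)"
        using hk[of "gcod t"] comp_at_natural[of k t "gdom k" A "gdom t" "gcod t"] t * by simp
      also have "\<dots> = gcomp C (gmap A t) (gcomp C (?c (gdom t)) (h (gdom t)))"
        using hk[of "gdom t"] by simp
      also have "\<dots> = gcomp C (gcomp C (gmap A t) (?c (gdom t))) (h (gdom t))"
        using hS t * by (intro gassoc[symmetric]) auto
      also have "\<dots> = gcomp C (gcomp C (?c (gcod t)) (gmap (alg_cot C J A) t)) (h (gdom t))"
        using t * by (simp add: gmap_alg_cot cot_fun_natural)
      also have "\<dots> = gcomp C (?c (gcod t)) (gcomp C (gmap (alg_cot C J A) t) (h (gdom t)))"
        using hS t * by (intro gassoc) auto
      finally show "gcomp C (?c (gcod t)) (gcomp C (h (gcod t)) (gmap (gdom k) t))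
        = gcomp C (?c (gcod t)) (gcomp C (gmap (alg_cot C J A) t) (h (gdom t)))" .
    qed (use hS hR t * in \<open>auto simp: Un_commute\<close>)
  qed (use * h in auto)
  have "gcomp Al (cu Al J A (var j)) \<alpha> = k"
    by (rule Al_ext) (use * \<alpha> hk in \<open>auto simp: gm_cu_Al\<close>)
  then show "\<exists>h. gm Al h \<and> gdom h = gdom k \<and> gcod h = cotensor_ob Al J A \<and> gctx h = N \<and>
      gcomp Al (Gm (cotensor_ob Al J A) A (counit Al J A \<odot> var j)) h = k"
    using \<alpha> by (intro exI[of _ \<alpha>]) (simp add: cu_def)
next
  fix h h' j assume *: "gm Al h" "gm Al h'" "gdom h' = gdom h" "gcod h = cotensor_ob Al J A" "gcod h' = cotensor_ob Al J A"
    "gctx h' = gctx h" "fst j = J" "j \<notin> gctx h"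
    and eq: "gcomp Al (Gm (cotensor_ob Al J A) A (counit Al J A \<odot> var j)) h = gcomp Al (Gm (cotensor_ob Al J A) A (counit Al J A \<odot> var j)) h'"
  have e: "gcomp Al (cu Al J A (var j)) h = gcomp Al (cu Al J A (var j)) h'" using eq by (simp add: cu_def)
  show "h = h'"
  proof (rule Al_ext)
    fix S assume S [simp]: "S \<in> \<J>"
    have "comp_at T C S (gcomp Al (cu Al J A (var j)) h) = comp_at T C S (gcomp Al (cu Al J A (var j)) h')" by (simp only: e)
    then have "gcomp C (cu C J (obj_map A S) (var j)) (comp_at T C S h) = gcomp C (cu C J (obj_map A S) (var j)) (comp_at T C S h')"
      using * by (simp add: gm_cu_Al)
    then show "comp_at T C S h = comp_at T C S h'"
      by - (rule designated_ext[where e = "var j" and X = "obj_map A S" and J = J]; use * in simp)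
  qed (use * in auto)
qed auto

end

end

end

section \<open>Commutants\<close>

context system_of_arities
begin

context
  fixes T :: "('o, 'm) jtheory" and C :: "('c, 'o, 'm) cotensored_vcat" and A
  assumes adm: "admissible C" and th: "is_theory T" and A: "is_talg T C A"
begin

abbreviation "CT \<equiv> commutant_theory C (T, A)"
abbreviation "CA \<equiv> snd (commutant C (T, A))"

lemma commutant_eq: "commutant C (T, A) = (CT, CA)"
  by (simp add: commutant_def)

lemma CT_simps [simp]:
  "Ob CT = \<J>" "Hom CT J K = alg_hom T C (alg_cot C J A) (alg_cot C K A)"
  "Comp CT J K L = Comp (Alg_vcat T C) (alg_cot C J A) (alg_cot C K A) (alg_cot C L A)"
  "Ide CT J = Ide (Alg_vcat T C) (alg_cot C J A)"
  by (simp_all add: commutant_theory_def)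

lemma CT_str: "obj_map (str CT) J = J" "hom_map (str CT) = cot_comap (Alg_vcat T C) A"
  by (simp_all add: commutant_theory_def)

lemma CA_simps: "obj_map CA J = cotensor_ob C J (obj_map A \<I>)"
  "hom_map CA J K = alg_proj T C (alg_cot C J A) (alg_cot C K A) \<I>"
  by (simp_all add: commutant_def alg_carrier_def)

lemmas A_simps [simp] = alg_context_simps[OF adm th] talg_simps[OF adm th A] talg_cot[OF adm th _ A] A
  designated_Al[OF adm th _ A, unfolded Alg_simps] is_vcat_Al[OF adm th] Al_typed[OF adm th] arities_unit

text \<open>The objects of \<open>CT\<close> are labels \<open>J\<close> for the algebras
  \<open>[J,A]\<close>; up to this relabelling its graded morphisms are homomorphisms. Different
  labels may denote the same algebra, which is why \<open>incl_inject\<close> also asks for equal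
  ends.\<close>

definition incl :: "('o, 'o, 'm) gmor \<Rightarrow> (('o, 'c, 'm) vfun, 'o, 'm) gmor" where
  "incl f = Gm (alg_cot C (gdom f) A) (alg_cot C (gcod f) A) (gel f)"

lemma incl_simps [simp]:
  "gdom (incl f) = alg_cot C (gdom f) A" "gcod (incl f) = alg_cot C (gcod f) A" "gctx (incl f) = gctx f"
  "incl (gcomp CT g f) = gcomp (Alg_vcat T C) (incl g) (incl f)" "incl (gid CT J) = gid (Alg_vcat T C) (alg_cot C J A)"
  by (simp_all add: incl_def gcomp_def gid_def)

lemma gm_incl [simp]: "gm CT f \<Longrightarrow> gm (Alg_vcat T C) (incl f)"
  by (simp add: gm_def) (simp add: incl_def)

lemma incl_inject: "incl f = incl g \<Longrightarrow> gdom f = gdom g \<Longrightarrow> gcod f = gcod g \<Longrightarrow> f = g"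
  by (simp add: incl_def gmor.expand)

lemma CT_ext:
  assumes "gm CT f" "gm CT g" "gdom g = gdom f" "gcod g = gcod f" "gctx g = gctx f"
    "\<And>S. S \<in> \<J> \<Longrightarrow> comp_at T C S (incl f) = comp_at T C S (incl g)"
  shows "f = g"
  by (rule incl_inject[OF Al_ext[OF adm th]]) (use assms in auto)

lemma CT_typed [simp]: "vcat_typed CT"
  using Al_typed[OF adm th] unfolding vcat_typed_def by simp

lemma is_vcat_CT [simp]: "is_vcat CT"
proof (rule is_vcatI)
  fix f g h assume *: "gm CT f" "gm CT g" "gm CT h" "gcod f = gdom g" "gcod g = gdom h"
    "gctx h \<inter> gctx g = {}" "gctx g \<inter> gctx f = {}" "gctx h \<inter> gctx f = {}"
  show "gcomp CT (gcomp CT h g) f = gcomp CT h (gcomp CT g f)"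
    by (rule incl_inject) (use * in auto)
next
  fix f assume *: "gm CT f"
  show "gcomp CT (gid CT (gcod f)) f = f" by (rule incl_inject) (use * in auto)
  show "gcomp CT f (gid CT (gdom f)) = f" by (rule incl_inject) (use * in auto)
qed auto

lemma comap_Al:
  "is_vfun arities_op (Alg_vcat T C) (comap_fun (Alg_vcat T C) A)"
  "preserves_cotensors arities_op (Alg_vcat T C) (comap_fun (Alg_vcat T C) A)"
  by (rule is_vfun_comap_fun comap_fun_preserves; simp)+

lemmas comap_Al_typed = is_vfun_typed[OF comap_Al(1)]

lemma incl_str [simp]: "incl (gmap (str CT) f) = gmap (comap_fun (Alg_vcat T C) A) f"
  by (simp add: incl_def gmap_def CT_str comap_fun_def)

lemma str_typed: "vfun_typed arities_op CT (str CT)"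
  using comap_Al_typed by (simp add: vfun_typed_def CT_str comap_fun_def)

lemma is_vfun_str: "is_vfun arities_op CT (str CT)"
proof (rule is_vfunI)
  show "gmap (str CT) (gcomp arities_op g f) = gcomp CT (gmap (str CT) g) (gmap (str CT) f)"
    if "gm arities_op f" "gm arities_op g" "gcod f = gdom g" "gctx g \<inter> gctx f = {}" for f g
    by (rule incl_inject) (use that in \<open>auto simp: gmap_gcomp[OF comap_Al(1)]\<close>)
  show "gmap (str CT) (gid arities_op J) = gid CT (obj_map (str CT) J)" if "J \<in> Ob arities_op" for J
    by (rule incl_inject) (use that in \<open>auto simp: gmap_gid[OF comap_Al(1)] CT_str\<close>)
qed (auto simp: str_typed)

text \<open>Hom-objects and composition are those of the category of algebras, so the comparison
  maps are literally the same ones, tested at fewer objects.\<close>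

lemma CT_cotensor:
  assumes "is_cotensor (Alg_vcat T C) J (alg_cot C K A) (alg_cot C D A) c" "D \<in> \<J>"
  shows "is_cotensor CT J K D c"
  using assms unfolding is_cotensor_def cotensor_comparison_def by simp

lemma preserves_str: "preserves_cotensors arities_op CT (str CT)"
  using comap_Al(2) unfolding preserves_cotensors_def
  by (auto simp: CT_str comap_fun_def is_cotensor_def[of arities_op] intro!: CT_cotensor)

lemma is_theory_CT: "is_theory CT"
  by (simp add: is_theory_def is_vfun_str preserves_str CT_str)

text \<open>Compose with the projection at a fresh index: components of projections of algebras are
  projections in \<open>C\<close>, and \<open>[f,-]\<close> reindexes them in the same way on both
  levels.\<close>

lemma comp_at_comap:
  assumes f: "gm arities_op f" and S [simp]: "S \<in> \<J>"
  shows "comp_at T C S (gmap (comap_fun (Alg_vcat T C) A) f) = gmap (comap_fun C (obj_map A S)) f"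
proof -
  note [simp] = gm_simps[OF f, simplified]
  obtain x where x [simp]: "fst x = gcod f" "x \<notin> gctx f"
    using fresh_name[of "gctx f"] f by (metis gm_vctx vctx_finite)
  let ?F = "gmap (comap_fun (Alg_vcat T C) A)" and ?G = "gmap (comap_fun C (obj_map A S))"
  have g: "gm (Alg_vcat T C) (?F f)" "gm C (?G f)"
    using f by (auto intro!: gm_comap_fun)
  have "gcomp C (cu C (gcod f) (obj_map A S) (var x)) (comp_at T C S (?F f))
     = comp_at T C S (gcomp (Alg_vcat T C) (cu (Alg_vcat T C) (gcod f) A (var x)) (?F f))"
    using g by (simp add: comp_at_gcomp[OF adm th] comp_at_cu[OF adm th _ A] gm_cu_Al[OF adm th _ A])
  also have "\<dots> = comp_at T C S (cu (Alg_vcat T C) (gdom f) A (gev f (var x)))"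
    using f by (subst comap_fun_natural) auto
  also have "\<dots> = cu C (gdom f) (obj_map A S) (gev f (var x))"
    using f by (simp add: comp_at_cu[OF adm th _ A])
  also have "\<dots> = gcomp C (cu C (gcod f) (obj_map A S) (var x)) (?G f)"
    using f by (subst comap_fun_natural) auto
  finally show ?thesis
    by (intro designated_ext[where e = "var x" and J = "gcod f" and X = "obj_map A S",
          OF _ _ _ gm_comp_at[OF adm th g(1) S] g(2)]) auto
qed

lemma gmap_CA: "gmap CA f = comp_at T C \<I> (incl f)"
  by (simp add: gmap_def CA_simps incl_def evalf_def)

lemma CA_typed [simp]: "vfun_typed CT C CA"
  using alg_proj_arr[OF adm th talg_cot[OF adm th _ A] talg_cot[OF adm th _ A]] by (simp add: vfun_typed_def CA_simps)

lemma is_vfun_CA: "is_vfun CT C CA"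
proof (rule is_vfunI)
  show "gmap CA (gcomp CT g f) = gcomp C (gmap CA g) (gmap CA f)"
    if "gm CT f" "gm CT g" "gcod f = gdom g" "gctx g \<inter> gctx f = {}" for f g
    unfolding gmap_CA using that by (simp add: comp_at_gcomp[OF adm th])
  show "gmap CA (gid CT J) = gid C (obj_map CA J)" if "J \<in> Ob CT" for J
    unfolding gmap_CA using that by (simp add: comp_at_gid[OF adm th] CA_simps)
qed auto

text \<open>The commutant algebra restricted along its structure functor is \<open>[-,|A|]\<close>;
  preservation of cotensors by \<open>CA\<close> is thereby reduced to
  \<open>comap_fun_tensor\<close>.\<close>

lemma evaluate_comap:
  assumes [simp]: "J \<in> \<J>" "K \<in> \<J>"
  shows "hom_map CA J K \<cdot> cot_comap (Alg_vcat T C) A J K = cot_comap C (obj_map A \<I>) J K"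
proof -
  let ?F = "comap_fun (Alg_vcat T C) A" and ?G = "comap_fun C (obj_map A \<I>)"
  have t: "vfun_typed arities_op C (vfun_comp (evalf T C \<I>) ?F)" "vfun_typed arities_op C ?G"
    using vfun_typed_comp[OF comap_Al_typed evalf_typed[OF adm th]] comap_fun_typed[of C "obj_map A \<I>"] by auto
  have "hom_map (vfun_comp (evalf T C \<I>) ?F) J K = hom_map ?G J K"
    by (rule gmap_ext[OF t])
      (auto simp: gmap_vfun_comp[OF comap_Al_typed evalf_typed[OF adm th]] comp_at_comap)
  then show ?thesis by (simp add: vfun_comp_def evalf_def comap_fun_def CA_simps)
qed

lemma is_talg_CA: "is_talg CT C CA"
  unfolding is_talg_def
proof
  show "preserves_cotensors CT C CA"
    unfolding preserves_cotensors_def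
  proof (intro ballI allI impI)
    fix J K D c assume J [simp]: "J \<in> \<J>" and "K \<in> Ob CT" and c: "is_cotensor CT J K D c"
    then have K [simp]: "K \<in> \<J>" and JK [simp]: "J \<otimes> K \<in> \<J>" using arities_tensor by auto
    let ?b = "curry_arr J K (J \<otimes> K) (\<one> (J \<otimes> K))"
    have "is_cotensor arities_op J K (J \<otimes> K) ?b"
      by (rule arities_op_cotensor) (auto intro: is_iso_idt)
    then have B: "is_cotensor CT J K (J \<otimes> K) (cot_comap (Alg_vcat T C) A (J \<otimes> K) K \<cdot> ?b)"
      using preserves_str by (auto simp: preserves_cotensors_def CT_str)
    have "hom_map CA (J \<otimes> K) K \<cdot> cot_comap (Alg_vcat T C) A (J \<otimes> K) K \<cdot> ?b = cot_comap C (obj_map A \<I>) (J \<otimes> K) K \<cdot> ?b"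
      using arrowsD[OF cot_comap_arr[of "Alg_vcat T C" A "J \<otimes> K" K]] vfun_simps[OF CA_typed, of "J \<otimes> K"]
      by (simp flip: evaluate_comap)
    then have "is_cotensor C J (obj_map CA K) (obj_map CA (J \<otimes> K)) (hom_map CA (J \<otimes> K) K \<cdot> cot_comap (Alg_vcat T C) A (J \<otimes> K) K \<cdot> ?b)"
      using comap_fun_tensor[of C "obj_map A \<I>" J K] by (simp add: CA_simps)
    then show "is_cotensor C J (obj_map CA K) (obj_map CA D) (hom_map CA D K \<cdot> c)"
      by - (rule cotensor_transfer[OF _ _ is_vfun_CA _ _ B _ c]; simp)
  qed
qed (rule is_vfun_CA)

lemma is_algebra_commutant: "is_algebra C (commutant C (T, A))"
  by (subst commutant_eq) (simp add: is_algebra_def is_theory_CT is_talg_CA)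

text \<open>Depends on the convention that the designated \<open>[\<I>,X]\<close> is
  \<open>X\<close> itself.\<close>

lemma carrier_commutant: "alg_carrier (commutant C (T, A)) = alg_carrier (T, A)"
  using admissible_simps(3)[OF adm, of "obj_map A \<I>"] by (simp add: commutant_def alg_carrier_def)

end

section \<open>The preorder of algebras on an object\<close>

text \<open>Naturality of the inverses follows from that of \<open>f\<close> (\<open>nat'\<close>),
  so inverses have to be supplied pointwise only.\<close>

lemma vnat_isoI:
  assumes [simp]: "is_vcat B" "is_vcat C" and F: "is_vfun B C F" and G: "is_vfun B C G"
    and f: "\<And>X. X \<in> Ob B \<Longrightarrow> gm C (f X) \<and> gdom (f X) = obj_map F X \<and> gcod (f X) = obj_map G X \<and> gctx (f X) = {}"
    and g: "\<And>X. X \<in> Ob B \<Longrightarrow> gm C (g X) \<and> gdom (g X) = obj_map G X \<and> gcod (g X) = obj_map F X \<and> gctx (g X) = {}"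
    and inv: "\<And>X. X \<in> Ob B \<Longrightarrow> gcomp C (g X) (f X) = gid C (obj_map F X)" "\<And>X. X \<in> Ob B \<Longrightarrow> gcomp C (f X) (g X) = gid C (obj_map G X)"
    and nat: "\<And>u. gm B u \<Longrightarrow> gcomp C (f (gcod u)) (gmap F u) = gcomp C (gmap G u) (f (gdom u))"
  shows "is_vnat_iso B C F G (\<lambda>X. arr (gel (f X)))"
proof -
  note [simp] = vfun_simps[OF is_vfun_typed[OF F]] vfun_simps[OF is_vfun_typed[OF G]]
    gm_gmap[OF is_vfun_typed[OF F]] gm_gmap[OF is_vfun_typed[OF G]]
  have f_eq: "Gm (obj_map F X) (obj_map G X) (El {} (arr (gel (f X)))) = f X" and
    f_arr: "arr (gel (f X)) \<in> \<V> \<I> (Hom C (obj_map F X) (obj_map G X))" if "X \<in> Ob B" for X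
    using f[OF that] app_generic(1)[of "gel (f X)"] gm_simps[of C "f X"] by (auto intro!: gmor.expand elem.expand)
  have g_eq: "Gm (obj_map G X) (obj_map F X) (El {} (arr (gel (g X)))) = g X" and
    g_arr: "arr (gel (g X)) \<in> \<V> \<I> (Hom C (obj_map G X) (obj_map F X))" if "X \<in> Ob B" for X
    using g[OF that] app_generic(1)[of "gel (g X)"] gm_simps[of C "g X"] by (auto intro!: gmor.expand elem.expand)
  have nat': "gcomp C (g (gcod u)) (gmap G u) = gcomp C (gmap F u) (g (gdom u))" if u: "gm B u" for u
  proof -
    note uu [simp] = gm_simps[OF u] u
    note s [simp] = f[OF uu(1)] f[OF uu(2)] g[OF uu(1)] g[OF uu(2)]
    have "gcomp C (g (gcod u)) (gmap G u) = gcomp C (g (gcod u)) (gcomp C (gmap G u) (gcomp C (f (gdom u)) (g (gdom u))))"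
      by (simp add: inv)
    also have "\<dots> = gcomp C (g (gcod u)) (gcomp C (gcomp C (gmap G u) (f (gdom u))) (g (gdom u)))"
      by simp
    also have "\<dots> = gcomp C (gcomp C (g (gcod u)) (f (gcod u))) (gcomp C (gmap F u) (g (gdom u)))"
      by (simp flip: nat)
    also have "\<dots> = gcomp C (gmap F u) (g (gdom u))" by (simp add: inv)
    finally show ?thesis .
  qed
  have "is_vnat B C F G (\<lambda>X. arr (gel (f X)))" "is_vnat B C G F (\<lambda>X. arr (gel (g X)))"
    using F G f_arr g_arr nat nat' by (auto simp: is_vnat_iff is_vfun_typed f_eq g_eq gm_simps)
  moreover have "ucomp C (obj_map F X) (obj_map G X) (obj_map F X) (arr (gel (g X))) (arr (gel (f X))) = Ide C (obj_map F X)"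
    "ucomp C (obj_map G X) (obj_map F X) (obj_map G X) (arr (gel (f X))) (arr (gel (g X))) = Ide C (obj_map G X)"
    if "X \<in> Ob B" for X
    using that f_arr g_arr inv by (simp_all add: ucomp_iff f_eq g_eq)
  ultimately show ?thesis unfolding is_vnat_iso_def by (intro conjI exI[of _ "\<lambda>X. arr (gel (g X))"]) auto
qed

lemma vnat_isoD:
  assumes iso: "is_vnat_iso B C F G t" and [simp]: "is_vcat B" "is_vcat C" and F: "is_vfun B C F" and G: "is_vfun B C G"
    and f_def: "f = (\<lambda>X. Gm (obj_map F X) (obj_map G X) (El {} (t X)))"
  obtains g where
    "\<And>X. X \<in> Ob B \<Longrightarrow> gm C (f X) \<and> gdom (f X) = obj_map F X \<and> gcod (f X) = obj_map G X \<and> gctx (f X) = {}"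
    "\<And>X. X \<in> Ob B \<Longrightarrow> gm C (g X) \<and> gdom (g X) = obj_map G X \<and> gcod (g X) = obj_map F X \<and> gctx (g X) = {}"
    "\<And>X. X \<in> Ob B \<Longrightarrow> gcomp C (g X) (f X) = gid C (obj_map F X)" "\<And>X. X \<in> Ob B \<Longrightarrow> gcomp C (f X) (g X) = gid C (obj_map G X)"
    "\<And>u. gm B u \<Longrightarrow> gcomp C (f (gcod u)) (gmap F u) = gcomp C (gmap G u) (f (gdom u))"
    "\<And>u. gm B u \<Longrightarrow> gcomp C (g (gcod u)) (gmap G u) = gcomp C (gmap F u) (g (gdom u))"
proof -
  note [simp] = vfun_simps[OF is_vfun_typed[OF F]] vfun_simps[OF is_vfun_typed[OF G]]
  obtain u where t: "is_vnat B C F G t" and u: "is_vnat B C G F u"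
    and inv: "\<forall>X \<in> Ob B. ucomp C (obj_map F X) (obj_map G X) (obj_map F X) (u X) (t X) = Ide C (obj_map F X) \<and>
          ucomp C (obj_map G X) (obj_map F X) (obj_map G X) (t X) (u X) = Ide C (obj_map G X)"
    using iso unfolding is_vnat_iso_def by auto
  have t_arr: "t X \<in> \<V> \<I> (Hom C (obj_map F X) (obj_map G X))" and u_arr: "u X \<in> \<V> \<I> (Hom C (obj_map G X) (obj_map F X))"
    if "X \<in> Ob B" for X using t u that by (auto simp: is_vnat_def)
  have el: "elem (El {} a)" "ty (El {} a) = E" if "a \<in> \<V> \<I> E" for a E
    using arrowsD[OF that] by (auto simp: elem_def ty_def)
  show ?thesis
    by (rule that[of "\<lambda>X. Gm (obj_map G X) (obj_map F X) (El {} (u X))"])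
      (use t u F G inv t_arr u_arr el[OF t_arr] el[OF u_arr] in \<open>auto simp: f_def is_vnat_iff is_vfun_typed ucomp_iff\<close>)
qed

definition alg_le :: "('c, 'o, 'm, 'z) cotensored_vcat_scheme \<Rightarrow> 'c \<Rightarrow> ('c, 'o, 'm) alg \<Rightarrow> ('c, 'o, 'm) alg \<Rightarrow> bool" where
  "alg_le C X A B \<longleftrightarrow> (\<exists>m. is_Alg_morphism C X A B m)"

lemma alg_le_iff:
  "alg_le C X (T, A) (U, B) \<longleftrightarrow> is_theory T \<and> is_talg T C A \<and> obj_map A \<I> = X \<and> is_theory U \<and> is_talg U C B \<and> obj_map B \<I> = X
     \<and> (\<exists>M f. is_theory_morphism T U M \<and> is_vnat_iso T C A (vfun_comp B M) f \<and> f \<I> = Ide C X)"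
  by (auto simp: alg_le_def is_Alg_morphism_def is_algebra_def alg_carrier_def)

lemma theory_morphism_simps:
  assumes "is_theory_morphism T U M" "is_theory T" "is_theory U"
  shows "is_vfun T U M" "J \<in> \<J> \<Longrightarrow> obj_map M J = J"
    "gm arities_op x \<Longrightarrow> gmap M (gmap (str T) x) = gmap (str U) x"
proof -
  show M: "is_vfun T U M" using assms by (simp add: is_theory_morphism_def)
  note T = theory_simps[OF assms(2)] and U = theory_simps[OF assms(3)]
  have eq: "vfun_eq arities_op (vfun_comp M (str T)) (str U)" using assms by (simp add: is_theory_morphism_def)
  show "obj_map M J = J" if "J \<in> \<J>"
    using eq that T(4) U(4) by (auto simp: vfun_eq_def vfun_comp_def)
  show "gmap M (gmap (str T) x) = gmap (str U) x" if x: "gm arities_op x"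
  proof -
    have "gmap M (gmap (str T) x) = gmap (vfun_comp M (str T)) x"
      by (rule gmap_vfun_comp[OF is_vfun_typed[OF T(3)] is_vfun_typed[OF M] x, symmetric])
    also have "\<dots> = gmap (str U) x" using eq gm_simps[OF x] by (simp add: gmap_def vfun_eq_def)
    finally show ?thesis .
  qed
qed

lemma theory_morphismI:
  assumes M: "is_vfun T U M" and T: "is_theory T" and U: "is_theory U" and ob: "\<And>J. J \<in> \<J> \<Longrightarrow> obj_map M J = J"
    and str: "\<And>x. gm arities_op x \<Longrightarrow> gmap M (gmap (str T) x) = gmap (str U) x"
  shows "is_theory_morphism T U M"
proof -
  note Ts = theory_simps[OF T] and Us = theory_simps[OF U]
  note t = is_vfun_typed[OF Ts(3)] is_vfun_typed[OF M]
  have "hom_map (vfun_comp M (str T)) J K = hom_map (str U) J K" if "J \<in> \<J>" "K \<in> \<J>" for J K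
    by (rule gmap_ext[OF vfun_typed_comp[OF t] is_vfun_typed[OF Us(3)]])
      (use that str in \<open>auto simp: gmap_vfun_comp[OF t]\<close>)
  then show ?thesis using M ob Ts(4) Us(4)
    by (auto simp: is_theory_morphism_def vfun_eq_def) (simp add: vfun_comp_def)
qed

lemma alg_le_refl:
  assumes C: "admissible C" and T: "is_theory T" and A: "is_talg T C A"
  shows "alg_le C (obj_map A \<I>) (T, A) (T, A)"
proof -
  let ?M = "\<lparr>obj_map = (\<lambda>J. J), hom_map = (\<lambda>J K. \<one> (Hom T J K))\<rparr>"
  note [simp] = theory_simps[OF T] admissible_simps(1)[OF C] arities_unit
  have t: "vfun_typed T T ?M" by (auto simp: vfun_typed_def idt_arr)
  have M: "gmap ?M f = f" if "gm T f" for f using gm_simps[OF that] by (simp add: gmap_def)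
  have Mf: "is_vfun T T ?M" by (rule is_vfunI) (auto simp: t M)
  have tm: "is_theory_morphism T T ?M"
    by (rule theory_morphismI) (use T Mf gm_gmap[OF is_vfun_typed[OF theory_simps(3)[OF T]]] in \<open>auto simp: M\<close>)
  have Af: "is_vfun T C A" using A by (simp add: is_talg_def)
  note [simp] = vfun_simps[OF is_vfun_typed[OF Af]] gm_gmap[OF is_vfun_typed[OF Af]]
  have AM: "is_vfun T C (vfun_comp A ?M)" by (rule is_vfun_comp[OF Mf Af]) auto
  have oAM: "obj_map (vfun_comp A ?M) J = obj_map A J" for J by (simp add: vfun_comp_def)
  have "is_vnat_iso T C A (vfun_comp A ?M) (\<lambda>X. arr (gel (gid C (obj_map A X))))"
  proof (rule vnat_isoI[OF _ _ Af AM, where g = "\<lambda>X. gid C (obj_map A X)"])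
    fix u assume u: "gm T u"
    note g = gm_simps[OF u]
    show "gcomp C (gid C (obj_map A (gcod u))) (gmap A u) = gcomp C (gmap (vfun_comp A ?M) u) (gid C (obj_map A (gdom u)))"
      using g u by (simp add: gmap_vfun_comp[OF t is_vfun_typed[OF Af]] M)
  qed (auto simp: oAM)
  moreover have "arr (gel (gid C (obj_map A \<I>))) = Ide C (obj_map A \<I>)" by (simp add: gid_def app_def unit_elem_def)
  ultimately show ?thesis using T A tm unfolding alg_le_iff by auto
qed

text \<open>Theory morphisms are the identity on objects, so the isomorphism for the composite is
  \<open>g J\<close> after \<open>f J\<close>; at \<open>\<I>\<close> both are identities.\<close>

lemma alg_le_trans:
  fixes C :: "('c, 'o, 'm, 'z) cotensored_vcat_scheme"
  assumes C: "admissible C" and AB: "alg_le C X (T, A) (U, B)" and BD: "alg_le C X (U, B) (W, D)"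
  shows "alg_le C X (T, A) (W, D)"
proof -
  obtain M f where T: "is_theory T" and A: "is_talg T C A" and X: "obj_map A \<I> = X" and U: "is_theory U" and B: "is_talg U C B" "obj_map B \<I> = X"
    and M: "is_theory_morphism T U M" and f: "is_vnat_iso T C A (vfun_comp B M) f" "f \<I> = Ide C X"
    using AB unfolding alg_le_iff by auto
  obtain N g where W: "is_theory W" and D: "is_talg W C D" "obj_map D \<I> = X"
    and N: "is_theory_morphism U W N" and g: "is_vnat_iso U C B (vfun_comp D N) g" "g \<I> = Ide C X"
    using BD unfolding alg_le_iff by auto
  note [simp] = theory_simps(1,2)[OF T] theory_simps(1,2)[OF U] theory_simps(1,2)[OF W] admissible_simps(1)[OF C] arities_unit
  note Ms = theory_morphism_simps[OF M T U] and Ns = theory_morphism_simps[OF N U W]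
  note Mt = is_vfun_typed[OF Ms(1)] and Nt = is_vfun_typed[OF Ns(1)]
  have Af: "is_vfun T C A" and Bf: "is_vfun U C B" and Df: "is_vfun W C D" using A B D by (auto simp: is_talg_def)
  note At = is_vfun_typed[OF Af] and Bt = is_vfun_typed[OF Bf] and Dt = is_vfun_typed[OF Df]
  have BM: "is_vfun T C (vfun_comp B M)" by (rule is_vfun_comp[OF Ms(1) Bf]) auto
  have DN: "is_vfun U C (vfun_comp D N)" by (rule is_vfun_comp[OF Ns(1) Df]) auto
  have NM: "is_vfun T W (vfun_comp N M)" by (rule is_vfun_comp[OF Ms(1) Ns(1)]) auto
  have DNM: "is_vfun T C (vfun_comp D (vfun_comp N M))" by (rule is_vfun_comp[OF NM Df]) auto
  define ff :: "'o \<Rightarrow> ('c, 'o, 'm) gmor" where "ff = (\<lambda>J. Gm (obj_map A J) (obj_map (vfun_comp B M) J) (El {} (f J)))"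
  obtain fi where fs:
    "\<And>J. J \<in> Ob T \<Longrightarrow> gm C (ff J) \<and> gdom (ff J) = obj_map A J \<and> gcod (ff J) = obj_map (vfun_comp B M) J \<and> gctx (ff J) = {}"
    "\<And>J. J \<in> Ob T \<Longrightarrow> gm C (fi J) \<and> gdom (fi J) = obj_map (vfun_comp B M) J \<and> gcod (fi J) = obj_map A J \<and> gctx (fi J) = {}"
    "\<And>J. J \<in> Ob T \<Longrightarrow> gcomp C (fi J) (ff J) = gid C (obj_map A J)"
    "\<And>J. J \<in> Ob T \<Longrightarrow> gcomp C (ff J) (fi J) = gid C (obj_map (vfun_comp B M) J)"
    "\<And>u. gm T u \<Longrightarrow> gcomp C (ff (gcod u)) (gmap A u) = gcomp C (gmap (vfun_comp B M) u) (ff (gdom u))"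
    by (rule vnat_isoD[OF f(1) _ _ Af BM ff_def]) auto
  define gg :: "'o \<Rightarrow> ('c, 'o, 'm) gmor" where "gg = (\<lambda>J. Gm (obj_map B J) (obj_map (vfun_comp D N) J) (El {} (g J)))"
  obtain gi where gs:
    "\<And>J. J \<in> Ob U \<Longrightarrow> gm C (gg J) \<and> gdom (gg J) = obj_map B J \<and> gcod (gg J) = obj_map (vfun_comp D N) J \<and> gctx (gg J) = {}"
    "\<And>J. J \<in> Ob U \<Longrightarrow> gm C (gi J) \<and> gdom (gi J) = obj_map (vfun_comp D N) J \<and> gcod (gi J) = obj_map B J \<and> gctx (gi J) = {}"
    "\<And>J. J \<in> Ob U \<Longrightarrow> gcomp C (gi J) (gg J) = gid C (obj_map B J)"
    "\<And>J. J \<in> Ob U \<Longrightarrow> gcomp C (gg J) (gi J) = gid C (obj_map (vfun_comp D N) J)"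
    "\<And>u. gm U u \<Longrightarrow> gcomp C (gg (gcod u)) (gmap B u) = gcomp C (gmap (vfun_comp D N) u) (gg (gdom u))"
    by (rule vnat_isoD[OF g(1) _ _ Bf DN gg_def]) auto
  have ob [simp]: "obj_map (vfun_comp B M) J = obj_map B J" "obj_map (vfun_comp D N) J = obj_map D J"
    "obj_map (vfun_comp D (vfun_comp N M)) J = obj_map D J" "obj_map (vfun_comp N M) J = J" "obj_map M J = J" if "J \<in> \<J>" for J
    using that Ms(2) Ns(2) by (auto simp: vfun_comp_def)
  note [simp] = vfun_simps(1)[OF At] vfun_simps(1)[OF Bt] vfun_simps(1)[OF Dt]
  have tm: "is_theory_morphism T W (vfun_comp N M)"
  proof (rule theory_morphismI[OF NM T W])
    fix x assume x: "gm arities_op x"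
    have "gmap (vfun_comp N M) (gmap (str T) x) = gmap N (gmap M (gmap (str T) x))"
      by (rule gmap_vfun_comp[OF Mt Nt gm_gmap[OF is_vfun_typed[OF theory_simps(3)[OF T]] x]])
    then show "gmap (vfun_comp N M) (gmap (str T) x) = gmap (str W) x" using Ms(3) Ns(3) x by simp
  qed simp
  let ?h = "\<lambda>J. gcomp C (gg J) (ff J)" and ?k = "\<lambda>J. gcomp C (fi J) (gi J)"
  have "is_vnat_iso T C A (vfun_comp D (vfun_comp N M)) (\<lambda>J. arr (gel (?h J)))"
  proof (rule vnat_isoI[OF _ _ Af DNM, where g = ?k])
    fix J assume "J \<in> Ob T"
    then have J [simp]: "J \<in> \<J>" by simp
    note s [simp] = fs(1,2)[of J, simplified] gs(1,2)[of J, simplified]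
    show "gm C (?h J) \<and> gdom (?h J) = obj_map A J \<and> gcod (?h J) = obj_map (vfun_comp D (vfun_comp N M)) J \<and> gctx (?h J) = {}"
      by simp
    show "gm C (?k J) \<and> gdom (?k J) = obj_map (vfun_comp D (vfun_comp N M)) J \<and> gcod (?k J) = obj_map A J \<and> gctx (?k J) = {}"
      by simp
    have "gcomp C (?k J) (?h J) = gcomp C (fi J) (gcomp C (gcomp C (gi J) (gg J)) (ff J))" by simp
    then show "gcomp C (?k J) (?h J) = gid C (obj_map A J)" using gs(3)[of J] fs(3)[of J] by simp
    have "gcomp C (?h J) (?k J) = gcomp C (gg J) (gcomp C (gcomp C (ff J) (fi J)) (gi J))" by simp
    then show "gcomp C (?h J) (?k J) = gid C (obj_map (vfun_comp D (vfun_comp N M)) J)" using gs(4)[of J] fs(4)[of J] by simp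
  next
    fix u assume u: "gm T u"
    note uu [simp] = gm_simps(1,2)[OF u, simplified]
    note s [simp] = fs(1)[of "gdom u", simplified] fs(1)[of "gcod u", simplified] gs(1)[of "gdom u", simplified] gs(1)[of "gcod u", simplified]
    have m: "gm U (gmap M u)" using gm_gmap[OF Mt u] .
    have [simp]: "gm C (gmap A u)" "gm C (gmap B (gmap M u))" "gm C (gmap D (gmap N (gmap M u)))"
      using u m gm_gmap[OF At] gm_gmap[OF Bt] gm_gmap[OF Dt] gm_gmap[OF Nt] by auto
    have e: "gmap (vfun_comp B M) u = gmap B (gmap M u)" "gmap (vfun_comp D N) (gmap M u) = gmap D (gmap N (gmap M u))"
      "gmap (vfun_comp D (vfun_comp N M)) u = gmap D (gmap N (gmap M u))"
      using u m gmap_vfun_comp[OF Mt Bt u] gmap_vfun_comp[OF Nt Dt m] gmap_vfun_comp[OF is_vfun_typed[OF NM] Dt u]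
        gmap_vfun_comp[OF Mt Nt u] by auto
    have [simp]: "obj_map N (gdom u) = gdom u" "obj_map N (gcod u) = gcod u" using Ns(2) by auto
    have "gcomp C (?h (gcod u)) (gmap A u) = gcomp C (gg (gcod u)) (gcomp C (ff (gcod u)) (gmap A u))"
      by simp
    also have "\<dots> = gcomp C (gcomp C (gg (gcod u)) (gmap B (gmap M u))) (ff (gdom u))"
      by (simp add: fs(5)[OF u] e)
    also have "\<dots> = gcomp C (gcomp C (gmap D (gmap N (gmap M u))) (gg (gdom u))) (ff (gdom u))"
      using gs(5)[OF m] by (simp add: e)
    also have "\<dots> = gcomp C (gmap (vfun_comp D (vfun_comp N M)) u) (?h (gdom u))"
      by (simp add: e)
    finally show "gcomp C (?h (gcod u)) (gmap A u) = gcomp C (gmap (vfun_comp D (vfun_comp N M)) u) (?h (gdom u))" .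
  qed auto
  moreover have "arr (gel (?h \<I>)) = Ide C X"
  proof -
    have XC: "X \<in> Ob C" using B(2) vfun_simps(1)[OF Bt, of \<I>] by simp
    then have el: "Ide C X \<in> \<V> \<I> (Hom C X X)" by (simp add: arrows_def)
    have "ff \<I> = gid C X" "gg \<I> = gid C X"
      using f(2) g(2) X B(2) D(2) app_unit[OF el] by (simp_all add: ff_def gg_def gid_def)
    then show ?thesis using XC by simp (simp add: gid_def app_def unit_elem_def)
  qed
  ultimately show ?thesis using T A X W D tm unfolding alg_le_iff by auto
qed

end

section \<open>Commutation is symmetric\<close>

context system_of_arities
begin

lemma closed_elem: "elem e \<Longrightarrow> ctx e = {} \<Longrightarrow> arr e \<in> \<V> \<I> (ty e) \<and> arr e \<odot> unit_elem = e"
  using app_generic[of e] by (simp add: generic_def unit_elem_def)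

text \<open>Composition with a closed morphism is uniform in the index: one arrow \<open>q\<close>
  serves all elements \<open>e\<close>. Data of this shape can be lifted by
  \<open>cotensor_ex_closed\<close>.\<close>

lemma whisker_left:
  assumes [simp]: "is_vcat C" and a: "gm C a" "gctx a = {}" and [simp]: "X \<in> Ob C" and h: "h \<in> \<V> E (Hom C X (gdom a))"
  obtains q where "q \<in> \<V> E (Hom C X (gcod a))"
    "\<And>e. elem e \<Longrightarrow> ty e = E \<Longrightarrow> gcomp C a (Gm X (gdom a) (h \<odot> e)) = Gm X (gcod a) (q \<odot> e)"
proof -
  note g [simp] = gm_simps[OF a(1)]
  have c: "arr (gel a) \<in> \<V> \<I> (Hom C (gdom a) (gcod a))" "arr (gel a) \<odot> unit_elem = gel a"
    using closed_elem[OF g(3) a(2)] by auto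
  note [simp] = arrowsD[OF c(1)] arrowsD[OF h] arrows_dom[OF h]
  show ?thesis
    by (rule that[of "Comp C X (gdom a) (gcod a) \<cdot> (arr (gel a) \<boxtimes> h) \<cdot> \<l>\<^sup>- E"])
      (auto simp: arrows_def gcomp_def c)
qed

lemma whisker_right:
  assumes [simp]: "is_vcat C" and b: "gm C b" "gctx b = {}" and [simp]: "Z \<in> Ob C" and h: "h \<in> \<V> E (Hom C (gcod b) Z)"
  obtains q where "q \<in> \<V> E (Hom C (gdom b) Z)"
    "\<And>e. elem e \<Longrightarrow> ty e = E \<Longrightarrow> gcomp C (Gm (gcod b) Z (h \<odot> e)) b = Gm (gdom b) Z (q \<odot> e)"
proof -
  note g [simp] = gm_simps[OF b(1)]
  have c: "arr (gel b) \<in> \<V> \<I> (Hom C (gdom b) (gcod b))" "arr (gel b) \<odot> unit_elem = gel b"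
    using closed_elem[OF g(3) b(2)] by auto
  note [simp] = arrowsD[OF c(1)] arrowsD[OF h] arrows_dom[OF h]
  show ?thesis
    by (rule that[of "Comp C (gdom b) (gcod b) Z \<cdot> (h \<boxtimes> arr (gel b)) \<cdot> \<r>\<^sup>- E"])
      (auto simp: arrows_def gcomp_def c)
qed

text \<open>The projection \<open>S \<rightarrow> \<I>\<close> of a theory indexed by an element of \<open>S\<close>.\<close>

definition projection :: "('o, 'm) jtheory \<Rightarrow> 'o \<Rightarrow> ('o, 'm) elem \<Rightarrow> ('o, 'o, 'm) gmor" where
  "projection T S e = gmap (str T) (Gm S \<I> (curry_arr S \<I> S (\<r> S) \<odot> e))"

lemma projection_simps [simp]: "gctx (projection T S e) = ctx e"
  by (simp add: projection_def)

context
  fixes T assumes th: "is_theory T"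
begin

lemma th_simps [simp]: "is_vcat T" "Ob T = \<J>" "J \<in> \<J> \<Longrightarrow> obj_map (str T) J = J" "\<I> \<in> \<J>"
  using theory_simps[OF th] arities_unit by auto

lemma gm_str [simp]: "gm arities_op x \<Longrightarrow> gm T (gmap (str T) x)"
  by (rule gm_gmap[OF is_vfun_typed[OF theory_simps(3)[OF th]]])

lemma projection_cod [simp]: "gcod (projection T S e) = \<I>" "S \<in> \<J> \<Longrightarrow> gdom (projection T S e) = S"
  by (simp_all add: projection_def)

lemma gm_projection [simp]: "S \<in> \<J> \<Longrightarrow> elem e \<Longrightarrow> ty e = S \<Longrightarrow> gm T (projection T S e)"
  by (simp add: projection_def)

lemma projection_unit: "projection T \<I> unit_elem = gid T \<I>"
proof -
  have "Gm \<I> \<I> (curry_arr \<I> \<I> \<I> (\<r> \<I>) \<odot> unit_elem) = gid arities_op \<I>"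
    by (simp add: gid_def ide_arities_op left_unitor_unit)
  then show ?thesis using gmap_gid[OF theory_simps(3)[OF th], of \<I>] by (simp add: projection_def)
qed

text \<open>Structural operations are reindexings: the identity is computed in
  \<open>arities_op\<close>, as application of \<open>x\<close> to \<open>k\<close>, and transported
  by \<open>str T\<close>.\<close>

lemma projection_str:
  assumes x: "gm arities_op x" and k: "elem k" "ty k = gcod x" "ctx k \<inter> gctx x = {}" and S: "gdom x = S" "gcod x = R"
  shows "gcomp T (projection T R k) (gmap (str T) x) = projection T S (gev x k)"
proof -
  note g [simp] = gm_simps[OF x, simplified]
  have d [simp]: "gctx x \<inter> ctx k = {}" using k by blast
  let ?p = "\<lambda>S k. Gm S \<I> (curry_arr S \<I> S (\<r> S) \<odot> k)"
  have "gcomp arities_op (?p (gcod x) k) x = ?p (gdom x) (gev x k)"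
  proof (rule gev_ext[where u = unit_elem])
    have "gev (gcomp arities_op (?p (gcod x) k) x) unit_elem = gev x (gev (?p (gcod x) k) unit_elem)"
      using x k by (intro gev_gcomp) auto
    then show "gev (gcomp arities_op (?p (gcod x) k) x) unit_elem = gev (?p (gdom x) (gev x k)) unit_elem"
      using x k by (simp add: gev_def[of "Gm _ _ _"])
  qed (use x k in auto)
  then show ?thesis
    using gmap_gcomp[OF theory_simps(3)[OF th], of x "?p (gcod x) k"] x k S g(1,2) by (simp add: projection_def)
qed

text \<open>In \<open>arities_op\<close> the object \<open>S\<close> is a cotensor of
  \<open>\<I>\<close> by \<open>S\<close>, and \<open>str T\<close> preserves it. The counit so
  obtained is the arrow underlying the projections.\<close>

lemma projection_cotensor:
  assumes "S \<in> \<J>"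
  shows "is_cotensor T S \<I> S (hom_map (str T) S \<I> \<cdot> curry_arr S \<I> S (\<r> S))"
proof -
  have "is_cotensor arities_op S \<I> S (curry_arr S \<I> S (\<r> S))"
    by (rule arities_op_cotensor) (use assms right_unitor_iso in auto)
  moreover have "preserves_cotensors arities_op T (str T)" using th by (simp add: is_theory_def)
  ultimately have "is_cotensor T S (obj_map (str T) \<I>) (obj_map (str T) S) (hom_map (str T) S \<I> \<cdot> curry_arr S \<I> S (\<r> S))"
    unfolding preserves_cotensors_def using assms by (metis arities_op_simps(1) arities_unit)
  then show ?thesis using assms by simp
qed

text \<open>The interchange \<open>[J,A(S)] = [J,[S,X]] = [S,[J,X]] = [S,Y]\<close>, where \<open>X\<close> is the carrier of \<open>A\<close> and \<open>f\<close> is an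
  isomorphism from \<open>Y\<close> to \<open>[J,X]\<close>.\<close>

lemma exchange:
  fixes C :: "('c, 'o, 'm) cotensored_vcat"
  assumes adm: "admissible C" and A: "is_talg T C A" and J [simp]: "J \<in> \<J>" and S [simp]: "S \<in> \<J>"
    and f: "gm C f \<and> gdom f = Y \<and> gcod f = cotensor_ob C J (obj_map A \<I>) \<and> gctx f = {}"
    and g: "gm C g \<and> gdom g = cotensor_ob C J (obj_map A \<I>) \<and> gcod g = Y \<and> gctx g = {}"
    and inv: "gcomp C g f = gid C Y" "gcomp C f g = gid C (cotensor_ob C J (obj_map A \<I>))"
  shows "\<exists>h k. gm C h \<and> gdom h = cotensor_ob C J (obj_map A S) \<and> gcod h = cotensor_ob C S Y \<and> gctx h = {}
    \<and> gm C k \<and> gdom k = cotensor_ob C S Y \<and> gcod k = cotensor_ob C J (obj_map A S) \<and> gctx k = {}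
    \<and> gcomp C k h = gid C (cotensor_ob C J (obj_map A S)) \<and> gcomp C h k = gid C (cotensor_ob C S Y)
    \<and> (\<forall>e. elem e \<longrightarrow> ty e = S \<longrightarrow> gcomp C (cu C S Y e) h = gcomp C g (gmap (alg_cot C J A) (projection T S e)))"
proof -
  note [simp] = alg_context_simps[OF adm th] talg_simps[OF adm th A] A talg_cot[OF adm th J A] f g
  let ?B = "alg_cot C J A" and ?p = "hom_map (str T) S \<I> \<cdot> curry_arr S \<I> S (\<r> S)"
  let ?X = "cotensor_ob C J (obj_map A \<I>)" and ?D = "cotensor_ob C J (obj_map A S)" and ?E = "cotensor_ob C S Y"
  note Bt = talg_typed[OF adm th talg_cot[OF adm th J A]]
  have Y [simp]: "Y \<in> Ob C" using f gm_simps(1)[of C f] by simp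
  have ob [simp]: "?X \<in> Ob C" "?D \<in> Ob C" "?E \<in> Ob C"
    using designated_simps(1)[of C J] designated_simps(1)[of C S] by auto
  have p: "?p \<in> \<V> S (Hom T S \<I>)" using projection_cotensor[OF S] by (simp add: is_cotensor_def)
  define c where "c = hom_map ?B S \<I> \<cdot> ?p"
  \<comment> \<open>\<open>[J,A]\<close> is an algebra, hence sends the power \<open>S\<close> of
    \<open>\<I>\<close> to a power: \<open>[J,A(S)]\<close> is a cotensor of
    \<open>[J,A(\<I>)]\<close> by \<open>S\<close>.\<close>
  have cot: "is_cotensor C S ?X ?D c"
    using projection_cotensor[OF S] talg_cot[OF adm th J A] by (auto simp: c_def is_talg_def preserves_cotensors_def)
  have c: "c \<in> \<V> S (Hom C ?D ?X)" using cot by (simp add: is_cotensor_def)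
  have st: "hom_map (str T) S \<I> \<in> arrs V" "source V (hom_map (str T) S \<I>) = \<I> \<Rrightarrow> S" "target V (hom_map (str T) S \<I>) = Hom T S \<I>"
    using vfun_simps[OF is_vfun_typed[OF theory_simps(3)[OF th]], of S] by auto
  have pc: "gmap ?B (projection T S e) = Gm ?D ?X (c \<odot> e)" if "elem e" "ty e = S" for e
    using that st vfun_simps[OF Bt, of S] by (simp add: projection_def gmap_def c_def)
  have gB [simp]: "gm C (gmap ?B (projection T S e))" if "elem e" "ty e = S" for e
    using that by (intro gm_gmap[OF Bt]) simp
  \<comment> \<open>The projections of \<open>?D\<close>, carried from \<open>?X\<close> to
    \<open>Y\<close> by \<open>g\<close>, lift to \<open>h\<close>; those of \<open>?E\<close>,
    carried from \<open>Y\<close> to \<open>?X\<close> by \<open>f\<close>, lift to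
    \<open>k\<close>.\<close>
  obtain q where q: "q \<in> \<V> S (Hom C ?D Y)" "\<And>e. elem e \<Longrightarrow> ty e = S \<Longrightarrow> gcomp C g (Gm ?D ?X (c \<odot> e)) = Gm ?D Y (q \<odot> e)"
    by (rule whisker_left[of C g ?D c S]) (use c in auto)
  have ds: "designated C S Y" by simp
  obtain h where h: "gm C h" "gdom h = ?D" "gcod h = ?E" "gctx h = {}"
     "\<And>e. elem e \<Longrightarrow> ty e = S \<Longrightarrow> gcomp C (cu C S Y e) h = gcomp C g (gmap ?B (projection T S e))"
    using cotensor_ex_closed[OF _ _ Y designated_simps(1,2)[OF ds] ds q(1)] q(2) by (auto simp: pc cu_def)
  obtain r where r: "r \<in> \<V> S (Hom C ?E ?X)" "\<And>e. elem e \<Longrightarrow> ty e = S \<Longrightarrow> gcomp C f (cu C S Y e) = Gm ?E ?X (r \<odot> e)"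
    using whisker_left[of C f ?E "counit C S Y" S] designated_simps(2)[OF ds] f by (auto simp: cu_def)
  obtain k where k: "gm C k" "gdom k = ?E" "gcod k = ?D" "gctx k = {}"
     "\<And>e. elem e \<Longrightarrow> ty e = S \<Longrightarrow> gcomp C (gmap ?B (projection T S e)) k = gcomp C f (cu C S Y e)"
    using cotensor_ex_closed[OF _ _ ob(1,2) c cot r(1)] r(2) by (auto simp: pc)
  let ?v = "var (S, 0)"
  have v [simp]: "elem ?v" "ty ?v = S" by auto
  \<comment> \<open>The composites of \<open>h\<close> and \<open>k\<close> leave the projection at
    a variable unchanged, so they are identities.\<close>
  have "gcomp C (cu C S Y ?v) (gcomp C h k) = gcomp C (gcomp C (cu C S Y ?v) h) k"
    using h(1-4) k(1-4) by simp
  also have "\<dots> = gcomp C g (gcomp C (gmap ?B (projection T S ?v)) k)"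
    using h k(1-4) by simp
  also have "\<dots> = gcomp C (gcomp C g f) (cu C S Y ?v)"
    using k by simp
  finally have "gcomp C (cu C S Y ?v) (gcomp C h k) = gcomp C (cu C S Y ?v) (gid C ?E)"
    by (simp add: inv)
  then have hk: "gcomp C h k = gid C ?E"
    by (rule designated_ext[where e = ?v and J = S and X = Y, rotated -1]) (use h k in auto)
  have "gcomp C (gmap ?B (projection T S ?v)) (gcomp C k h) = gcomp C (gcomp C (gmap ?B (projection T S ?v)) k) h"
    using h(1-4) k(1-4) by simp
  also have "\<dots> = gcomp C f (gcomp C (cu C S Y ?v) h)"
    using h(1-4) k by simp
  also have "\<dots> = gcomp C (gcomp C f g) (gmap ?B (projection T S ?v))"
    using h by simp
  finally have "gcomp C (Gm ?D ?X (c \<odot> ?v)) (gcomp C k h) = gcomp C (Gm ?D ?X (c \<odot> ?v)) (gid C ?D)"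
    using gB[of ?v] by (simp add: inv pc)
  then have kh: "gcomp C k h = gid C ?D"
    by (rule cotensor_ext[OF _ _ ob(1,2) c cot, where e = ?v, rotated -1]) (use h k in auto)
  show ?thesis using h k hk kh by blast
qed

end

lemma cot_fun_unit:
  fixes C :: "('c, 'o, 'm) cotensored_vcat"
  assumes adm: "admissible C" and f: "gm C f"
  shows "gmap (cot_fun C \<I>) f = f"
proof -
  note a = admissible_simps[OF adm]
  note g [simp] = gm_simps[OF f] a(1,2) arities_unit
  have gf: "gm C (gmap (cot_fun C \<I>) f)" using f by (intro gm_cot_fun) auto
  have "gcomp C (cu C \<I> (gcod f) unit_elem) (gmap (cot_fun C \<I>) f) = gcomp C f (cu C \<I> (gdom f) unit_elem)"
    using f by (intro cot_fun_natural) auto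
  moreover have "cotensor_ob C \<I> X = X" "cu C \<I> X unit_elem = gid C X" if "X \<in> Ob C" for X
    using that by (simp_all add: a(3,4) cu_def gid_def)
  ultimately show ?thesis using f gf by simp
qed

text \<open>Notation of the proof: \<open>w u\<close> is the homomorphism of powers of
  \<open>A\<close> that the given morphism assigns to \<open>u\<close>; \<open>\<phi> J S\<close>,
  with inverse \<open>\<psi> J S\<close>, is the exchange from \<open>[J,A(S)]\<close> to
  \<open>[S,B(J)]\<close>; \<open>m J t\<close> is \<open>[J,A(t)]\<close> conjugated by it, and
  \<open>H\<close> collects these into arrows on hom-objects.\<close>

lemma commutant_symmetric:
  fixes C :: "('c, 'o, 'm) cotensored_vcat"
  assumes adm: "admissible C" and T: "is_theory T" and A: "is_talg T C A"
    and le: "alg_le C X (U, B) (commutant C (T, A))"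
  shows "alg_le C X (T, A) (commutant C (U, B))"
proof -
  let ?CT = "commutant_theory C (T, A)" and ?CA = "snd (commutant C (T, A))"
  let ?DT = "commutant_theory C (U, B)" and ?DB = "snd (commutant C (U, B))"
  let ?inc = "incl C A"
  obtain M f where U: "is_theory U" and B: "is_talg U C B" and BX: "obj_map B \<I> = X" and AX: "obj_map ?CA \<I> = X"
    and M: "is_theory_morphism U ?CT M" and f: "is_vnat_iso U C B (vfun_comp ?CA M) f" "f \<I> = Ide C X"
  proof -
    have "alg_le C X (U, B) (?CT, ?CA)" using le by (simp add: commutant_def)
    then show ?thesis using that unfolding alg_le_iff by auto
  qed
  note sA [simp] = alg_context_simps[OF adm T] talg_simps[OF adm T A] talg_cot[OF adm T _ A] arities_unit
  note sB [simp] = alg_context_simps[OF adm U] talg_simps[OF adm U B] talg_cot[OF adm U _ B] projection_cod[OF T]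
  note [simp] = CT_simps[OF adm T A] CT_simps[OF adm U B]
  note CT = is_theory_CT[OF adm T A] and CA = is_vfun_CA[OF adm T A]
  note DT = is_theory_CT[OF adm U B] and DB = is_vfun_CA[OF adm U B]
  note CAt = is_vfun_typed[OF CA] and DBt = is_vfun_typed[OF DB]
  have Bf: "is_vfun U C B" and Af: "is_vfun T C A" using A B by (auto simp: is_talg_def)
  note Bt = is_vfun_typed[OF Bf] and At = is_vfun_typed[OF Af]
  have XC [simp]: "X \<in> Ob C" using talg_simps(1)[OF adm U B, of \<I>] BX by simp
  have AX' [simp]: "obj_map A \<I> = X" and [simp]: "obj_map B \<I> = X"
    using AX BX admissible_simps(3)[OF adm, of "obj_map A \<I>"] by (auto simp: CA_simps[OF adm T A])
  have cI [simp]: "cotensor_ob C \<I> Y = Y" "cu C \<I> Y unit_elem = gid C Y" if "Y \<in> Ob C" for Y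
    using that by (simp_all add: admissible_simps(3,4)[OF adm] cu_def gid_def)
  have cot_ob [simp]: "cotensor_ob C J Y \<in> Ob C" if "J \<in> \<J>" "Y \<in> Ob C" for J Y
    using that designated_simps(1)[of C J Y] by simp
  note Ms = theory_morphism_simps[OF M U CT]
  note Mt = is_vfun_typed[OF Ms(1)]
  have CM: "is_vfun U C (vfun_comp ?CA M)"
    by (rule is_vfun_comp[OF Ms(1) CA]) (use theory_simps(1)[OF CT] in auto)
  have CMob [simp]: "obj_map (vfun_comp ?CA M) J = cotensor_ob C J X" if "J \<in> \<J>" for J
    using that Ms(2) by (simp add: vfun_comp_def CA_simps[OF adm T A])
  define ff :: "'o \<Rightarrow> ('c, 'o, 'm) gmor" where "ff = (\<lambda>J. Gm (obj_map B J) (obj_map (vfun_comp ?CA M) J) (El {} (f J)))"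
  obtain g where g:
    "\<And>J. J \<in> Ob U \<Longrightarrow> gm C (ff J) \<and> gdom (ff J) = obj_map B J \<and> gcod (ff J) = obj_map (vfun_comp ?CA M) J \<and> gctx (ff J) = {}"
    "\<And>J. J \<in> Ob U \<Longrightarrow> gm C (g J) \<and> gdom (g J) = obj_map (vfun_comp ?CA M) J \<and> gcod (g J) = obj_map B J \<and> gctx (g J) = {}"
    "\<And>J. J \<in> Ob U \<Longrightarrow> gcomp C (g J) (ff J) = gid C (obj_map B J)"
    "\<And>J. J \<in> Ob U \<Longrightarrow> gcomp C (ff J) (g J) = gid C (obj_map (vfun_comp ?CA M) J)"
    "\<And>u. gm U u \<Longrightarrow> gcomp C (g (gcod u)) (gmap (vfun_comp ?CA M) u) = gcomp C (gmap B u) (g (gdom u))"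
    by (rule vnat_isoD[OF f(1) _ _ Bf CM ff_def]) auto
  \<comment> \<open>The inverse of the given isomorphism is also the identity at
    \<open>\<I>\<close>; this is what normalises \<open>\<phi> \<I> \<I>\<close> at the end.\<close>
  have gI: "g \<I> = gid C X"
  proof -
    have el: "Ide C X \<in> \<V> \<I> (Hom C X X)" by (simp add: arrows_def)
    have "ff \<I> = gid C X" using f(2) app_unit[OF el] by (simp add: ff_def gid_def)
    then show ?thesis using g(2,3)[of \<I>] by simp
  qed
  define w where "w u = ?inc (gmap M u)" for u
  have w [simp]: "gm (Alg_vcat T C) (w u)" "gdom (w u) = alg_cot C (gdom u) A" "gcod (w u) = alg_cot C (gcod u) A" "gctx (w u) = gctx u"
    if "gm U u" for u
    using gm_incl[OF adm T A gm_gmap[OF Mt that]] gm_simps(1,2)[OF that] Ms(2) by (auto simp: w_def incl_simps[OF adm T A])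
  have gw: "gcomp C (g (gcod u)) (comp_at T C \<I> (w u)) = gcomp C (gmap B u) (g (gdom u))" if u: "gm U u" for u
    using g(5)[OF u] gmap_vfun_comp[OF Mt CAt u] gmap_CA[OF adm T A, of "gmap M u"] by (simp add: w_def)
  \<comment> \<open>The properties of the exchange are gathered in one predicate, so that
    \<open>\<phi>\<close> and \<open>\<psi>\<close> can be chosen for all \<open>J\<close> and
    \<open>S\<close> at once.\<close>
  define P where "P J S h k \<longleftrightarrow> gm C h \<and> gdom h = cotensor_ob C J (obj_map A S) \<and> gcod h = cotensor_ob C S (obj_map B J) \<and> gctx h = {}
    \<and> gm C k \<and> gdom k = cotensor_ob C S (obj_map B J) \<and> gcod k = cotensor_ob C J (obj_map A S) \<and> gctx k = {}
    \<and> gcomp C k h = gid C (cotensor_ob C J (obj_map A S)) \<and> gcomp C h k = gid C (cotensor_ob C S (obj_map B J))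
    \<and> (\<forall>e. elem e \<longrightarrow> ty e = S \<longrightarrow> gcomp C (cu C S (obj_map B J) e) h = gcomp C (g J) (gmap (alg_cot C J A) (projection T S e)))"
    for J S and h k :: "('c, 'o, 'm) gmor"
  have "\<exists>h k. P J S h k" if [simp]: "J \<in> \<J>" "S \<in> \<J>" for J S
    unfolding P_def by (rule exchange[OF T adm A, where f = "ff J" and g = "g J"]) (use g(1-4)[of J] in auto)
  then have "\<exists>\<phi> \<psi>. \<forall>J S. J \<in> \<J> \<longrightarrow> S \<in> \<J> \<longrightarrow> P J S (\<phi> J S) (\<psi> J S)" by metis
  then obtain \<phi> \<psi> where P: "\<And>J S. J \<in> \<J> \<Longrightarrow> S \<in> \<J> \<Longrightarrow> P J S (\<phi> J S) (\<psi> J S)" by blast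
  have \<phi> [simp]: "gm C (\<phi> J S)" "gdom (\<phi> J S) = cotensor_ob C J (obj_map A S)" "gcod (\<phi> J S) = cotensor_ob C S (obj_map B J)" "gctx (\<phi> J S) = {}"
    and \<psi> [simp]: "gm C (\<psi> J S)" "gdom (\<psi> J S) = cotensor_ob C S (obj_map B J)" "gcod (\<psi> J S) = cotensor_ob C J (obj_map A S)" "gctx (\<psi> J S) = {}"
    and \<psi>\<phi>: "gcomp C (\<psi> J S) (\<phi> J S) = gid C (cotensor_ob C J (obj_map A S))"
    and \<phi>\<psi>: "gcomp C (\<phi> J S) (\<psi> J S) = gid C (cotensor_ob C S (obj_map B J))"
    and cu\<phi>: "\<And>e. elem e \<Longrightarrow> ty e = S \<Longrightarrow> gcomp C (cu C S (obj_map B J) e) (\<phi> J S) = gcomp C (g J) (gmap (alg_cot C J A) (projection T S e))"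
    if "J \<in> \<J>" "S \<in> \<J>" for J S
    using P[OF that] unfolding P_def by auto
  have gmA [simp]: "gm C (gmap (alg_cot C J A) t)" if "J \<in> \<J>" "gm T t" for J t
    by (rule gm_gmap[OF talg_typed[OF adm T talg_cot[OF adm T that(1) A]] that(2)])
  have gmB [simp]: "gm C (gmap (alg_cot C J B) u)" if "J \<in> \<J>" "gm U u" for J u
    by (rule gm_gmap[OF talg_typed[OF adm U talg_cot[OF adm U that(1) B]] that(2)])
  have gmB' [simp]: "gm C (gmap B u)" if "gm U u" for u using gm_gmap[OF Bt that] .
  have gmw [simp]: "gm C (comp_at T C S (w u))" if "S \<in> \<J>" "gm U u" for S u
    using that by (intro gm_comp_at[OF adm T]) auto
  have [simp]: "gm C (g J)" "gdom (g J) = cotensor_ob C J X" "gcod (g J) = obj_map B J" "gctx (g J) = {}" if "J \<in> \<J>" for J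
    using g(2)[of J] that by auto

  \<comment> \<open>Composing with the projection at a fresh \<open>x\<close> replaces the component
    of \<open>w u\<close> at \<open>S\<close> by the one at \<open>\<I>\<close>, which is
    \<open>B(u)\<close> up to \<open>g\<close> by \<open>gw\<close>. So \<open>w u\<close> is forced
    to be \<open>[S,B(u)]\<close> at \<open>S\<close>, up to \<open>\<phi>\<close>.\<close>
  have key: "gcomp C (\<phi> K S) (comp_at T C S (w u)) = gcomp C (gmap (alg_cot C S B) u) (\<phi> J S)"
    if u: "gm U u" and JK: "gdom u = J" "gcod u = K" and S [simp]: "S \<in> \<J>" for u J K S
  proof -
    have [simp]: "J \<in> \<J>" "K \<in> \<J>" using gm_simps(1,2)[OF u] JK by auto
    obtain x where x [simp]: "fst x = S" "x \<notin> gctx u" using fresh_name[of "gctx u"] u by (metis gm_vctx vctx_finite)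
    let ?p = "projection T S (var x)"
    have p [simp]: "gm T ?p" by (rule gm_projection[OF T]) auto
    have "gcomp C (cu C S (obj_map B K) (var x)) (gcomp C (\<phi> K S) (comp_at T C S (w u)))
      = gcomp C (gcomp C (cu C S (obj_map B K) (var x)) (\<phi> K S)) (comp_at T C S (w u))"
      using u JK by (intro gassoc[symmetric]) auto
    also have "\<dots> = gcomp C (g K) (gcomp C (gmap (alg_cot C K A) ?p) (comp_at T C S (w u)))"
      using u JK by (simp add: cu\<phi>)
    also have "\<dots> = gcomp C (g K) (gcomp C (comp_at T C \<I> (w u)) (gmap (alg_cot C J A) ?p))"
      using u JK comp_at_natural[OF adm T w(1)[OF u], of ?p "alg_cot C J A" "alg_cot C K A" S \<I>] by simp
    also have "\<dots> = gcomp C (gcomp C (g K) (comp_at T C \<I> (w u))) (gmap (alg_cot C J A) ?p)"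
      using u JK by (intro gassoc[symmetric]) auto
    also have "\<dots> = gcomp C (gmap B u) (gcomp C (g J) (gmap (alg_cot C J A) ?p))"
      using u JK gw[OF u] by simp
    also have "\<dots> = gcomp C (gmap B u) (gcomp C (cu C S (obj_map B J) (var x)) (\<phi> J S))"
      by (simp add: cu\<phi>)
    also have "\<dots> = gcomp C (gcomp C (gmap B u) (cu C S (obj_map B J) (var x))) (\<phi> J S)"
      using u JK by (intro gassoc[symmetric]) auto
    also have "gcomp C (gmap B u) (cu C S (obj_map B J) (var x)) = gcomp C (cu C S (obj_map B K) (var x)) (gmap (alg_cot C S B) u)"
      using u JK by (simp add: gmap_alg_cot[OF adm U B] cot_fun_natural)
    also have "gcomp C (gcomp C (cu C S (obj_map B K) (var x)) (gmap (alg_cot C S B) u)) (\<phi> J S)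
      = gcomp C (cu C S (obj_map B K) (var x)) (gcomp C (gmap (alg_cot C S B) u) (\<phi> J S))"
      using u JK by (intro gassoc) auto
    finally show ?thesis
      by (rule designated_ext[where e = "var x" and J = S and X = "obj_map B K", rotated -1]) (use u JK in auto)
  qed
  have key': "gcomp C (comp_at T C S (w u)) (\<psi> J S) = gcomp C (\<psi> K S) (gmap (alg_cot C S B) u)"
    if u: "gm U u" and JK: "gdom u = J" "gcod u = K" and S [simp]: "S \<in> \<J>" for u J K S
  proof -
    have [simp]: "J \<in> \<J>" "K \<in> \<J>" using gm_simps(1,2)[OF u] JK by auto
    have "gcomp C (comp_at T C S (w u)) (\<psi> J S) = gcomp C (gcomp C (\<psi> K S) (\<phi> K S)) (gcomp C (comp_at T C S (w u)) (\<psi> J S))"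
      using u JK by (simp add: \<psi>\<phi>)
    also have "\<dots> = gcomp C (\<psi> K S) (gcomp C (gcomp C (\<phi> K S) (comp_at T C S (w u))) (\<psi> J S))"
      using u JK by simp
    also have "\<dots> = gcomp C (\<psi> K S) (gcomp C (gmap (alg_cot C S B) u) (gcomp C (\<phi> J S) (\<psi> J S)))"
      unfolding key[OF u JK S] using u JK by simp
    also have "\<dots> = gcomp C (\<psi> K S) (gmap (alg_cot C S B) u)"
      using u JK by (simp add: \<phi>\<psi>)
    finally show ?thesis .
  qed

  define m where "m J t = gcomp C (\<phi> J (gcod t)) (gcomp C (gmap (alg_cot C J A) t) (\<psi> J (gdom t)))" for J t
  have m_simps [simp]: "gm C (m J t)" "gdom (m J t) = cotensor_ob C (gdom t) (obj_map B J)"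
    "gcod (m J t) = cotensor_ob C (gcod t) (obj_map B J)" "gctx (m J t) = gctx t"
    if "J \<in> \<J>" "gm T t" for J t
    using that gm_simps(1,2)[OF that(2)] by (auto simp: m_def)
  \<comment> \<open>After \<open>key'\<close> on one side and \<open>key\<close> on the other,
    exactly the naturality of \<open>w u\<close> with respect to \<open>t\<close> is left.\<close>
  have m_natural: "gcomp C (m (gcod u) t) (gmap (alg_cot C (gdom t) B) u) = gcomp C (gmap (alg_cot C (gcod t) B) u) (m (gdom u) t)"
    if t: "gm T t" and u: "gm U u" "gctx t \<inter> gctx u = {}" "gctx u \<inter> gctx t = {}" for t u
  proof -
    let ?J = "gdom u" and ?K = "gcod u" and ?S = "gdom t" and ?R = "gcod t"
    have [simp]: "?J \<in> \<J>" "?K \<in> \<J>" "?S \<in> \<J>" "?R \<in> \<J>" using gm_simps(1,2)[OF t] gm_simps(1,2)[OF u(1)] by auto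
    have "gcomp C (m ?K t) (gmap (alg_cot C ?S B) u) = gcomp C (\<phi> ?K ?R) (gcomp C (gmap (alg_cot C ?K A) t) (gcomp C (\<psi> ?K ?S) (gmap (alg_cot C ?S B) u)))"
      using t u by (simp add: m_def)
    also have "\<dots> = gcomp C (\<phi> ?K ?R) (gcomp C (gmap (alg_cot C ?K A) t) (gcomp C (comp_at T C ?S (w u)) (\<psi> ?J ?S)))"
      using t u by (simp add: key')
    also have "\<dots> = gcomp C (\<phi> ?K ?R) (gcomp C (gcomp C (gmap (alg_cot C ?K A) t) (comp_at T C ?S (w u))) (\<psi> ?J ?S))"
      using t u by simp
    also have "gcomp C (gmap (alg_cot C ?K A) t) (comp_at T C ?S (w u)) = gcomp C (comp_at T C ?R (w u)) (gmap (alg_cot C ?J A) t)"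
      using u t by (intro comp_at_natural[OF adm T w(1)[OF u(1)], symmetric]) auto
    also have "gcomp C (\<phi> ?K ?R) (gcomp C (gcomp C (comp_at T C ?R (w u)) (gmap (alg_cot C ?J A) t)) (\<psi> ?J ?S))
      = gcomp C (gcomp C (\<phi> ?K ?R) (comp_at T C ?R (w u))) (gcomp C (gmap (alg_cot C ?J A) t) (\<psi> ?J ?S))"
      using t u by simp
    also have "\<dots> = gcomp C (gmap (alg_cot C ?R B) u) (m ?J t)"
      using t u key[of u ?J ?K ?R] by (simp add: m_def)
    finally show ?thesis .
  qed
  have m_gcomp: "m J (gcomp T t s) = gcomp C (m J t) (m J s)"
    if J [simp]: "J \<in> \<J>" and st: "gm T s" "gm T t" "gcod s = gdom t" "gctx t \<inter> gctx s = {}" for J s t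
  proof -
    have [simp]: "gdom s \<in> \<J>" "gdom t \<in> \<J>" "gcod t \<in> \<J>" using gm_simps(1,2)[OF st(1)] gm_simps(1,2)[OF st(2)] by auto
    have e: "gmap (alg_cot C J A) (gcomp T t s) = gcomp C (gmap (alg_cot C J A) t) (gmap (alg_cot C J A) s)"
      using st by (intro gmap_gcomp[OF talg_vfun[OF adm T]]) auto
    have "gcomp C (m J t) (m J s) = gcomp C (\<phi> J (gcod t)) (gcomp C (gmap (alg_cot C J A) t)
       (gcomp C (gcomp C (\<psi> J (gdom t)) (\<phi> J (gdom t))) (gcomp C (gmap (alg_cot C J A) s) (\<psi> J (gdom s)))))"
      using st by (simp add: m_def)
    then show ?thesis using st by (simp add: m_def e \<psi>\<phi>)
  qed
  have m_gid: "m J (gid T S) = gid C (cotensor_ob C S (obj_map B J))" if [simp]: "J \<in> \<J>" "S \<in> \<J>" for J S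
  proof -
    have "gmap (alg_cot C J A) (gid T S) = gid C (cotensor_ob C J (obj_map A S))"
      using gmap_gid[OF talg_vfun[OF adm T talg_cot[OF adm T _ A]], of J S] by simp
    then show ?thesis by (simp add: m_def \<phi>\<psi>)
  qed

  \<comment> \<open>A single arrow out of \<open>Hom T S R\<close> is needed. The operations
    \<open>m J\<close> at the generic \<open>var x\<close> are assembled into a homomorphism, and
    abstracting over \<open>x\<close> gives \<open>H\<close>.\<close>
  have "\<exists>H. H \<in> \<V> (Hom T S R) (alg_hom U C (alg_cot C S B) (alg_cot C R B)) \<and>
      (\<forall>t J. gm T t \<longrightarrow> gdom t = S \<longrightarrow> gcod t = R \<longrightarrow> J \<in> \<J> \<longrightarrow>
        comp_at U C J (Gm (alg_cot C S B) (alg_cot C R B) (H \<odot> gel t)) = m J t)" if SR [simp]: "S \<in> \<J>" "R \<in> \<J>" for S R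
  proof -
    define x where "x = (Hom T S R, 0 :: nat)"
    have x [simp]: "fst x = Hom T S R" by (simp add: x_def)
    let ?t = "Gm S R (var x)"
    have t [simp]: "gm T ?t" by simp
    obtain \<alpha> where \<alpha>: "gm (Alg_vcat U C) \<alpha>" "gdom \<alpha> = alg_cot C S B" "gcod \<alpha> = alg_cot C R B" "gctx \<alpha> = {x}"
        "\<And>J. J \<in> \<J> \<Longrightarrow> comp_at U C J \<alpha> = m J ?t"
      by (rule Al_ex[OF adm U, of "alg_cot C S B" "alg_cot C R B" "{x}" "{}" "\<lambda>J. m J ?t"])
        (insert m_natural[OF t], auto)
    obtain H where H: "H \<in> \<V> (Hom T S R) (alg_hom U C (alg_cot C S B) (alg_cot C R B))" "gel \<alpha> = H \<odot> var x"
      by (rule abstract_elem[of "gel \<alpha>" "var x"]) (use \<alpha> gm_simps[OF \<alpha>(1)] in auto)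
    note [simp] = arrowsD[OF H(1)]
    \<comment> \<open>\<open>H\<close> is known at the variable \<open>x\<close> only. To evaluate
      it at any \<open>t\<close>, also \<open>m J\<close> is exhibited as an arrow \<open>r\<close>,
      by whiskering with \<open>\<psi>\<close> and \<open>\<phi>\<close>, and \<open>r\<close> is
      compared with \<open>?p \<cdot> H\<close> at \<open>x\<close>.\<close>
    have "comp_at U C J (Gm (alg_cot C S B) (alg_cot C R B) (H \<odot> gel t)) = m J t"
      if t: "gm T t" "gdom t = S" "gcod t = R" and J [simp]: "J \<in> \<J>" for t J
    proof -
      let ?a = "alg_cot C J A" and ?p = "alg_proj U C (alg_cot C S B) (alg_cot C R B) J"
      let ?h = "hom_map ?a S R"
      have ha: "?h \<in> \<V> (Hom T S R) (Hom C (cotensor_ob C J (obj_map A S)) (cotensor_ob C J (obj_map A R)))"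
        using talg_simps[OF adm T talg_cot[OF adm T J A] SR(1)] by (simp add: arrows_def)
      obtain q where q: "q \<in> \<V> (Hom T S R) (Hom C (cotensor_ob C S (obj_map B J)) (cotensor_ob C J (obj_map A R)))"
        "\<And>e. elem e \<Longrightarrow> ty e = Hom T S R \<Longrightarrow> gcomp C (Gm (cotensor_ob C J (obj_map A S)) (cotensor_ob C J (obj_map A R)) (?h \<odot> e)) (\<psi> J S)
           = Gm (cotensor_ob C S (obj_map B J)) (cotensor_ob C J (obj_map A R)) (q \<odot> e)"
        using whisker_right[of C "\<psi> J S" "cotensor_ob C J (obj_map A R)" ?h "Hom T S R"] ha by auto
      obtain r where r: "r \<in> \<V> (Hom T S R) (Hom C (cotensor_ob C S (obj_map B J)) (cotensor_ob C R (obj_map B J)))"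
        "\<And>e. elem e \<Longrightarrow> ty e = Hom T S R \<Longrightarrow> gcomp C (\<phi> J R) (Gm (cotensor_ob C S (obj_map B J)) (cotensor_ob C J (obj_map A R)) (q \<odot> e))
           = Gm (cotensor_ob C S (obj_map B J)) (cotensor_ob C R (obj_map B J)) (r \<odot> e)"
        using whisker_left[of C "\<phi> J R" "cotensor_ob C S (obj_map B J)" q "Hom T S R"] q(1) by auto
      have mr: "m J (Gm S R e) = Gm (cotensor_ob C S (obj_map B J)) (cotensor_ob C R (obj_map B J)) (r \<odot> e)"
        if "elem e" "ty e = Hom T S R" for e
        using q(2)[OF that] r(2)[OF that] by (simp add: m_def gmap_def)
      note [simp] = arrowsD[OF r(1)] alg_proj_typed[OF adm U talg_cot[OF adm U SR(1) B] talg_cot[OF adm U SR(2) B] J]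
      have "?p \<cdot> H = r"
      proof (rule arr_ext[where x = x and E = "Hom T S R"])
        have "comp_at U C J \<alpha> = m J ?t" using \<alpha>(5) by simp
        then have "?p \<odot> gel \<alpha> = r \<odot> var x" using mr[of "var x"] \<alpha>(2,3) by (simp add: gmap_def evalf_def)
        then show "(?p \<cdot> H) \<odot> var x = r \<odot> var x" using H(2) by simp
      qed (auto simp: arrows_def)
      then have "?p \<odot> H \<odot> gel t = r \<odot> gel t"
        using gm_simps[OF t(1)] t by (simp flip: app_comp)
      moreover have "Gm S R (gel t) = t" using t by (simp add: gmor.expand)
      ultimately show ?thesis using mr[of "gel t"] gm_simps[OF t(1)] t by (simp add: gmap_def evalf_def)
    qed
    then show ?thesis using H(1) by blast
  qed
  then obtain H where H: "\<And>S R. S \<in> \<J> \<Longrightarrow> R \<in> \<J> \<Longrightarrow> H S R \<in> \<V> (Hom T S R) (alg_hom U C (alg_cot C S B) (alg_cot C R B))"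
    "\<And>t J. gm T t \<Longrightarrow> gdom t \<in> \<J> \<Longrightarrow> gcod t \<in> \<J> \<Longrightarrow> J \<in> \<J> \<Longrightarrow>
        comp_at U C J (Gm (alg_cot C (gdom t) B) (alg_cot C (gcod t) B) (H (gdom t) (gcod t) \<odot> gel t)) = m J t"
    by metis
  let ?N = "\<lparr>obj_map = (\<lambda>J. J), hom_map = H\<rparr>"
  have Nt: "vfun_typed T ?DT ?N" using H(1) by (simp add: vfun_typed_def)
  have N: "comp_at U C J (incl C B (gmap ?N t)) = m J t" if "gm T t" "J \<in> \<J>" for t J
    using H(2)[OF that(1) _ _ that(2)] gm_simps(1,2)[OF that(1)] by (simp add: incl_def[OF adm U B] gmap_def)
  note Dext = CT_ext[OF adm U B]
  note Ds [simp] = theory_simps(1)[OF DT] gm_incl[OF adm U B] incl_simps[OF adm U B]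
  have Nob [simp]: "gdom (gmap ?N t) = gdom t" "gcod (gmap ?N t) = gcod t" for t by simp_all
  have gN [simp]: "gm ?DT (gmap ?N t)" if "gm T t" for t using gm_gmap[OF Nt that] .
  have Nf: "is_vfun T ?DT ?N"
  proof (rule is_vfunI)
    fix s t assume st: "gm T s" "gm T t" "gcod s = gdom t" "gctx t \<inter> gctx s = {}"
    show "gmap ?N (gcomp T t s) = gcomp ?DT (gmap ?N t) (gmap ?N s)"
    proof (rule Dext)
      fix J assume [simp]: "J \<in> \<J>"
      have "comp_at U C J (incl C B (gcomp ?DT (gmap ?N t) (gmap ?N s))) = gcomp C (comp_at U C J (incl C B (gmap ?N t))) (comp_at U C J (incl C B (gmap ?N s)))"
        using st by (simp add: comp_at_gcomp[OF adm U])
      then show "comp_at U C J (incl C B (gmap ?N (gcomp T t s))) = comp_at U C J (incl C B (gcomp ?DT (gmap ?N t) (gmap ?N s)))"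
        using st by (simp add: N m_gcomp)
    qed (use st in auto)
  next
    fix S assume "S \<in> Ob T"
    then have [simp]: "S \<in> \<J>" by simp
    show "gmap ?N (gid T S) = gid ?DT (obj_map ?N S)"
      by (rule Dext) (auto simp: N m_gid comp_at_gid[OF adm U])
  qed (auto simp: Nt)
  have tm: "is_theory_morphism T ?DT ?N"
  proof (rule theory_morphismI[OF Nf T DT])
    fix x assume x: "gm arities_op x"
    note gx [simp] = gm_simps(1,2)[OF x, simplified]
    let ?S = "gdom x" and ?R = "gcod x"
    have sx [simp]: "gm T (gmap (str T) x)" "obj_map (str T) ?S = ?S" "obj_map (str T) ?R = ?R"
      using gm_str[OF T x] theory_simps(4)[OF T] by auto
    show "gmap ?N (gmap (str T) x) = gmap (str ?DT) x"
    proof (rule Dext)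
      fix J assume J [simp]: "J \<in> \<J>"
      \<comment> \<open>Compared through the projection at \<open>y\<close>: \<open>cu\<phi>\<close>
        turns it into a projection of \<open>T\<close>, \<open>projection_str\<close> reindexes that
        by \<open>x\<close>, and \<open>cu\<phi>\<close> leads back.\<close>
      have "m J (gmap (str T) x) = gmap (comap_fun C (obj_map B J)) x"
      proof -
        obtain y where y [simp]: "fst y = ?R" "y \<notin> gctx x" using fresh_name[of "gctx x"] x by (metis gm_vctx vctx_finite)
        have gr [simp]: "gm C (gmap (comap_fun C (obj_map B J)) x)" using x by (intro gm_comap_fun) auto
        let ?c = "cu C ?R (obj_map B J) (var y)" and ?a = "gmap (alg_cot C J A)"
        have p [simp]: "gm T (projection T ?R (var y))" "gm T (projection T ?S (gev x (var y)))"
          using x by (auto intro!: gm_projection[OF T])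
        have "gcomp C ?c (m J (gmap (str T) x)) = gcomp C (gcomp C ?c (\<phi> J ?R)) (gcomp C (?a (gmap (str T) x)) (\<psi> J ?S))"
          unfolding m_def using x by (subst gassoc) auto
        also have "\<dots> = gcomp C (g J) (gcomp C (gcomp C (?a (projection T ?R (var y))) (?a (gmap (str T) x))) (\<psi> J ?S))"
          using x by (simp add: cu\<phi>)
        also have "gcomp C (?a (projection T ?R (var y))) (?a (gmap (str T) x)) = ?a (gcomp T (projection T ?R (var y)) (gmap (str T) x))"
          using x by (intro gmap_gcomp[OF talg_vfun[OF adm T], symmetric]) auto
        also have "gcomp T (projection T ?R (var y)) (gmap (str T) x) = projection T ?S (gev x (var y))"
          using x by (intro projection_str[OF T]) auto
        also have "gcomp C (g J) (gcomp C (?a (projection T ?S (gev x (var y)))) (\<psi> J ?S))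
          = gcomp C (gcomp C (cu C ?S (obj_map B J) (gev x (var y))) (\<phi> J ?S)) (\<psi> J ?S)"
          using x by (simp add: cu\<phi>)
        also have "\<dots> = cu C ?S (obj_map B J) (gev x (var y))"
          using x by (simp add: \<phi>\<psi>)
        also have "\<dots> = gcomp C ?c (gmap (comap_fun C (obj_map B J)) x)"
          using x by (subst comap_fun_natural) auto
        finally show ?thesis
          by (rule designated_ext[where e = "var y" and J = ?R and X = "obj_map B J", rotated -1]) (use x in auto)
      qed
      then show "comp_at U C J (incl C B (gmap ?N (gmap (str T) x))) = comp_at U C J (incl C B (gmap (str ?DT) x))"
        using x by (simp add: N incl_str[OF adm U B] comp_at_comap[OF adm U B])
    qed (use x gm_str[OF DT x] theory_simps(4)[OF DT] in auto)
  qed simp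

  have DN: "is_vfun T C (vfun_comp ?DB ?N)"
    by (rule is_vfun_comp[OF Nf DB]) auto
  have DNob [simp]: "obj_map (vfun_comp ?DB ?N) S = cotensor_ob C S X" for S
    by (simp add: vfun_comp_def CA_simps[OF adm U B])
  \<comment> \<open>At \<open>J = \<I>\<close> the exchange goes from
    \<open>[\<I>,A(S)] = A(S)\<close> to \<open>[S,B(\<I>)] = [S,X]\<close>, the value at
    \<open>S\<close> of the commutant of \<open>B\<close>.\<close>
  have "is_vnat_iso T C A (vfun_comp ?DB ?N) (\<lambda>S. arr (gel (\<phi> \<I> S)))"
  proof (rule vnat_isoI[OF _ _ Af DN, where g = "\<lambda>S. \<psi> \<I> S"])
    fix t assume t: "gm T t"
    note gt [simp] = gm_simps(1,2)[OF t, simplified] gm_gmap[OF At t]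
    have a: "gmap (alg_cot C \<I> A) t = gmap A t"
      using t by (simp add: gmap_alg_cot[OF adm T A] cot_fun_unit[OF adm])
    have "gmap (vfun_comp ?DB ?N) t = m \<I> t"
      using gmap_vfun_comp[OF Nt DBt t] gmap_CA[OF adm U B, of "gmap ?N t"] N[OF t, of \<I>] by simp
    then have "gcomp C (gmap (vfun_comp ?DB ?N) t) (\<phi> \<I> (gdom t)) = gcomp C (\<phi> \<I> (gcod t)) (gcomp C (gmap A t) (gcomp C (\<psi> \<I> (gdom t)) (\<phi> \<I> (gdom t))))"
      using t by (simp add: m_def a)
    then show "gcomp C (\<phi> \<I> (gcod t)) (gmap A t) = gcomp C (gmap (vfun_comp ?DB ?N) t) (\<phi> \<I> (gdom t))"
      using t by (simp add: \<psi>\<phi>)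
  qed (auto simp: \<phi>\<psi> \<psi>\<phi>)
  \<comment> \<open>The counit of \<open>[\<I>,X]\<close> and the projection of \<open>T\<close> at
    \<open>unit_elem\<close> are identities, and so is \<open>g \<I>\<close>.\<close>
  moreover have "arr (gel (\<phi> \<I> \<I>)) = Ide C X"
  proof -
    have "\<phi> \<I> \<I> = gcomp C (cu C \<I> (obj_map B \<I>) unit_elem) (\<phi> \<I> \<I>)" by simp
    also have "\<dots> = gcomp C (g \<I>) (gmap (alg_cot C \<I> A) (projection T \<I> unit_elem))"
      by (rule cu\<phi>) auto
    also have "\<dots> = gid C X"
      using gmap_gid[OF talg_vfun[OF adm T talg_cot[OF adm T _ A]], of \<I> \<I>] by (simp add: projection_unit[OF T] gI)
    finally show ?thesis by (simp add: gid_def app_def unit_elem_def)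
  qed
  ultimately have "alg_le C X (T, A) (?DT, ?DB)"
    using T A DT is_talg_CA[OF adm U B] tm unfolding alg_le_iff by (auto simp: CA_simps[OF adm U B])
  then show ?thesis by (simp add: commutant_def)
qed

end

section \<open>The Galois connection and the four equivalent conditions\<close>

theorem proposition13p7:
  fixes V :: "('o, 'm) smc_structure"
    and \<J> :: "'o set"
    and C :: "('c, 'o, 'm) cotensored_vcat"
    and A :: "('c, 'o, 'm) alg"
  assumes "system_of_arities V \<J>"
    and "smc_category.has_pullbacks V"
    and "system_of_arities.admissible V \<J> C"
    and "system_of_arities.is_algebra V \<J> C A"
  shows "(system_of_arities.commutative V \<J> C A
            \<longleftrightarrow> system_of_arities.contracommutative V \<J> C (system_of_arities.commutant V \<J> C A))
       \<and> (system_of_arities.commutative V \<J> C A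
            \<longleftrightarrow> system_of_arities.commutative V \<J> C (system_of_arities.commutant V \<J> C (system_of_arities.commutant V \<J> C A)))
       \<and> (system_of_arities.commutative V \<J> C A
            \<longleftrightarrow> system_of_arities.commutes_with V \<J> C A
                   (system_of_arities.commutant V \<J> C (system_of_arities.commutant V \<J> C A)))"
proof -
  interpret system_of_arities V \<J> by fact
  note adm = assms(3) and A = assms(4)
  let ?le = "alg_le C (alg_carrier A)" and ?c = "commutant C"
  have alg: "is_algebra C (?c D)" "alg_carrier (?c D) = alg_carrier D" if "is_algebra C D" for D
    using that is_algebra_commutant[OF adm] carrier_commutant[OF adm] by (cases D; simp add: is_algebra_def)+
  have trans: "?le D F" if "?le D E" "?le E F" for D E F
    using that alg_le_trans[OF adm] by (metis surj_pair)
  have sym: "?le E (?c D)" if "?le D (?c E)" "is_algebra C E" for D E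
    using that commutant_symmetric[OF adm] by (cases D; cases E; simp add: is_algebra_def)
  have refl: "?le D D" if "is_algebra C D" "alg_carrier D = alg_carrier A" for D
    using alg_le_refl[OF adm, of "fst D" "snd D"] that
    by (simp add: is_algebra_def alg_carrier_def case_prod_beta)
  \<comment> \<open>Symmetry applied to the reflexivity of the commutant gives the unit of the
    connection; symmetry applied after the unit gives antitonicity.\<close>
  have unit: "?le D (?c (?c D))" if "is_algebra C D" "alg_carrier D = alg_carrier A" for D
    by (rule sym[OF refl that(1)]) (use alg[OF that(1)] that(2) in auto)
  have anti: "?le (?c E) (?c D)" if "?le D E" "is_algebra C E" "alg_carrier E = alg_carrier A" for D E
    by (rule sym[OF trans[OF that(1) unit[OF that(2,3)]] alg(1)[OF that(2)]])
  let ?p = "?c A" let ?pp = "?c ?p" let ?ppp = "?c ?pp"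
  note p = alg[OF A] note pp = alg[OF p(1)] note ppp = alg[OF pp(1)]
  have 1: "commutative C A \<longleftrightarrow> ?le A ?p"
    and 3: "commutative C ?pp \<longleftrightarrow> ?le ?pp ?ppp"
    and 4: "commutes_with C A ?pp \<longleftrightarrow> ?le ?pp ?p"
    using p(2) pp(2) by (simp_all add: commutative_def commutes_with_def alg_le_def)
  have "?le ?pp ?p" if "?le A ?p" using anti[OF that p(1,2)] .
  moreover have "?le ?pp ?ppp" if "?le ?pp ?p" using anti[OF that p(1,2)] .
  \<comment> \<open>Antitonicity applied to the unit at \<open>A\<close> puts \<open>?ppp\<close>
    below \<open>?p\<close>.\<close>
  moreover have "?le ?pp ?p" if "?le ?pp ?ppp"
    by (rule trans[OF that anti[OF unit[OF A] pp(1)]]) (use p pp in auto)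
  moreover have "?le A ?p" if "?le ?pp ?p" by (rule trans[OF unit[OF A] that]) simp
  \<comment> \<open>Contracommutativity of \<open>?p\<close> unfolds to commutativity of
    \<open>?pp\<close>, so the second condition coincides with the third.\<close>
  ultimately show ?thesis
    unfolding contracommutative_def 1 3 4 by blast
qed

end
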